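(* Let $\beta\in\{1,\ldots,n\}$ and let $t^\beta=t^\beta(x)$ be the corresponding Saito polynomial. Then the derivatives $v_j=\partial_{x^j}t^\beta(x)$ satisfy $\nabla_i v_j=0$ for all $i,j$, that is $$\nabla_i\nabla_j t^\beta(x)=\nabla_i\partial_{x^j}t^\beta(x)=0,\qquad i,j=1,\ldots,n,$$ if the Dunkl operators have parameter $c=\frac{d_\beta-1}{h}$.
   Context: Let $V=\mathbb C^n$ with standard basis $e_1,\ldots,e_n$, bilinear form $(e_i,e_j)=\delta_{ij}$ and coordinates $x=(x^1,\ldots,x^n)$. Let $W$ be an irreducible finite Coxeter group of rank $n$ acting on $V$ by orthogonal transformations so that $V$ is the complexified reflection representation. Let $\mathcal R\subset V$ be its root system, $\mathcal R_+$ the positive roots, normalized so that $(\gamma,\gamma)=2$, and $\gamma_i=(\gamma,e_i)$. $W$ acts on polynomials by $(wf)(x)=f(w^{-1}x)$; $\mathbb C[x]^W$ is the ring of invariants. Let $d_1\ge\ldots\ge d_n$ be the degrees of $W$ (degrees of homogeneous basic invariants); $h=d_1$ is the Coxeter number. Saito polynomials: homogeneous generators $t^1,\ldots,t^n$ of $\mathbb C[x]^W$ with $\deg t^\alpha=d_\alpha$ such that, writing $g^{\alpha\beta}=\sum_{a=1}^n\frac{\partial t^\alpha}{\partial x^a}\frac{\partial t^\beta}{\partial x^a}$ as polynomials in $t^1,\ldots,t^n$, one has $\partial_{t^1}g^{\alpha\beta}(t)=\delta_{\alpha+\beta,n+1}$ for all $1\le\alpha,\beta\le n$. Such polynomials exist;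 fix a choice. Dunkl operators with parameter $c\in\mathbb C$: $\nabla_i=\partial_{x^i}-c\sum_{\gamma\in\mathcal R_+}\frac{\gamma_i}{(\gamma,x)}(1-s_\gamma)$, where $s_\gamma$ is the orthogonal reflection in the hyperplane $(\gamma,x)=0$. *)

theory Defs
  imports "HOL-Analysis.Analysis"
begin

section \<open>Polynomials on complex coordinate space\<close>

text \<open>
  Polynomials over the infinite field of complex numbers are identified with the functions they
  define. \<open>alg_gen S\<close> is the unital complex algebra of functions generated by \<open>S\<close>; it serves
  for the polynomial ring, for polynomials in auxiliary variables, and for the notion of a
  generating set of an invariant ring.
\<close>

inductive_set alg_gen :: "('a \<Rightarrow> complex) set \<Rightarrow> ('a \<Rightarrow> complex) set"
  for S :: "('a \<Rightarrow> complex) set" where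
  const: "(\<lambda>x. a) \<in> alg_gen S"
| gen: "f \<in> S \<Longrightarrow> f \<in> alg_gen S"
| add: "f \<in> alg_gen S \<Longrightarrow> g \<in> alg_gen S \<Longrightarrow> (\<lambda>x. f x + g x) \<in> alg_gen S"
| mult: "f \<in> alg_gen S \<Longrightarrow> g \<in> alg_gen S \<Longrightarrow> (\<lambda>x. f x * g x) \<in> alg_gen S"

definition poly_ring :: "(complex^'n \<Rightarrow> complex) set" where
  "poly_ring = alg_gen (range (\<lambda>i x. x $ i))"

definition homogeneous :: "nat \<Rightarrow> (complex^'n \<Rightarrow> complex) \<Rightarrow> bool" where
  "homogeneous k f \<longleftrightarrow> f \<in> poly_ring \<and> (\<forall>a x. f (a *s x) = a ^ k * f x)"

definition partial :: "'n \<Rightarrow> (complex^'n \<Rightarrow> complex) \<Rightarrow> complex^'n \<Rightarrow> complex" where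
  "partial i f x = deriv (\<lambda>z. f (x + axis i z)) 0"

section \<open>Finite Coxeter groups and their invariants\<close>

text \<open>The complex bilinear (not Hermitian) form, for which the standard basis is orthonormal.\<close>

definition bform :: "complex^'n \<Rightarrow> complex^'n \<Rightarrow> complex" where
  "bform x y = (\<Sum>i\<in>UNIV. x $ i * y $ i)"

definition reflection :: "complex^'n \<Rightarrow> complex^'n \<Rightarrow> complex^'n" where
  "reflection \<gamma> x = x - (2 * bform \<gamma> x / bform \<gamma> \<gamma>) *s \<gamma>"

text \<open>
  Root systems, with all roots of squared length 2, of finite Coxeter groups whose rank is the
  dimension of the space. \<open>span\<close> is the real span and \<open>vec.span\<close> the complex one. The last two
  clauses say that the form makes the real span of the roots a Euclidean space; this space then
  meets its multiple by the imaginary unit only in 0, so that the whole space is its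
  complexification. The roots themselves need not have real coordinates. As the roots are
  normalized, the only roots proportional to \<open>\<gamma>\<close> are \<open>\<gamma>\<close> and \<open>-\<gamma>\<close>.
\<close>

definition coxeter_root_system :: "(complex^'n) set \<Rightarrow> bool" where
  "coxeter_root_system R \<longleftrightarrow>
     finite R \<and> vec.span R = UNIV \<and>
     (\<forall>\<gamma>\<in>R. bform \<gamma> \<gamma> = 2) \<and>
     (\<forall>\<gamma>\<in>R. reflection \<gamma> ` R = R) \<and>
     (\<forall>\<gamma>\<in>R. \<forall>\<delta>\<in>R. bform \<gamma> \<delta> \<in> \<real>) \<and>
     (\<forall>v\<in>span R. v \<noteq> 0 \<longrightarrow> Re (bform v v) > 0)"

definition irreducible_roots :: "(complex^'n) set \<Rightarrow> bool" where
  "irreducible_roots R \<longleftrightarrow>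
     R \<noteq> {} \<and>
     \<not> (\<exists>R1 R2. R1 \<noteq> {} \<and> R2 \<noteq> {} \<and> R1 \<inter> R2 = {} \<and> R1 \<union> R2 = R \<and>
          (\<forall>\<gamma>\<in>R1. \<forall>\<delta>\<in>R2. bform \<gamma> \<delta> = 0))"

definition positive_roots :: "(complex^'n) set \<Rightarrow> (complex^'n) set \<Rightarrow> bool" where
  "positive_roots R P \<longleftrightarrow>
     (\<exists>l :: complex^'n \<Rightarrow> real. linear l \<and> (\<forall>\<gamma>\<in>R. l \<gamma> \<noteq> 0) \<and> P = {\<gamma>\<in>R. l \<gamma> > 0})"

text \<open>
  Reflections are involutions, so closure under inverses is automatic. The group permutes the finite
  spanning set \<open>R\<close> faithfully and is therefore finite.
\<close>

inductive_set coxeter_group :: "(complex^'n) set \<Rightarrow> (complex^'n \<Rightarrow> complex^'n) set"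
  for R :: "(complex^'n) set" where
  one: "id \<in> coxeter_group R"
| refl: "w \<in> coxeter_group R \<Longrightarrow> \<gamma> \<in> R \<Longrightarrow> reflection \<gamma> \<circ> w \<in> coxeter_group R"

definition act :: "(complex^'n \<Rightarrow> complex^'n) \<Rightarrow> (complex^'n \<Rightarrow> complex) \<Rightarrow> complex^'n \<Rightarrow> complex" where
  "act w f x = f (inv w x)"

definition invariants :: "(complex^'n \<Rightarrow> complex^'n) set \<Rightarrow> (complex^'n \<Rightarrow> complex) set" where
  "invariants W = {f \<in> poly_ring. \<forall>w\<in>W. act w f = f}"

text \<open>
  Families \<open>t\<close>, \<open>d\<close> below are indexed by the natural numbers \<open>1, \<dots>, n\<close> with \<open>n = CARD('n)\<close>; their
  values at other indices are irrelevant. For a finite group, \<open>n\<close> polynomials that generate the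
  algebra of invariants are automatically algebraically independent.
\<close>

definition basic_invariants ::
  "(complex^'n \<Rightarrow> complex^'n) set \<Rightarrow> (nat \<Rightarrow> nat) \<Rightarrow> (nat \<Rightarrow> complex^'n \<Rightarrow> complex) \<Rightarrow> bool" where
  "basic_invariants W d t \<longleftrightarrow>
     (\<forall>\<alpha>\<in>{1..CARD('n)}. homogeneous (d \<alpha>) (t \<alpha>)) \<and>
     alg_gen (t ` {1..CARD('n)}) = invariants W"

definition group_degrees :: "(complex^'n \<Rightarrow> complex^'n) set \<Rightarrow> (nat \<Rightarrow> nat) \<Rightarrow> bool" where
  "group_degrees W d \<longleftrightarrow>
     (\<exists>u. basic_invariants W d u) \<and>
     (\<forall>\<alpha>\<in>{1..CARD('n)}. \<forall>\<beta>\<in>{1..CARD('n)}. \<alpha> \<le> \<beta> \<longrightarrow> d \<beta> \<le> d \<alpha>)"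

section \<open>Saito polynomials\<close>

text \<open>
  \<open>G\<close> is the polynomial in the variables \<open>y 1, \<dots>, y n\<close> that expresses \<open>g\<^sup>\<alpha>\<^sup>\<beta>\<close> through
  \<open>t 1, \<dots>, t n\<close>.
\<close>

definition saito_polynomials ::
  "(complex^'n \<Rightarrow> complex^'n) set \<Rightarrow> (nat \<Rightarrow> nat) \<Rightarrow> (nat \<Rightarrow> complex^'n \<Rightarrow> complex) \<Rightarrow> bool" where
  "saito_polynomials W d t \<longleftrightarrow>
     basic_invariants W d t \<and>
     (\<forall>\<alpha>\<in>{1..CARD('n)}. \<forall>\<beta>\<in>{1..CARD('n)}.
        \<exists>G \<in> alg_gen ((\<lambda>\<mu> (y :: nat \<Rightarrow> complex). y \<mu>) ` {1..CARD('n)}).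
          (\<forall>x. (\<Sum>a\<in>UNIV. partial a (t \<alpha>) x * partial a (t \<beta>) x) = G (\<lambda>\<mu>. t \<mu> x)) \<and>
          (\<forall>y. deriv (\<lambda>z. G (y(1 := z))) (y 1) = (if \<alpha> + \<beta> = CARD('n) + 1 then 1 else 0)))"

section \<open>Dunkl operators\<close>

text \<open>
  \<open>divdiff \<gamma> f\<close> is the polynomial quotient of \<open>f - s\<^sub>\<gamma> f\<close> by the linear form \<open>(\<gamma>, x)\<close>; pointwise
  division would give the wrong value 0 on the mirror. The lemma \<open>divdiff_ex1\<close> below shows that it
  is well defined.
\<close>

definition divdiff :: "complex^'n \<Rightarrow> (complex^'n \<Rightarrow> complex) \<Rightarrow> complex^'n \<Rightarrow> complex" where
  "divdiff \<gamma> f =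
     (THE q. q \<in> poly_ring \<and> (\<forall>x. bform \<gamma> x * q x = f x - act (reflection \<gamma>) f x))"

definition dunkl ::
  "(complex^'n) set \<Rightarrow> complex \<Rightarrow> 'n \<Rightarrow> (complex^'n \<Rightarrow> complex) \<Rightarrow> complex^'n \<Rightarrow> complex" where
  "dunkl P c i f x = partial i f x - c * (\<Sum>\<gamma>\<in>P. \<gamma> $ i * divdiff \<gamma> f x)"

lemma bform_add: "bform \<gamma> (x + y) = bform \<gamma> x + bform \<gamma> y"
  by (simp add: bform_def algebra_simps sum.distrib)

lemma bform_scale: "bform \<gamma> (a *s x) = a * bform \<gamma> x"
  by (simp add: bform_def sum_distrib_left mult_ac)

lemma reflection_reflection:
  assumes "bform \<gamma> \<gamma> \<noteq> 0"
  shows "reflection \<gamma> (reflection \<gamma> x) = x"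
proof -
  have "bform \<gamma> (reflection \<gamma> x) = - bform \<gamma> x"
    using bform_add[of \<gamma> "reflection \<gamma> x" "(2 * bform \<gamma> x / bform \<gamma> \<gamma>) *s \<gamma>"] assms
    by (simp add: reflection_def bform_scale eq_neg_iff_add_eq_0 add.commute)
  then show ?thesis
    by (simp add: reflection_def vec_eq_iff)
qed

lemma inv_reflection: "bform \<gamma> \<gamma> \<noteq> 0 \<Longrightarrow> inv (reflection \<gamma>) = reflection \<gamma>"
  by (rule inv_unique_comp) (auto simp: fun_eq_iff reflection_reflection)

lemma continuous_on_poly_ring:
  assumes "f \<in> poly_ring"
  shows "continuous_on UNIV f"
  using assms unfolding poly_ring_def
  by induction (auto intro!: continuous_intros)

lemma poly_ring_bform: "bform \<gamma> \<in> poly_ring"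
proof -
  have "(\<lambda>x. \<Sum>i\<in>A. \<gamma> $ i * x $ i) \<in> poly_ring" if "finite A" for A
    using that
  proof (induction A)
    case empty
    then show ?case by (simp add: poly_ring_def alg_gen.const)
  next
    case (insert k A)
    have "(\<lambda>x. \<gamma> $ k * x $ k + (\<Sum>i\<in>A. \<gamma> $ i * x $ i)) \<in> poly_ring"
      using insert.IH unfolding poly_ring_def
      by (intro alg_gen.add alg_gen.mult alg_gen.const) (auto intro: alg_gen.gen)
    then show ?case using insert.hyps by simp
  qed
  from this[of UNIV] show ?thesis
    by (simp add: bform_def[abs_def])
qed

lemma poly_ring_reflection:
  assumes "f \<in> poly_ring"
  shows "(\<lambda>x. f (reflection \<gamma> x)) \<in> poly_ring"
  using assms unfolding poly_ring_def
proof induction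
  case (gen f)
  then obtain i where f: "f = (\<lambda>x. x $ i)" by auto
  have "(\<lambda>x. x $ i + (- 2 / bform \<gamma> \<gamma> * \<gamma> $ i) * bform \<gamma> x) \<in> alg_gen (range (\<lambda>i x. x $ i))"
    using poly_ring_bform[of \<gamma>] unfolding poly_ring_def
    by (intro alg_gen.add alg_gen.mult[OF alg_gen.const]) (auto intro: alg_gen.gen)
  moreover have "(\<lambda>x. x $ i + (- 2 / bform \<gamma> \<gamma> * \<gamma> $ i) * bform \<gamma> x) = (\<lambda>x. f (reflection \<gamma> x))"
    by (simp add: f reflection_def fun_eq_iff)
  ultimately show ?case by simp
qed (auto intro: alg_gen.intros)

lemma divdiff_ex:
  assumes "f \<in> poly_ring"
  shows "\<exists>q\<in>poly_ring. \<forall>x. bform \<gamma> x * q x = f x - f (reflection \<gamma> x)"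
  using assms[unfolded poly_ring_def]
proof induction
  case (const a)
  then show ?case
    by (intro bexI[of _ "\<lambda>_. 0"]) (auto simp: poly_ring_def intro: alg_gen.const)
next
  case (gen f)
  then obtain i where f: "f = (\<lambda>x. x $ i)" by auto
  show ?case
    by (intro bexI[of _ "\<lambda>_. 2 / bform \<gamma> \<gamma> * \<gamma> $ i"])
      (auto simp: f reflection_def poly_ring_def intro: alg_gen.const)
next
  case (add f g)
  then obtain p q where "p \<in> poly_ring" "q \<in> poly_ring"
    "\<forall>x. bform \<gamma> x * p x = f x - f (reflection \<gamma> x)"
    "\<forall>x. bform \<gamma> x * q x = g x - g (reflection \<gamma> x)" by blast
  then show ?case
    by (intro bexI[of _ "\<lambda>x. p x + q x"])
      (auto simp: poly_ring_def algebra_simps intro: alg_gen.add)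
next
  case (mult f g)
  then obtain p q where pq: "p \<in> poly_ring" "q \<in> poly_ring"
    "\<And>x. bform \<gamma> x * p x = f x - f (reflection \<gamma> x)"
    "\<And>x. bform \<gamma> x * q x = g x - g (reflection \<gamma> x)" by blast
  have "bform \<gamma> x * (p x * g x + f (reflection \<gamma> x) * q x)
      = (bform \<gamma> x * p x) * g x + f (reflection \<gamma> x) * (bform \<gamma> x * q x)" for x
    by (simp add: algebra_simps)
  then have "bform \<gamma> x * (p x * g x + f (reflection \<gamma> x) * q x)
      = f x * g x - f (reflection \<gamma> x) * g (reflection \<gamma> x)" for x
    unfolding pq(3,4) by (simp add: left_diff_distrib right_diff_distrib)
  moreover have "(\<lambda>x. p x * g x + f (reflection \<gamma> x) * q x) \<in> poly_ring"
    using mult.hyps pq poly_ring_reflection[of f \<gamma>]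
    unfolding poly_ring_def by (intro alg_gen.add alg_gen.mult) auto
  ultimately show ?case
    by (intro bexI[of _ "\<lambda>x. p x * g x + f (reflection \<gamma> x) * q x"])
      blast+
qed

lemma poly_ring_cancel_bform:
  assumes "p \<in> poly_ring" "q \<in> poly_ring" "bform \<gamma> \<gamma> \<noteq> 0"
    and eq: "\<And>x. bform \<gamma> x * p x = bform \<gamma> x * q x"
  shows "p = q"
proof
  fix x
  show "p x = q x"
  proof (cases "bform \<gamma> x = 0")
    case False
    then show ?thesis using eq[of x] by simp
  next
    case True
    let ?X = "\<lambda>k::nat. x + of_real (inverse (real (Suc k))) *s \<gamma>"
    have "bform \<gamma> (?X k) \<noteq> 0" for k
      using assms(3) True by (simp add: bform_add bform_scale del: of_nat_Suc)
    then have same: "p (?X k) = q (?X k)" for k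
      using eq[of "?X k"] by simp
    have "(\<lambda>k. of_real (inverse (real (Suc k))) :: complex) \<longlonglongrightarrow> of_real 0"
      by (rule tendsto_of_real[OF LIMSEQ_inverse_real_of_nat])
    then have "(\<lambda>k. x $ i + of_real (inverse (real (Suc k))) * \<gamma> $ i) \<longlonglongrightarrow> x $ i + of_real 0 * \<gamma> $ i" for i
      by (intro tendsto_add tendsto_mult tendsto_const)
    then have X: "?X \<longlonglongrightarrow> x"
      by (intro vec_tendstoI) simp
    have "(\<lambda>k. f (?X k)) \<longlonglongrightarrow> f x" if "f \<in> poly_ring" for f :: "complex^'a \<Rightarrow> complex"
      using continuous_on_tendsto_compose[OF continuous_on_poly_ring[OF that] X] by simp
    from this[OF assms(1)] this[OF assms(2)] show ?thesis
      unfolding same by (rule LIMSEQ_unique)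
  qed
qed

lemma divdiff_ex1:
  assumes "f \<in> poly_ring" "bform \<gamma> \<gamma> \<noteq> 0"
  shows "\<exists>!q. q \<in> poly_ring \<and> (\<forall>x. bform \<gamma> x * q x = f x - act (reflection \<gamma>) f x)"
proof -
  obtain q where q: "q \<in> poly_ring" "\<forall>x. bform \<gamma> x * q x = f x - f (reflection \<gamma> x)"
    using divdiff_ex[OF assms(1)] by blast
  show ?thesis
  proof (rule ex1I[of _ q])
    show "q \<in> poly_ring \<and> (\<forall>x. bform \<gamma> x * q x = f x - act (reflection \<gamma>) f x)"
      using q by (simp add: act_def inv_reflection assms(2))
  next
    fix p
    assume "p \<in> poly_ring \<and> (\<forall>x. bform \<gamma> x * p x = f x - act (reflection \<gamma>) f x)"
    then show "p = q"
      using q assms(2)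
      by (intro poly_ring_cancel_bform[of p q \<gamma>]) (simp_all add: act_def inv_reflection)
  qed
qed

end

(*
  Write H_b for the Hessian of t^b. Since the gradient of t^b is W-equivariant, the claim says
  H_b = (d_b - 1)/h * sum over positive roots of gamma gamma^T (gamma, grad t^b)/(gamma, x).

  The Hessians commute: H_k grad t^b is equivariant, hence a combination of the grad t^i whose
  coefficients Gamma^i are polynomials in t. The Koszul formula writes g Gamma as a polynomial of
  degree at most 1 in t^1, and g is of degree 1 in t^1 with invertible leading coefficient, so Gamma
  does not depend on t^1. The curl of H_k grad t^b, contracted with g twice, is then quadratic in t^1
  on the one hand and linear on the other, so it vanishes; it is the commutator of H_k and H_b.
  Applied to x, commutation gives (d_b - 1) H_k grad t^b = (d_k - 1) H_b grad t^k.

  Hence H_b/(d_b - 1) = T(grad t^b) for a symmetric 3-tensor T with at most simple poles along the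
  mirrors. At a generic point of a mirror the gradients satisfy one linear relation; together with
  d_b + d_(n+1-b) = h + 2 it shows that the residues are those of 1/h sum gamma^3/(gamma, x). The
  difference of the two tensors is polynomial and homogeneous of degree -1, hence zero.
*)
theory Submission
  imports Defs "HOL-Computational_Algebra.Fundamental_Theorem_Algebra"
begin

section \<open>Polynomial functions\<close>

text \<open>The invariant theory that the argument rests on is derived from the generating property
  alone. The obstacle is to know where the gradients of the generators are independent and how they
  degenerate. At a point with known stabilizer, averaging over the group yields invariants with any
  jet that the stabilizer fixes, and their gradients are combinations of those of the generators.
  This gives independence off the mirrors and a single relation where the stabilizer is generated by
  one reflection. All other points lie in codimension two, so a generic complex line misses them,
  and a polynomial without zeros on a complex line is constant there. Hence the Jacobian is a
  nonzero constant times the product of the positive roots, and divisibility by it can be tested at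
  generic points of the mirrors. Dependence on the basic invariants is expressed by derivations
  \<open>D i\<close> of the ring of invariants, so that no polynomials in auxiliary variables have
  to be chosen: degree at most k in one generator becomes annihilation by the power k + 1 of its
  derivation.\<close>

lemma poly_ring_const [intro]: "(\<lambda>x. a) \<in> poly_ring"
  by (simp add: poly_ring_def alg_gen.const)

lemma poly_ring_coord [intro]: "(\<lambda>x. x $ i) \<in> poly_ring"
  unfolding poly_ring_def by (rule alg_gen.gen) auto

lemma poly_ring_add [intro]:
  "f \<in> poly_ring \<Longrightarrow> g \<in> poly_ring \<Longrightarrow> (\<lambda>x. f x + g x) \<in> poly_ring"
  by (simp add: poly_ring_def alg_gen.add)

lemma poly_ring_mult [intro]:
  "f \<in> poly_ring \<Longrightarrow> g \<in> poly_ring \<Longrightarrow> (\<lambda>x. f x * g x) \<in> poly_ring"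
  by (simp add: poly_ring_def alg_gen.mult)

lemma poly_ring_induct [consumes 1, case_names const coord add mult]:
  assumes "f \<in> poly_ring"
    and "\<And>a. Q (\<lambda>x. a)" "\<And>i. Q (\<lambda>x. x $ i)"
    and "\<And>f g. f \<in> poly_ring \<Longrightarrow> g \<in> poly_ring \<Longrightarrow> Q f \<Longrightarrow> Q g \<Longrightarrow> Q (\<lambda>x. f x + g x)"
    and "\<And>f g. f \<in> poly_ring \<Longrightarrow> g \<in> poly_ring \<Longrightarrow> Q f \<Longrightarrow> Q g \<Longrightarrow> Q (\<lambda>x. f x * g x)"
  shows "Q f"
  using assms(1) unfolding poly_ring_def
  by induction (use assms(2-) in \<open>auto simp: poly_ring_def\<close>)

lemma poly_ring_uminus [intro]: "f \<in> poly_ring \<Longrightarrow> (\<lambda>x. - f x) \<in> poly_ring"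
  using poly_ring_mult[OF poly_ring_const[of "-1"], of f] by simp

lemma poly_ring_diff [intro]:
  "f \<in> poly_ring \<Longrightarrow> g \<in> poly_ring \<Longrightarrow> (\<lambda>x. f x - g x) \<in> poly_ring"
  using poly_ring_add[OF _ poly_ring_uminus, of f g] by simp

lemma poly_ring_divide [intro]: "f \<in> poly_ring \<Longrightarrow> (\<lambda>x. f x / a) \<in> poly_ring"
  using poly_ring_mult[OF _ poly_ring_const[of "1 / a"], of f] by simp

lemma poly_ring_sum [intro]:
  "(\<And>i. i \<in> A \<Longrightarrow> f i \<in> poly_ring) \<Longrightarrow> (\<lambda>x. \<Sum>i\<in>A. f i x) \<in> poly_ring"
  by (induction A rule: infinite_finite_induct) auto

lemma poly_ring_prod [intro]:
  "(\<And>i. i \<in> A \<Longrightarrow> f i \<in> poly_ring) \<Longrightarrow> (\<lambda>x. \<Prod>i\<in>A. f i x) \<in> poly_ring"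
  by (induction A rule: infinite_finite_induct) auto

lemma poly_ring_power [intro]: "f \<in> poly_ring \<Longrightarrow> (\<lambda>x. f x ^ k) \<in> poly_ring"
  by (induction k) auto

lemma poly_ring_det:
  assumes "\<And>i j. (\<lambda>x. M x $ i $ j) \<in> poly_ring"
  shows "(\<lambda>x. det (M x)) \<in> poly_ring"
  unfolding det_def by (intro poly_ring_sum poly_ring_mult poly_ring_const poly_ring_prod assms)

lemma poly_ring_compose:
  assumes "f \<in> poly_ring" "\<And>i. (\<lambda>x. L x $ i) \<in> poly_ring"
  shows "(\<lambda>x. f (L x)) \<in> poly_ring"
  using assms(1) by (induction rule: poly_ring_induct) (use assms(2) in auto)

text \<open>The bridge to univariate polynomials: root counting, orders of vanishing and the
  fundamental theorem of algebra are all applied along lines.\<close>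

lemma poly_ring_on_line:
  assumes "f \<in> poly_ring"
  obtains p where "\<And>z. f (a + z *s b) = poly p z"
proof -
  have "\<exists>p. \<forall>z. f (a + z *s b) = poly p z"
    using assms
  proof (induction rule: poly_ring_induct)
    case (const c)
    then show ?case by (intro exI[of _ "[:c:]"]) simp
  next
    case (coord i)
    then show ?case by (intro exI[of _ "[:a $ i, b $ i:]"]) simp
  next
    case (add f g)
    then show ?case by (metis poly_add)
  next
    case (mult f g)
    then show ?case by (metis poly_mult)
  qed
  then show ?thesis using that by blast
qed

text \<open>On the line joining a point where \<open>f\<close> is nonzero to one where
  \<open>g\<close> is nonzero, both restrictions are nonzero univariate polynomials, and so is their
  product.\<close>

lemma poly_ring_mult_eq_0:
  assumes "f \<in> poly_ring" "g \<in> poly_ring" "\<And>x. f x * g x = 0"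
  shows "f = (\<lambda>x. 0) \<or> g = (\<lambda>x. 0)"
proof (rule ccontr)
  assume "\<not> ?thesis"
  then obtain a b where ab: "f a \<noteq> 0" "g b \<noteq> 0" by (auto simp: fun_eq_iff)
  obtain p where p: "\<And>z. f (a + z *s (b - a)) = poly p z"
    using poly_ring_on_line[OF assms(1)] by blast
  obtain q where q: "\<And>z. g (a + z *s (b - a)) = poly q z"
    using poly_ring_on_line[OF assms(2)] by blast
  have "poly (p * q) z = 0" for z
    using assms(3)[of "a + z *s (b - a)"] p q by simp
  then have "p * q = 0" using poly_all_0_iff_0 by blast
  moreover have "poly p 0 \<noteq> 0" "poly q 1 \<noteq> 0"
    using p[of 0] q[of 1] ab by simp_all
  ultimately show False by auto
qed

text \<open>Algebraic form of a density argument: identities between polynomials may be checked off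
  the zero set of any nonzero polynomial, mostly the Jacobian.\<close>

lemma poly_ring_cancel:
  assumes "f \<in> poly_ring" "g \<in> poly_ring" "h \<in> poly_ring" "f \<noteq> (\<lambda>x. 0)"
    and "\<And>x. f x \<noteq> 0 \<Longrightarrow> g x = h x"
  shows "g = h"
proof -
  have "f = (\<lambda>x. 0) \<or> (\<lambda>x. g x - h x) = (\<lambda>x. 0)"
    using assms by (intro poly_ring_mult_eq_0) auto
  then show ?thesis using assms(4) by (auto simp: fun_eq_iff)
qed

lemma poly_ring_common_nonzero:
  assumes "finite A" "\<And>i. i \<in> A \<Longrightarrow> f i \<in> poly_ring" "\<And>i. i \<in> A \<Longrightarrow> f i \<noteq> (\<lambda>x. 0)"
  shows "\<exists>x. \<forall>i\<in>A. f i x \<noteq> 0"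
proof -
  have "(\<lambda>x. \<Prod>i\<in>A. f i x) \<noteq> (\<lambda>x. 0)"
    using assms
  proof (induction A)
    case empty
    then show ?case by (simp add: fun_eq_iff)
  next
    case (insert a A)
    have "f a = (\<lambda>x. 0) \<or> (\<lambda>x. \<Prod>i\<in>A. f i x) = (\<lambda>x. 0)"
      if "(\<lambda>x. f a x * (\<Prod>i\<in>A. f i x)) = (\<lambda>x. 0)"
      using insert.prems(1) fun_cong[OF that]
      by (intro poly_ring_mult_eq_0 poly_ring_prod) auto
    then have "(\<lambda>x. f a x * (\<Prod>i\<in>A. f i x)) \<noteq> (\<lambda>x. 0)"
      using insert.IH insert.prems by blast
    then show ?case using insert.hyps by simp
  qed
  then show ?thesis using assms(1) by (auto simp: fun_eq_iff prod_zero_iff)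
qed

lemma poly_eq_if_eq_off_0:
  fixes p q :: "complex poly"
  assumes "\<And>z. z \<noteq> 0 \<Longrightarrow> poly p z = poly q z"
  shows "p = q"
proof (rule ccontr)
  assume "p \<noteq> q"
  then have "finite {z. poly (p - q) z = 0}" by (intro poly_roots_finite) simp
  moreover have "UNIV - {0} \<subseteq> {z. poly (p - q) z = 0}" using assms by auto
  ultimately have "finite (UNIV - {0::complex})" by (rule finite_subset[rotated])
  then show False by (simp add: infinite_UNIV_char_0)
qed

text \<open>Along the line through 0 and \<open>x\<close> the hypothesis reads z p(z) = f(x) for
  nonzero z, hence also for z = 0. In other words, no nonzero polynomial is homogeneous of degree
  -1.\<close>

lemma poly_ring_scale_zero:
  assumes "f \<in> poly_ring" and "\<And>s. s \<noteq> 0 \<Longrightarrow> s * f (s *s x) = f x"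
  shows "f x = 0"
proof -
  obtain p where p: "\<And>z. f (0 + z *s x) = poly p z"
    using poly_ring_on_line[OF assms(1)] by blast
  have "[:0, 1:] * p = [:f x:]"
    using assms(2) by (intro poly_eq_if_eq_off_0) (simp flip: p)
  then have "poly ([:0, 1:] * p) 0 = poly [:f x:] 0" by simp
  then show ?thesis by simp
qed

section \<open>Partial derivatives of polynomials\<close>

lemma poly_ring_field_differentiable_line:
  assumes "f \<in> poly_ring"
  shows "((\<lambda>z. f (x + axis i z)) has_field_derivative partial i f x) (at 0)"
proof -
  have "\<exists>D. ((\<lambda>z. f (x + axis i z)) has_field_derivative D) (at 0)"
    using assms
  proof (induction rule: poly_ring_induct)
    case (coord j)
    then show ?case
      by (cases "i = j") (auto simp: axis_def intro!: exI derivative_eq_intros)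
  next
    case (add f g)
    then obtain D E where "((\<lambda>z. f (x + axis i z)) has_field_derivative D) (at 0)"
      "((\<lambda>z. g (x + axis i z)) has_field_derivative E) (at 0)" by blast
    from DERIV_add[OF this] show ?case by blast
  next
    case (mult f g)
    then obtain D E where "((\<lambda>z. f (x + axis i z)) has_field_derivative D) (at 0)"
      "((\<lambda>z. g (x + axis i z)) has_field_derivative E) (at 0)" by blast
    from DERIV_mult[OF this] show ?case by blast
  qed (auto intro: exI[of _ 0])
  then show ?thesis unfolding partial_def using DERIV_imp_deriv by blast
qed

lemma partial_eqI:
  "((\<lambda>z. f (x + axis i z)) has_field_derivative D) (at 0) \<Longrightarrow> partial i f x = D"
  unfolding partial_def by (rule DERIV_imp_deriv)

lemma partial_const [simp]: "partial i (\<lambda>x. a) = (\<lambda>x. 0)"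
  by (auto intro!: partial_eqI)

lemma partial_coord [simp]: "partial i (\<lambda>x. x $ j) = (\<lambda>x. if i = j then 1 else 0)"
  by (rule ext, rule partial_eqI) (auto simp: axis_def intro!: derivative_eq_intros)

lemma partial_add:
  assumes "f \<in> poly_ring" "g \<in> poly_ring"
  shows "partial i (\<lambda>x. f x + g x) = (\<lambda>x. partial i f x + partial i g x)"
  by (rule ext, rule partial_eqI)
    (intro DERIV_add poly_ring_field_differentiable_line assms)

lemma partial_diff:
  assumes "f \<in> poly_ring" "g \<in> poly_ring"
  shows "partial i (\<lambda>x. f x - g x) = (\<lambda>x. partial i f x - partial i g x)"
  by (rule ext, rule partial_eqI)
    (intro DERIV_diff poly_ring_field_differentiable_line assms)

lemma partial_mult:
  assumes "f \<in> poly_ring" "g \<in> poly_ring"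
  shows "partial i (\<lambda>x. f x * g x) = (\<lambda>x. partial i f x * g x + f x * partial i g x)"
  using DERIV_mult[OF poly_ring_field_differentiable_line[OF assms(1), of _ i]
      poly_ring_field_differentiable_line[OF assms(2)]]
  by (intro ext partial_eqI) (auto simp: algebra_simps axis_def zero_vec_def[symmetric] elim!: DERIV_cong)

lemma partial_cmult:
  "f \<in> poly_ring \<Longrightarrow> partial i (\<lambda>x. a * f x) = (\<lambda>x. a * partial i f x)"
  by (subst partial_mult) auto

lemma partial_sum:
  assumes "\<And>k. k \<in> A \<Longrightarrow> f k \<in> poly_ring"
  shows "partial i (\<lambda>x. \<Sum>k\<in>A. f k x) = (\<lambda>x. \<Sum>k\<in>A. partial i (f k) x)"
  using assms
  by (induction A rule: infinite_finite_induct) (auto simp: partial_add poly_ring_sum)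

lemma partial_poly_ring [intro]:
  assumes "f \<in> poly_ring"
  shows "partial i f \<in> poly_ring"
  using assms
  by (induction rule: poly_ring_induct) (auto simp: partial_add partial_mult)

lemma partial_commute:
  assumes "f \<in> poly_ring"
  shows "partial i (partial j f) = partial j (partial i f)"
  using assms
proof (induction rule: poly_ring_induct)
  case (mult f g)
  then show ?case
    by (simp add: partial_mult partial_add partial_poly_ring poly_ring_mult fun_eq_iff algebra_simps)
qed (auto simp: partial_add partial_poly_ring)

lemma poly_ring_chain:
  assumes "f \<in> poly_ring"
    and "\<And>i. ((\<lambda>z. u z $ i) has_field_derivative v i) (at z)"
  shows "((\<lambda>z. f (u z)) has_field_derivative (\<Sum>i\<in>UNIV. v i * partial i f (u z))) (at z)"
  using assms(1)
proof (induction rule: poly_ring_induct)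
  case (coord i)
  then show ?case using assms(2)[of i] by (simp add: if_distrib cong: if_cong)
next
  case (add f g)
  then show ?case
    by (auto simp: partial_add algebra_simps sum.distrib intro!: derivative_eq_intros)
next
  case (mult f g)
  then show ?case
    by (auto simp: partial_mult algebra_simps sum.distrib sum_distrib_left
        intro!: derivative_eq_intros)
qed auto

lemma euler_homogeneous:
  assumes "f \<in> poly_ring" "\<And>a x. f (a *s x) = a ^ k * f x"
  shows "(\<Sum>i\<in>UNIV. x $ i * partial i f x) = of_nat k * f x"
proof -
  have "((\<lambda>z. f (z *s x)) has_field_derivative (\<Sum>i\<in>UNIV. x $ i * partial i f (1 *s x))) (at 1)"
    by (rule poly_ring_chain[OF assms(1)]) (auto intro!: derivative_eq_intros)
  moreover have "((\<lambda>z. f (z *s x)) has_field_derivative of_nat k * f x) (at 1)"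
    unfolding assms(2) by (auto intro!: derivative_eq_intros)
  ultimately show ?thesis using DERIV_unique by fastforce
qed

lemma partial_scale:
  assumes "f \<in> poly_ring"
  shows "partial i (\<lambda>x. f (a *s x)) x = a * partial i f (a *s x)"
proof (rule partial_eqI)
  have "((\<lambda>z. f (a *s (x + axis i z))) has_field_derivative
      (\<Sum>j\<in>UNIV. (if j = i then a else 0) * partial j f (a *s (x + axis i 0)))) (at 0)"
    by (rule poly_ring_chain[OF assms]) (auto simp: axis_def intro!: derivative_eq_intros)
  moreover have "(\<Sum>j\<in>UNIV. (if j = i then a else 0) * partial j f (a *s (x + axis i 0)))
      = a * partial i f (a *s x)"
    by (simp add: if_distrib[of "\<lambda>u. u * _"] axis_def zero_vec_def[symmetric] cong: if_cong)
  ultimately show "((\<lambda>z. f (a *s (x + axis i z))) has_field_derivative a * partial i f (a *s x)) (at 0)"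
    by simp
qed

text \<open>The factor \<open>a\<close> on the left covers k = 0 without the truncated exponent k -
  1. Later scaling laws are written in the same way.\<close>

lemma partial_homogeneous:
  assumes "f \<in> poly_ring" "\<And>a x. f (a *s x) = a ^ k * f x"
  shows "a * partial i f (a *s x) = a ^ k * partial i f x"
  using partial_scale[OF assms(1), of i a x] partial_cmult[OF assms(1), of i "a ^ k"]
  unfolding assms(2) by simp

declare poly_ring_bform [intro]

lemmas poly_ring_intros = poly_ring_const poly_ring_coord poly_ring_add poly_ring_mult
  poly_ring_uminus poly_ring_diff poly_ring_divide poly_ring_sum poly_ring_prod poly_ring_power
  poly_ring_bform partial_poly_ring

section \<open>The bilinear form and reflections\<close>

lemma bform_commute: "bform x y = bform y x"
  by (simp add: bform_def mult.commute)

lemma bform_add_left: "bform (x + y) z = bform x z + bform y z"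
  by (simp add: bform_add bform_commute[of _ z])

lemma bform_scale_left: "bform (a *s x) z = a * bform x z"
  by (simp add: bform_scale bform_commute[of _ z])

lemma bform_minus: "bform x (- y) = - bform x y"
  by (simp add: bform_def sum_negf)

lemma bform_minus_left: "bform (- x) y = - bform x y"
  by (simp add: bform_def sum_negf)

lemma bform_diff: "bform x (y - z) = bform x y - bform x z"
  by (simp add: bform_def algebra_simps sum_subtractf)

lemma bform_diff_left: "bform (x - y) z = bform x z - bform y z"
  by (simp add: bform_diff bform_commute[of _ z])

lemma bform_0 [simp]: "bform x 0 = 0" "bform 0 x = 0"
  by (simp_all add: bform_def)

lemma bform_axis: "bform x (axis i 1) = x $ i"
  by (simp add: bform_def axis_def if_distrib cong: if_cong)

lemmas bform_simps = bform_add bform_add_left bform_scale bform_scale_left bform_minus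
  bform_minus_left bform_diff bform_diff_left

lemma bform_eqI: "(\<And>y. bform x y = bform x' y) \<Longrightarrow> x = x'"
  by (metis bform_axis vec_eq_iff)

lemma bform_reflection:
  "bform \<gamma> \<gamma> \<noteq> 0 \<Longrightarrow> bform (reflection \<gamma> x) (reflection \<gamma> y) = bform x y"
  by (simp add: reflection_def bform_simps bform_commute[of x \<gamma>] field_simps)

lemma reflection_fixed: "bform \<gamma> x = 0 \<Longrightarrow> reflection \<gamma> x = x"
  by (simp add: reflection_def)

lemma bform_reflection_self: "bform \<gamma> \<gamma> \<noteq> 0 \<Longrightarrow> bform \<gamma> (reflection \<gamma> x) = - bform \<gamma> x"
  by (simp add: reflection_def bform_simps)

definition reflection_matrix :: "complex^'n \<Rightarrow> complex^'n^'n" where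
  "reflection_matrix v = (\<chi> i j. (if i = j then 1 else 0) - 2 / bform v v * v $ i * v $ j)"

lemma reflection_matrix: "reflection_matrix v *v x = reflection v x"
proof -
  have "(\<Sum>j\<in>UNIV. ((if i = j then 1 else 0) - 2 / bform v v * v $ i * v $ j) * x $ j)
      = x $ i - 2 * bform v x / bform v v * v $ i" for i
  proof -
    have "(\<Sum>j\<in>UNIV. ((if i = j then 1 else 0) - 2 / bform v v * v $ i * v $ j) * x $ j)
        = (\<Sum>j\<in>UNIV. (if i = j then x $ j else 0) - 2 / bform v v * v $ i * (v $ j * x $ j))"
      by (rule sum.cong) (auto simp: algebra_simps)
    also have "\<dots> = x $ i - 2 / bform v v * v $ i * bform v x"
      by (simp only: sum_subtractf bform_def[of v x] sum_distrib_left) simp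
    finally show ?thesis by (simp add: algebra_simps)
  qed
  then show ?thesis
    by (simp add: vec_eq_iff matrix_vector_mult_def reflection_matrix_def reflection_def)
qed

text \<open>
  In the basis where \<open>e\<^sub>j\<close> is replaced by \<open>v\<close> (for some \<open>v\<^sub>j \<noteq> 0\<close>), the reflection is the identity
  matrix with row \<open>j\<close> replaced.
\<close>

lemma det_reflection_matrix:
  assumes "bform v v \<noteq> 0"
  shows "det (reflection_matrix v) = - 1"
proof -
  from assms have "v \<noteq> 0" by auto
  then obtain j where j: "v $ j \<noteq> 0"
    by (auto simp: vec_eq_iff)
  define c where "c = 2 / bform v v"
  \<comment> \<open>Row j of the reflection in the new basis: \<open>v\<close> goes to
    \<open>- v\<close>, and any other basis vector with index l goes to itself minus c times
    \<open>v $ l\<close> times \<open>v\<close>.\<close>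
  define r where "r = (\<chi> l. if l = j then - 1 else - c * v $ l)"
  define B where "B = (\<chi> i l. if l = j then (mat 1 *v v) $ i else (mat 1 :: complex^'a^'a) $ i $ l)"
  define C where "C = (\<chi> i. if i = j then \<Sum>m\<in>UNIV. r $ m *s row m (mat 1 :: complex^'a^'a)
      else row i (mat 1))"
  have "det B = v $ j"
    unfolding B_def by (subst cramer_lemma) simp
  moreover have "det C = - 1"
    unfolding C_def by (subst cramer_lemma_transpose) (simp add: r_def)
  moreover have "reflection_matrix v ** B = B ** C"
  proof -
    have B: "B *v x = x + x $ j *s (v - axis j 1)" for x
    proof -
      have *: "(\<Sum>l\<in>UNIV. (if l = j then v $ i else if i = l then 1 else 0) * x $ l)
          = (\<Sum>l\<in>UNIV. (if i = l then x $ l else 0)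
              + (if l = j then v $ i * x $ l - (if i = j then x $ l else 0) else 0))" for i
        by (rule sum.cong) auto
      then have "(\<Sum>l\<in>UNIV. (if l = j then v $ i else if i = l then 1 else 0) * x $ l)
          = x $ i + x $ j * (v $ i - (if i = j then 1 else 0))" for i
        unfolding * by (simp add: sum.distrib mult.commute right_diff_distrib)
      moreover have "(B *v x) $ i
          = (\<Sum>l\<in>UNIV. (if l = j then v $ i else if i = l then 1 else 0) * x $ l)" for i
        unfolding B_def matrix_vector_mul_lid
        by (simp add: matrix_vector_mult_def mat_def cong: if_cong)
      ultimately show ?thesis
        by (simp add: vec_eq_iff axis_def algebra_simps)
    qed
    have row: "(\<Sum>m\<in>UNIV. r $ m *s row m (mat 1 :: complex^'a^'a)) = r"
    proof -
      have "(\<Sum>m\<in>UNIV. r $ m * (if m = i then 1 else 0)) = r $ i" for i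
        by (subst sum.remove[of _ i]) auto
      then show ?thesis by (simp add: vec_eq_iff row_def mat_def)
    qed
    have C: "C *v x = x + (bform r x - x $ j) *s axis j 1" for x
      unfolding C_def row
      by (auto simp: matrix_vector_mult_def vec_eq_iff row_def mat_def axis_def bform_def
          mult_if_delta)
    have "bform r x = (\<Sum>l\<in>UNIV. (if l = j then (c * v $ j - 1) * x $ l else 0) - c * (v $ l * x $ l))" for x
    proof -
      have "r $ l * x $ l = (if l = j then (c * v $ j - 1) * x $ l else 0) - c * (v $ l * x $ l)" for l
        by (cases "l = j") (simp_all add: r_def left_diff_distrib)
      then show ?thesis by (simp add: bform_def)
    qed
    then have r: "bform r x = (c * v $ j - 1) * x $ j - c * bform v x" for x
      by (simp add: sum_subtractf sum_distrib_left[symmetric] bform_def)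
    have "reflection v (B *v x) = B *v (C *v x)" for x
    proof -
      have cv: "c * bform v v = 2" using assms by (simp add: c_def)
      have *: "reflection v y = y - (c * bform v y) *s v" for y
        by (simp add: reflection_def c_def)
      have "c * bform v (B *v x) = c * bform v x + x $ j * (c * bform v v) - c * x $ j * v $ j"
        unfolding B by (simp add: bform_simps bform_axis algebra_simps)
      then have 1: "reflection v (B *v x)
          = x + x $ j *s (v - axis j 1) - (c * bform v x + x $ j * 2 - c * x $ j * v $ j) *s v"
        unfolding * cv by (simp add: B)
      show ?thesis
        unfolding 1 unfolding C B r
        by (simp add: vec_eq_iff axis_def algebra_simps)
    qed
    then show ?thesis
      by (simp only: matrix_eq matrix_vector_mul_assoc[symmetric] reflection_matrix simp_thms)
  qed
  ultimately have "det (reflection_matrix v) * v $ j = - v $ j"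
    by (metis det_mul mult.commute mult_minus1)
  then have "det (reflection_matrix v) * v $ j = (- 1) * v $ j" by simp
  with j show ?thesis by (metis mult_right_cancel)
qed

section \<open>Divisibility by linear forms\<close>

lemma poly_ring_eq_bform_mult:
  assumes "f \<in> poly_ring" "bform \<gamma> \<gamma> \<noteq> 0" and zero: "\<And>x. bform \<gamma> x = 0 \<Longrightarrow> f x = 0"
  obtains q where "q \<in> poly_ring" "\<And>x. f x = bform \<gamma> x * q x"
proof -
  \<comment> \<open>The orthogonal projection onto the mirror. The difference of \<open>f\<close>
    and its pullback is divisible by the linear form, by the same product rule as for reflections,
    and the pullback is zero by hypothesis.\<close>
  define pr where "pr x = x - (bform \<gamma> x / bform \<gamma> \<gamma>) *s \<gamma>" for x
  have pr_poly: "(\<lambda>x. pr x $ i) \<in> poly_ring" for i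
    unfolding pr_def
    by (simp, intro poly_ring_diff poly_ring_coord poly_ring_divide poly_ring_mult
        poly_ring_bform poly_ring_const)
  have "\<exists>q\<in>poly_ring. \<forall>x. f x - f (pr x) = bform \<gamma> x * q x"
    using assms(1)
  proof (induction rule: poly_ring_induct)
    case (const a)
    then show ?case by (intro bexI[of _ "\<lambda>_. 0"]) auto
  next
    case (coord i)
    then show ?case by (intro bexI[of _ "\<lambda>_. \<gamma> $ i / bform \<gamma> \<gamma>"]) (auto simp: pr_def)
  next
    case (add f g)
    then obtain p q where "p \<in> poly_ring" "q \<in> poly_ring"
      "\<And>x. f x - f (pr x) = bform \<gamma> x * p x" "\<And>x. g x - g (pr x) = bform \<gamma> x * q x" by blast
    moreover from this have "f x + g x - (f (pr x) + g (pr x)) = bform \<gamma> x * (p x + q x)" for x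
      unfolding add_diff_add by (simp add: distrib_left)
    ultimately show ?case
      by (intro bexI[of _ "\<lambda>x. p x + q x"]) auto
  next
    case (mult f g)
    then obtain p q where pq: "p \<in> poly_ring" "q \<in> poly_ring"
      "\<And>x. f x - f (pr x) = bform \<gamma> x * p x" "\<And>x. g x - g (pr x) = bform \<gamma> x * q x" by blast
    have "(\<lambda>x. f (pr x)) \<in> poly_ring"
      by (rule poly_ring_compose) (use mult pr_poly in auto)
    moreover have "f x * g x - f (pr x) * g (pr x)
        = bform \<gamma> x * (p x * g x + f (pr x) * q x)" for x
    proof -
      have "f x * g x - f (pr x) * g (pr x)
          = (f x - f (pr x)) * g x + f (pr x) * (g x - g (pr x))" by (simp add: algebra_simps)
      then show ?thesis unfolding pq(3,4) by (simp add: algebra_simps)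
    qed
    ultimately show ?case
      using mult pq by (intro bexI[of _ "\<lambda>x. p x * g x + f (pr x) * q x"]) auto
  qed
  then obtain q where "q \<in> poly_ring" "\<And>x. f x - f (pr x) = bform \<gamma> x * q x" by blast
  moreover have "f (pr x) = 0" for x
    by (rule zero) (use assms(2) in \<open>simp add: pr_def bform_simps\<close>)
  ultimately show ?thesis using that[of q] by simp
qed

text \<open>The mirror is irreducible: pulling back along the projection turns functions on it into
  polynomials on the whole space, which have no zero divisors. The point \<open>z\<close> certifies
  that \<open>g\<close> is not identically zero on the mirror.\<close>

lemma poly_ring_zero_on_mirror:
  assumes "f \<in> poly_ring" "g \<in> poly_ring" "bform \<gamma> \<gamma> \<noteq> 0"
    and "\<And>x. bform \<gamma> x = 0 \<Longrightarrow> g x \<noteq> 0 \<Longrightarrow> f x = 0"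
    and "bform \<gamma> z = 0" "g z \<noteq> 0"
    and "bform \<gamma> x = 0"
  shows "f x = 0"
proof -
  define pr where "pr x = x - (bform \<gamma> x / bform \<gamma> \<gamma>) *s \<gamma>" for x
  have pr_poly: "(\<lambda>x. pr x $ i) \<in> poly_ring" for i
    unfolding pr_def
    by (simp, intro poly_ring_diff poly_ring_coord poly_ring_divide poly_ring_mult
        poly_ring_bform poly_ring_const)
  have pr0: "bform \<gamma> (pr x) = 0" for x
    using assms(3) by (simp add: pr_def bform_simps)
  have "(\<lambda>x. f (pr x)) = (\<lambda>x. 0) \<or> (\<lambda>x. g (pr x)) = (\<lambda>x. 0)"
  proof (rule poly_ring_mult_eq_0)
    show "f (pr y) * g (pr y) = 0" for y
      using assms(4)[OF pr0, of y] by auto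
  qed (rule poly_ring_compose[OF assms(1) pr_poly] poly_ring_compose[OF assms(2) pr_poly])+
  moreover have pr: "pr z = z" "pr x = x" using assms(5,7) by (simp_all add: pr_def)
  ultimately show ?thesis
    using assms(6) fun_cong[of "\<lambda>x. f (pr x)" "\<lambda>x. 0" x] fun_cong[of "\<lambda>x. g (pr x)" "\<lambda>x. 0" z]
    by auto
qed

text \<open>The forms are split off one at a time. After division by the form of
  \<open>\<delta>\<close> the quotient still vanishes on the mirror of \<open>\<gamma>\<close>,
  because the divisor is not identically zero there.\<close>

lemma poly_ring_eq_prod_bform_mult:
  assumes "finite A" "f \<in> poly_ring"
    and "\<And>\<gamma>. \<gamma> \<in> A \<Longrightarrow> bform \<gamma> \<gamma> \<noteq> 0"
    and "\<And>\<gamma> \<delta>. \<gamma> \<in> A \<Longrightarrow> \<delta> \<in> A \<Longrightarrow> \<gamma> \<noteq> \<delta> \<Longrightarrow> \<exists>z. bform \<gamma> z = 0 \<and> bform \<delta> z \<noteq> 0"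
    and "\<And>\<gamma> x. \<gamma> \<in> A \<Longrightarrow> bform \<gamma> x = 0 \<Longrightarrow> f x = 0"
  shows "\<exists>q\<in>poly_ring. \<forall>x. f x = (\<Prod>\<gamma>\<in>A. bform \<gamma> x) * q x"
  using assms
proof (induction A arbitrary: f)
  case empty
  then show ?case by auto
next
  case (insert \<delta> A)
  obtain q where q: "q \<in> poly_ring" "\<And>x. f x = bform \<delta> x * q x"
    using poly_ring_eq_bform_mult[OF insert.prems(1), of \<delta>] insert.prems(2,4)
    by (metis insertI1)
  have "q x = 0" if mem: "\<gamma> \<in> A" "bform \<gamma> x = 0" for \<gamma> x
  proof -
    have "\<gamma> \<noteq> \<delta>" using mem insert.hyps by auto
    then obtain z where z: "bform \<gamma> z = 0" "bform \<delta> z \<noteq> 0"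
      using insert.prems(3)[of \<gamma> \<delta>] mem by blast
    show ?thesis
    proof (rule poly_ring_zero_on_mirror[of q "bform \<delta>" \<gamma> z x])
      show "bform \<gamma> \<gamma> \<noteq> 0" using insert.prems(2) mem by blast
      show "q y = 0" if "bform \<gamma> y = 0" "bform \<delta> y \<noteq> 0" for y
        using insert.prems(4)[of \<gamma> y] \<open>\<gamma> \<in> A\<close> q(2)[of y] that by simp
    qed (use q(1) mem z in auto)
  qed
  then have "\<exists>r\<in>poly_ring. \<forall>x. q x = (\<Prod>\<gamma>\<in>A. bform \<gamma> x) * r x"
    using insert.prems(2,3) by (intro insert.IH q(1)) blast+
  then obtain r where "r \<in> poly_ring" "\<And>x. q x = (\<Prod>\<gamma>\<in>A. bform \<gamma> x) * r x" by blast
  then show ?case using q insert.hyps by (intro bexI[of _ r]) simp_all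
qed

lemma proportional_if_vanishes_on_mirror:
  assumes "bform v v \<noteq> 0" "\<And>z. bform v z = 0 \<Longrightarrow> bform \<delta> z = 0"
  shows "\<delta> = (bform \<delta> v / bform v v) *s v"
proof (rule bform_eqI)
  fix y
  have "bform v (y - (bform v y / bform v v) *s v) = 0"
    using assms(1) by (simp add: bform_simps)
  then have "bform \<delta> (y - (bform v y / bform v v) *s v) = 0" by (rule assms(2))
  then show "bform \<delta> y = bform ((bform \<delta> v / bform v v) *s v) y"
    by (simp add: bform_simps mult.commute)
qed

lemma poly_ring_common_nonzero_on_mirror:
  assumes "bform v v \<noteq> 0" "finite A" "\<And>i. i \<in> A \<Longrightarrow> f i \<in> poly_ring"
    and "\<And>i. i \<in> A \<Longrightarrow> \<exists>z. bform v z = 0 \<and> f i z \<noteq> 0"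
  shows "\<exists>z. bform v z = 0 \<and> (\<forall>i\<in>A. f i z \<noteq> 0)"
proof -
  define pr where "pr y = y - (bform v y / bform v v) *s v" for y
  have pr0: "bform v (pr y) = 0" for y
    using assms(1) by (simp add: pr_def bform_simps)
  have pr_poly: "(\<lambda>x. pr x $ i) \<in> poly_ring" for i
    unfolding pr_def
    by (simp, intro poly_ring_diff poly_ring_coord poly_ring_divide poly_ring_mult
        poly_ring_bform poly_ring_const)
  have "\<exists>y. \<forall>i\<in>A. f i (pr y) \<noteq> 0"
  proof (rule poly_ring_common_nonzero[OF assms(2)])
    fix i assume i: "i \<in> A"
    show "(\<lambda>y. f i (pr y)) \<in> poly_ring"
      by (rule poly_ring_compose[OF assms(3)[OF i] pr_poly])
    obtain z where "bform v z = 0" "f i z \<noteq> 0"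
      using assms(4)[OF i] by blast
    moreover from this have "pr z = z" by (simp add: pr_def)
    ultimately show "(\<lambda>y. f i (pr y)) \<noteq> (\<lambda>x. 0)"
      by (metis (no_types, lifting))
  qed
  then show ?thesis using pr0 by blast
qed

section \<open>Reflection groups\<close>

locale reflection_group =
  fixes R P :: "(complex^'n) set"
  assumes root_system: "coxeter_root_system R" and positive: "positive_roots R P"
begin

abbreviation "W \<equiv> coxeter_group R"

text \<open>The basic anti-invariant, a square root of the discriminant; in type A it is a
  Vandermonde determinant up to a constant.\<close>

definition discriminant_root :: "complex^'n \<Rightarrow> complex" where
  "discriminant_root x = (\<Prod>\<gamma>\<in>P. bform \<gamma> x)"

lemma finite_R: "finite R"
  using root_system by (simp add: coxeter_root_system_def)

lemma P_subset: "P \<subseteq> R"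
  using positive by (auto simp: positive_roots_def)

lemma finite_P: "finite P"
  using P_subset finite_R finite_subset by blast

lemma root_norm: "\<gamma> \<in> R \<Longrightarrow> bform \<gamma> \<gamma> = 2"
  using root_system by (simp add: coxeter_root_system_def)

lemma root_nonisotropic: "\<gamma> \<in> R \<Longrightarrow> bform \<gamma> \<gamma> \<noteq> 0"
  by (simp add: root_norm)

lemma positive_root_norm: "\<gamma> \<in> P \<Longrightarrow> bform \<gamma> \<gamma> = 2"
  using P_subset root_norm by blast

lemma reflection_root: "\<gamma> \<in> R \<Longrightarrow> reflection \<gamma> x = x - bform \<gamma> x *s \<gamma>"
  by (simp add: reflection_def root_norm)

lemma reflection_image: "\<gamma> \<in> R \<Longrightarrow> reflection \<gamma> ` R = R"
  using root_system by (simp add: coxeter_root_system_def)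

lemma uminus_root: "\<gamma> \<in> R \<Longrightarrow> - \<gamma> \<in> R"
proof -
  assume \<gamma>: "\<gamma> \<in> R"
  then have "reflection \<gamma> \<gamma> = - \<gamma>"
    by (simp add: reflection_root root_norm vec_eq_iff)
  then show ?thesis using reflection_image[OF \<gamma>] \<gamma> by (metis imageI)
qed

lemma roots_eq: "R = P \<union> uminus ` P" and positive_disjoint: "P \<inter> uminus ` P = {}"
proof -
  obtain l :: "complex^'n \<Rightarrow> real" where l: "linear l" "\<And>\<gamma>. \<gamma> \<in> R \<Longrightarrow> l \<gamma> \<noteq> 0"
    and P: "P = {\<gamma>\<in>R. l \<gamma> > 0}"
    using positive by (auto simp: positive_roots_def)
  have neg: "l (- x) = - l x" for x
    using l(1) by (rule linear_neg)
  have "\<gamma> \<in> P \<or> - \<gamma> \<in> P" if "\<gamma> \<in> R" for \<gamma>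
    using l(2)[OF that] that uminus_root[OF that] by (auto simp: P neg)
  then show "R = P \<union> uminus ` P"
    using P_subset uminus_root by (force simp: image_iff)
  show "P \<inter> uminus ` P = {}"
    by (auto simp: P neg)
qed

text \<open>Otherwise \<open>\<delta>\<close> is a multiple of \<open>\<gamma>\<close>; equal norms
  leave the factors 1 and -1, and positivity excludes the second.\<close>

lemma distinct_mirrors:
  assumes "\<gamma> \<in> P" "\<delta> \<in> P" "\<gamma> \<noteq> \<delta>"
  shows "\<exists>z. bform \<gamma> z = 0 \<and> bform \<delta> z \<noteq> 0"
proof (rule ccontr)
  assume contr: "\<not> ?thesis"
  obtain a where "\<delta> = a *s \<gamma>"
    using proportional_if_vanishes_on_mirror[of \<gamma> \<delta>] contr positive_root_norm[OF assms(1)] by auto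
  moreover have "a * a = 1"
    using positive_root_norm[OF assms(2)] positive_root_norm[OF assms(1)]
    unfolding \<open>\<delta> = a *s \<gamma>\<close> by (simp add: bform_simps)
  then have "a = 1 \<or> a = - 1" by (simp add: square_eq_1_iff)
  ultimately have "\<delta> = \<gamma> \<or> \<delta> = - \<gamma>" by (auto simp: vec_eq_iff)
  then show False using assms positive_disjoint by auto
qed

lemma discriminant_root_poly: "discriminant_root \<in> poly_ring"
  unfolding discriminant_root_def[abs_def] by auto

lemma discriminant_root_nonzero: "discriminant_root \<noteq> (\<lambda>x. 0)"
proof -
  have "\<exists>x. \<forall>\<gamma>\<in>P. bform \<gamma> x \<noteq> 0"
  proof (rule poly_ring_common_nonzero[OF finite_P])
    fix \<gamma> assume "\<gamma> \<in> P"
    then show "bform \<gamma> \<noteq> (\<lambda>x. 0)" using positive_root_norm[of \<gamma>] by (metis zero_neq_numeral)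
  qed auto
  then show ?thesis by (auto simp: discriminant_root_def fun_eq_iff finite_P)
qed

text \<open>
  The square of the product is, up to sign, the product over all roots and hence invariant; the
  sign is detected on the mirror of \<open>\<gamma>\<close>, after dividing by \<open>(\<gamma>, x)\<close>.
\<close>

lemma discriminant_root_reflection:
  assumes \<gamma>: "\<gamma> \<in> R"
  shows "discriminant_root (reflection \<gamma> x) = - discriminant_root x"
proof -
  have *: "discriminant_root (reflection \<gamma> x) = - discriminant_root x" if \<gamma>: "\<gamma> \<in> P" for \<gamma> x
  proof -
    have \<gamma>R: "\<gamma> \<in> R" using \<gamma> P_subset by blast
    let ?s = "reflection \<gamma>"
    have all: "(\<Prod>\<delta>\<in>R. bform \<delta> y) = (-1) ^ card P * (discriminant_root y)\<^sup>2" for y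
    proof -
      have "(\<Prod>\<delta>\<in>R. bform \<delta> y) = (\<Prod>\<delta>\<in>P. bform \<delta> y) * (\<Prod>\<delta>\<in>uminus ` P. bform \<delta> y)"
        unfolding roots_eq using finite_P positive_disjoint
        by (intro prod.union_disjoint) auto
      also have "(\<Prod>\<delta>\<in>uminus ` P. bform \<delta> y) = (\<Prod>\<delta>\<in>P. - bform \<delta> y)"
        by (subst prod.reindex) (auto simp: inj_on_def bform_minus_left)
      also have "\<dots> = (-1) ^ card P * (\<Prod>\<delta>\<in>P. bform \<delta> y)" by (rule prod_uminus)
      finally show ?thesis by (simp add: discriminant_root_def power2_eq_square)
    qed
    have "(\<Prod>\<delta>\<in>R. bform \<delta> (?s y)) = (\<Prod>\<delta>\<in>R. bform \<delta> y)" for y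
    proof -
      have "(\<Prod>\<delta>\<in>R. bform \<delta> (?s y)) = (\<Prod>\<delta>\<in>R. bform (?s \<delta>) y)"
        by (metis (no_types, lifting) \<gamma>R bform_reflection reflection_reflection root_nonisotropic)
      also have "\<dots> = (\<Prod>\<delta>\<in>?s ` R. bform \<delta> y)"
        by (subst prod.reindex) (auto intro!: inj_on_inverseI reflection_reflection root_nonisotropic \<gamma>R)
      finally show ?thesis using reflection_image[OF \<gamma>R] by simp
    qed
    then have sq: "(discriminant_root (?s y))\<^sup>2 = (discriminant_root y)\<^sup>2" for y
      unfolding all by simp
    have comp: "(\<lambda>y. discriminant_root (?s y)) \<in> poly_ring"
      by (rule poly_ring_reflection[OF discriminant_root_poly])
    define B where "B y = (\<Prod>\<delta>\<in>P - {\<gamma>}. bform \<delta> y)" for y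
    have B: "discriminant_root y = bform \<gamma> y * B y" for y
      unfolding discriminant_root_def B_def using finite_P \<gamma> by (rule prod.remove)
    have B_poly: "B \<in> poly_ring" unfolding B_def[abs_def] by auto
    have "(\<lambda>y. discriminant_root (?s y) - discriminant_root y) = (\<lambda>x. 0)
        \<or> (\<lambda>y. discriminant_root (?s y) + discriminant_root y) = (\<lambda>x. 0)"
      using sq comp discriminant_root_poly
      by (intro poly_ring_mult_eq_0 poly_ring_diff poly_ring_add)
        (simp_all add: algebra_simps power2_eq_square)
    \<comment> \<open>With the plus sign, the product \<open>B\<close> of the other roots would be
      odd under the reflection, since the form of \<open>\<gamma>\<close> is odd. It would vanish on
      the whole mirror, although none of its factors does.\<close>
    moreover have False if "(\<lambda>y. discriminant_root (?s y) - discriminant_root y) = (\<lambda>x. 0)"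
    proof -
      have "(\<lambda>y. - B (?s y)) = B"
      proof (rule poly_ring_cancel_bform)
        show "(\<lambda>y. - B (?s y)) \<in> poly_ring" using poly_ring_reflection[OF B_poly] by auto
        show "bform \<gamma> y * - B (?s y) = bform \<gamma> y * B y" for y
          using fun_cong[OF that, of y] bform_reflection_self[OF root_nonisotropic[OF \<gamma>R], of y]
          by (simp add: B)
      qed (use B_poly root_nonisotropic[OF \<gamma>R] in auto)
      then have "B z = 0" if "bform \<gamma> z = 0" for z
        using fun_cong[of "\<lambda>y. - B (?s y)" B z] reflection_fixed[OF that] by simp
      moreover have "\<exists>z. bform \<gamma> z = 0 \<and> (\<forall>\<delta>\<in>P - {\<gamma>}. bform \<delta> z \<noteq> 0)"
        using distinct_mirrors[OF \<gamma>] finite_P root_nonisotropic[OF \<gamma>R]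
        by (intro poly_ring_common_nonzero_on_mirror) auto
      ultimately show False
        using finite_P by (auto simp: B_def)
    qed
    ultimately show ?thesis by (auto simp: fun_eq_iff eq_neg_iff_add_eq_0)
  qed
  have "reflection (- \<gamma>) = reflection \<gamma>"
    by (simp add: fun_eq_iff reflection_def bform_simps vec_eq_iff)
  then show ?thesis using * \<gamma> roots_eq by (metis UnE imageE minus_minus)
qed

text \<open>All facts obtained by induction over products of reflections, in one statement. The
  determinant clause is what later recognizes the reflections of the group.\<close>

lemma group_element:
  assumes "w \<in> W"
  shows "\<exists>M. w = (\<lambda>x. M *v x) \<and> (\<forall>x. discriminant_root (w x) = det M * discriminant_root x)
    \<and> (\<forall>x y. bform (w x) (w y) = bform x y) \<and> w ` R = R \<and> bij w"
  using assms
proof induction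
  case one
  then show ?case by (intro exI[of _ "mat 1"]) (auto simp: id_def[symmetric])
next
  case (refl w \<gamma>)
  then obtain M where M: "w = (\<lambda>x. M *v x)" "\<And>x. discriminant_root (w x) = det M * discriminant_root x"
    "\<And>x y. bform (w x) (w y) = bform x y" "w ` R = R" "bij w" by blast
  have "bij (reflection \<gamma>)"
    using reflection_reflection[OF root_nonisotropic[OF \<open>\<gamma> \<in> R\<close>]] by (metis involuntory_imp_bij)
  then have "bij (reflection \<gamma> \<circ> w)"
    using M(5) by (rule bij_comp[rotated])
  moreover have "(reflection \<gamma> \<circ> w) ` R = R"
    by (metis M(4) image_comp reflection_image[OF \<open>\<gamma> \<in> R\<close>])
  moreover have "reflection \<gamma> \<circ> w = (\<lambda>x. (reflection_matrix \<gamma> ** M) *v x)"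
    by (simp add: M(1) fun_eq_iff reflection_matrix flip: matrix_vector_mul_assoc)
  moreover have "discriminant_root ((reflection \<gamma> \<circ> w) x)
      = det (reflection_matrix \<gamma> ** M) * discriminant_root x" for x
    using \<open>\<gamma> \<in> R\<close>
    by (simp add: M(2) det_mul det_reflection_matrix root_nonisotropic discriminant_root_reflection)
  moreover have "bform ((reflection \<gamma> \<circ> w) x) ((reflection \<gamma> \<circ> w) y) = bform x y" for x y
    using \<open>\<gamma> \<in> R\<close> by (simp add: M(3) bform_reflection root_nonisotropic)
  ultimately show ?case by blast
qed

lemma group_matrix:
  assumes "w \<in> W"
  obtains M where "w = (\<lambda>x. M *v x)"
  using group_element[OF assms] by blast

lemma group_bij: "w \<in> W \<Longrightarrow> bij w"
  using group_element by blast

lemma group_poly: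
  assumes "w \<in> W" "f \<in> poly_ring"
  shows "(\<lambda>x. f (w x)) \<in> poly_ring"
proof -
  obtain M where "w = (\<lambda>x. M *v x)" using group_matrix[OF assms(1)] .
  then show ?thesis
    by (auto intro!: poly_ring_compose[OF assms(2)] poly_ring_sum poly_ring_mult
        simp: matrix_vector_mult_def)
qed

lemma reflection_in_group: "\<gamma> \<in> R \<Longrightarrow> reflection \<gamma> \<in> W"
  using coxeter_group.refl[OF coxeter_group.one] by simp

lemma group_comp_reflection:
  assumes "w \<in> W" "\<gamma> \<in> R"
  shows "w \<circ> reflection \<gamma> \<in> W"
  using assms(1)
proof induction
  case one
  then show ?case using reflection_in_group[OF assms(2)] by simp
next
  case (refl w \<delta>)
  then show ?case using coxeter_group.refl by (metis comp_assoc)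
qed

lemma finite_W: "finite W"
proof (rule finite_imageD)
  have "(\<lambda>w. restrict w R) ` W \<subseteq> R \<rightarrow>\<^sub>E R"
    using group_element by fastforce
  moreover have "finite (R \<rightarrow>\<^sub>E R)" by (rule finite_PiE[OF finite_R finite_R])
  ultimately show "finite ((\<lambda>w. restrict w R) ` W)" by (rule finite_subset)
  show "inj_on (\<lambda>w. restrict w R) W"
  proof (rule inj_onI)
    fix v w assume vw: "v \<in> W" "w \<in> W" "restrict v R = restrict w R"
    obtain M N where MN: "v = (\<lambda>x. M *v x)" "w = (\<lambda>x. N *v x)"
      using group_matrix[OF vw(1)] group_matrix[OF vw(2)] by metis
    have "v x = w x" for x
    proof (rule vec.linear_eq_on[of v w x R])
      show "Vector_Spaces.linear (*s) (*s) v" "Vector_Spaces.linear (*s) (*s) w"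
        unfolding MN by (rule matrix_vector_mul_linear_gen)+
      show "x \<in> vec.span R" using root_system by (simp add: coxeter_root_system_def)
      show "v b = w b" if "b \<in> R" for b using vw(3) that by (metis restrict_apply')
    qed
    then show "v = w" by blast
  qed
qed

text \<open>A reflection has determinant -1, so it reverses the sign of
  \<open>discriminant_root\<close>, which therefore vanishes on its mirror. A product of linear
  forms can vanish on a hyperplane only if one of them does, and then \<open>v\<close> is
  proportional to a root.\<close>

lemma group_reflection:
  assumes "reflection v \<in> W" "bform v v \<noteq> 0"
  shows "\<exists>\<gamma>\<in>P. reflection v = reflection \<gamma>"
proof -
  obtain M where M: "reflection v = (\<lambda>x. M *v x)"
    "\<And>x. discriminant_root (reflection v x) = det M * discriminant_root x"
    using group_element[OF assms(1)] by blast
  have "M = reflection_matrix v"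
    using M(1) by (metis matrix_eq reflection_matrix)
  then have anti: "discriminant_root (reflection v x) = - discriminant_root x" for x
    using M(2) det_reflection_matrix[OF assms(2)] by simp
  then have zero: "discriminant_root z = 0" if "bform v z = 0" for z
  proof -
    have "discriminant_root z = - discriminant_root z"
      using anti[of z] reflection_fixed[OF that] by simp
    then show ?thesis by simp
  qed
  have "\<exists>\<gamma>\<in>P. \<forall>z. bform v z = 0 \<longrightarrow> bform \<gamma> z = 0"
  proof (rule ccontr)
    assume "\<not> ?thesis"
    then have "\<exists>z. bform v z = 0 \<and> (\<forall>\<gamma>\<in>P. bform \<gamma> z \<noteq> 0)"
      using finite_P by (intro poly_ring_common_nonzero_on_mirror assms(2)) auto
    then show False
      using zero finite_P by (auto simp: discriminant_root_def)
  qed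
  then obtain \<gamma> where \<gamma>: "\<gamma> \<in> P" "\<And>z. bform v z = 0 \<Longrightarrow> bform \<gamma> z = 0" by blast
  then obtain a where a: "\<gamma> = a *s v"
    using proportional_if_vanishes_on_mirror[OF assms(2), of \<gamma>] by blast
  then have "a \<noteq> 0" using positive_root_norm[OF \<gamma>(1)] by (auto simp: vec_eq_iff bform_def)
  then have "reflection v = reflection \<gamma>"
    using assms(2) by (simp add: a fun_eq_iff reflection_def bform_simps vec_eq_iff)
  then show ?thesis using \<gamma>(1) by blast
qed

text \<open>If all minors of \<open>w - 1\<close> vanish, \<open>w - 1\<close> has rank one, and orthogonality makes \<open>w\<close> a reflection.\<close>

lemma group_fixed_space:
  assumes w: "w \<in> W" "w \<noteq> id" "\<And>\<gamma>. \<gamma> \<in> P \<Longrightarrow> w \<noteq> reflection \<gamma>"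
  shows "\<exists>i j x y. (w x - x) $ i * (w y - y) $ j - (w y - y) $ i * (w x - x) $ j \<noteq> 0"
proof (rule ccontr)
  assume "\<not> ?thesis"
  then have minors: "(w x - x) $ i * (w y - y) $ j = (w y - y) $ i * (w x - x) $ j" for i j x y
    by (metis right_minus_eq)
  obtain y where "w y \<noteq> y" using w(2) by (auto simp: fun_eq_iff)
  define v where "v = w y - y"
  have "v \<noteq> 0" using \<open>w y \<noteq> y\<close> by (simp add: v_def)
  then obtain j where j: "v $ j \<noteq> 0" by (auto simp: vec_eq_iff)
  define l where "l x = - ((w x - x) $ j / v $ j)" for x
  have wx: "w x = x - l x *s v" for x
  proof -
    have "(w x - x) $ i = (w x - x) $ j / v $ j * v $ i" for i
      using minors[of x i y j] j by (simp add: v_def[symmetric] eq_divide_eq mult.commute)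
    then have *: "w x - x = ((w x - x) $ j / v $ j) *s v"
      unfolding vec_eq_iff vector_smult_component by blast
    have "w x = x + (w x - x)" by simp
    also have "\<dots> = x + ((w x - x) $ j / v $ j) *s v" using * by (rule arg_cong)
    also have "\<dots> = x - l x *s v" by (simp add: l_def vec_eq_iff)
    finally show ?thesis .
  qed
  obtain M where M: "w = (\<lambda>x. M *v x)" using group_matrix[OF w(1)] .
  have l_poly: "l \<in> poly_ring"
    unfolding l_def[abs_def] vector_minus_component
    by (intro poly_ring_uminus poly_ring_divide poly_ring_diff poly_ring_coord
        group_poly[OF w(1) poly_ring_coord])
  have l_nz: "l \<noteq> (\<lambda>x. 0)"
    using j by (auto simp: fun_eq_iff l_def v_def intro!: exI[of _ y])
  \<comment> \<open>Expanding (w x, w x) = (x, x) gives this identity multiplied by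
    \<open>l x\<close>. Once the factor is cancelled, it excludes isotropic \<open>v\<close> and
    turns \<open>wx\<close> into the formula of a reflection.\<close>
  have l2: "2 * bform v x = l x * bform v v" for x
  proof -
    have "(\<lambda>x. 2 * bform v x) = (\<lambda>x. l x * bform v v)"
    proof (rule poly_ring_cancel[OF l_poly _ _ l_nz])
      fix x assume "l x \<noteq> 0"
      have "bform (w x) (w x) = bform x x" using group_element[OF w(1)] by blast
      then have "l x * (l x * bform v v) = l x * (2 * bform v x)"
        unfolding wx by (simp add: bform_simps bform_commute[of x v] algebra_simps)
      then show "2 * bform v x = l x * bform v v" using \<open>l x \<noteq> 0\<close> by simp
    qed (use l_poly in auto)
    then show ?thesis by (rule fun_cong)
  qed
  have vv: "bform v v \<noteq> 0"
  proof
    assume "bform v v = 0"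
    then have "bform v x = bform 0 x" for x using l2[of x] by simp
    then have "v = 0" by (rule bform_eqI)
    with \<open>v \<noteq> 0\<close> show False by simp
  qed
  have "w = reflection v"
    using l2 vv by (simp add: fun_eq_iff wx reflection_def)
  then show False using group_reflection[of v] vv w by metis
qed

section \<open>Points outside an exceptional set of codimension two\<close>

definition generic_point :: "complex^'n \<Rightarrow> bool" where
  "generic_point z \<longleftrightarrow>
     (\<forall>w\<in>W. w z = z \<longrightarrow> w = id \<or> (\<exists>\<gamma>\<in>P. w = reflection \<gamma>)) \<and>
     (\<forall>\<gamma>\<in>P. \<forall>\<delta>\<in>P. bform \<gamma> z = 0 \<longrightarrow> bform \<delta> z = 0 \<longrightarrow> \<gamma> = \<delta>)"

text \<open>The exceptional points are covered by common zero sets of two independent forms: two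
  rows of w - 1 for an element that is neither the identity nor a reflection, or two distinct
  positive roots. A nonzero minor records the independence.\<close>

lemma exceptional_codim2:
  obtains B where "finite B"
    "\<And>a b. (a, b) \<in> B \<Longrightarrow> \<exists>x y. bform a x * bform b y - bform a y * bform b x \<noteq> 0"
    "\<And>z. \<not> generic_point z \<Longrightarrow> \<exists>(a, b)\<in>B. bform a z = 0 \<and> bform b z = 0"
proof -
  have "\<exists>a. \<forall>x. bform a x = (w x - x) $ i" if "w \<in> W" for w i
  proof -
    obtain M where "w = (\<lambda>x. M *v x)" using group_matrix[OF \<open>w \<in> W\<close>] .
    moreover have "M *v x - x = (M - mat 1) *v x" for x :: "complex^'n"
      by (simp add: matrix_vector_mult_diff_rdistrib)
    ultimately show ?thesis
      by (intro exI[of _ "(M - mat 1) $ i"]) (simp add: bform_def matrix_vector_mult_def)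
  qed
  then obtain r where r: "\<And>w i x. w \<in> W \<Longrightarrow> bform (r w i) x = (w x - x) $ i"
    by metis
  define C where "C = (\<lambda>(w, i, j). (r w i, r w j)) ` (W \<times> UNIV \<times> UNIV) \<union> P \<times> P"
  define B where "B = {p \<in> C. \<exists>x y. bform (fst p) x * bform (snd p) y - bform (fst p) y * bform (snd p) x \<noteq> 0}"
  have "finite C"
    unfolding C_def using finite_W finite_P by simp
  then have "finite B" by (simp add: B_def)
  moreover have "\<exists>x y. bform a x * bform b y - bform a y * bform b x \<noteq> 0" if "(a, b) \<in> B" for a b
    using that by (simp add: B_def)
  moreover have "\<exists>(a, b)\<in>B. bform a z = 0 \<and> bform b z = 0" if "\<not> generic_point z" for z
  proof -
    from that consider
      w where "w \<in> W" "w z = z" "w \<noteq> id" "\<And>\<gamma>. \<gamma> \<in> P \<Longrightarrow> w \<noteq> reflection \<gamma>"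
      | \<gamma> \<delta> where "\<gamma> \<in> P" "\<delta> \<in> P" "bform \<gamma> z = 0" "bform \<delta> z = 0" "\<gamma> \<noteq> \<delta>"
      unfolding generic_point_def by blast
    then show ?thesis
    proof cases
      case 1
      obtain i j x y where "(w x - x) $ i * (w y - y) $ j - (w y - y) $ i * (w x - x) $ j \<noteq> 0"
        using group_fixed_space[OF 1(1,3,4)] by blast
      then have "(r w i, r w j) \<in> B"
        using 1(1) by (force simp: B_def C_def r image_iff)
      then show ?thesis using 1(1,2) by (intro bexI[of _ "(r w i, r w j)"]) (auto simp: r)
    next
      case 2
      obtain x where "bform \<gamma> x = 0" "bform \<delta> x \<noteq> 0"
        using distinct_mirrors[OF 2(1,2,5)] by blast
      then have "bform \<gamma> \<gamma> * bform \<delta> x - bform \<gamma> x * bform \<delta> \<gamma> \<noteq> 0"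
        using positive_root_norm[OF 2(1)] by simp
      then have "(\<gamma>, \<delta>) \<in> B" using 2 unfolding B_def C_def by auto
      then show ?thesis using 2 by auto
    qed
  qed
  ultimately show ?thesis using that by blast
qed

text \<open>Two independent forms cannot both vanish on the mirror, so each exceptional pair
  contains a form \<open>c p\<close> that does not. The product \<open>g\<close> of these forms is
  nonzero only at generic points.\<close>

lemma generic_on_mirror:
  assumes \<gamma>: "\<gamma> \<in> P"
  obtains g z where "g \<in> poly_ring" "bform \<gamma> z = 0" "g z \<noteq> 0"
    "\<And>x. bform \<gamma> x = 0 \<Longrightarrow> g x \<noteq> 0 \<Longrightarrow> generic_point x"
proof -
  obtain B where B: "finite B"
    "\<And>a b. (a, b) \<in> B \<Longrightarrow> \<exists>x y. bform a x * bform b y - bform a y * bform b x \<noteq> 0"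
    "\<And>z. \<not> generic_point z \<Longrightarrow> \<exists>(a, b)\<in>B. bform a z = 0 \<and> bform b z = 0"
    using exceptional_codim2 by blast
  have "\<exists>c\<in>{fst p, snd p}. \<exists>z. bform \<gamma> z = 0 \<and> bform c z \<noteq> 0" if pB: "p \<in> B" for p
  proof (rule ccontr)
    assume contr: "\<not> ?thesis"
    obtain a b where p: "p = (a, b)" by force
    obtain x y where xy: "bform a x * bform b y - bform a y * bform b x \<noteq> 0"
      using B(2)[of a b] pB p by blast
    \<comment> \<open>The combination of \<open>x\<close> and \<open>y\<close> that lies in the
      mirror. If \<open>a\<close> and \<open>b\<close> both vanish on it, the minor is annihilated
      by \<open>bform \<gamma> x\<close> and by \<open>bform \<gamma> y\<close>, so both of these
      are zero.\<close>
    define u where "u = bform \<gamma> y *s x - bform \<gamma> x *s y"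
    have "bform \<gamma> u = 0" by (simp add: u_def bform_simps)
    then have "bform a u = 0" "bform b u = 0" using contr p by auto
    then have ab: "bform \<gamma> y * bform a x = bform \<gamma> x * bform a y"
      "bform \<gamma> y * bform b x = bform \<gamma> x * bform b y" by (simp_all add: u_def bform_simps)
    have "bform \<gamma> y * (bform a x * bform b y - bform a y * bform b x)
        = (bform \<gamma> y * bform a x) * bform b y - bform a y * (bform \<gamma> y * bform b x)"
      by (simp add: algebra_simps)
    also have "\<dots> = 0" unfolding ab by simp
    finally have y: "bform \<gamma> y = 0" using xy by simp
    have "bform \<gamma> x * (bform a x * bform b y - bform a y * bform b x)
        = bform a x * (bform \<gamma> x * bform b y) - (bform \<gamma> x * bform a y) * bform b x"
      by (simp add: algebra_simps)
    also have "\<dots> = 0" unfolding ab[symmetric] by simp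
    finally have x: "bform \<gamma> x = 0" using xy by simp
    have "bform a x = 0" "bform a y = 0" using contr p x y by auto
    with xy show False by simp
  qed
  then obtain c where c: "\<And>p. p \<in> B \<Longrightarrow> c p \<in> {fst p, snd p}"
    "\<And>p. p \<in> B \<Longrightarrow> \<exists>z. bform \<gamma> z = 0 \<and> bform (c p) z \<noteq> 0"
    by metis
  define g where "g x = (\<Prod>p\<in>B. bform (c p) x)" for x
  have "\<exists>z. bform \<gamma> z = 0 \<and> (\<forall>p\<in>B. bform (c p) z \<noteq> 0)"
    using c(2) B(1) positive_root_norm[OF \<gamma>]
    by (intro poly_ring_common_nonzero_on_mirror) auto
  then obtain z where "bform \<gamma> z = 0" "g z \<noteq> 0"
    using B(1) by (auto simp: g_def)
  moreover have "g \<in> poly_ring" unfolding g_def[abs_def] by auto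
  moreover have "generic_point x" if "g x \<noteq> 0" for x
  proof (rule ccontr)
    assume "\<not> generic_point x"
    then obtain p where p: "p \<in> B" "bform (fst p) x = 0" "bform (snd p) x = 0"
      using B(3) by force
    then have "bform (c p) x = 0" using c(1)[of p] by auto
    then show False using that p(1) B(1) by (auto simp: g_def)
  qed
  ultimately show ?thesis using that by blast
qed

text \<open>A line meets the common zeros of two forms only if the minor of the forms on base point
  and direction is zero. These minors are nonzero polynomials, so the direction and then the base
  point can be chosen off their zeros. The condition on \<open>f\<close> at the direction
  \<open>b\<close> controls the behaviour of \<open>f\<close> towards infinity.\<close>

lemma generic_line:
  assumes "f \<in> poly_ring" "f \<noteq> (\<lambda>x. 0)"
  obtains a b where "f b \<noteq> 0" "\<And>z. generic_point (a + z *s b)"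
proof -
  obtain B where B: "finite B"
    "\<And>a b. (a, b) \<in> B \<Longrightarrow> \<exists>x y. bform a x * bform b y - bform a y * bform b x \<noteq> 0"
    "\<And>z. \<not> generic_point z \<Longrightarrow> \<exists>(a, b)\<in>B. bform a z = 0 \<and> bform b z = 0"
    using exceptional_codim2 by blast
  define m where "m p x y = bform (fst p) x * bform (snd p) y - bform (fst p) y * bform (snd p) x"
    for p :: "(complex^'n) \<times> (complex^'n)" and x y
  have m_poly: "(\<lambda>x. m p x y) \<in> poly_ring" "(\<lambda>y. m p x y) \<in> poly_ring" for p x y
    unfolding m_def
    by (intro poly_ring_diff poly_ring_mult poly_ring_bform poly_ring_const)+
  have "\<exists>x y. m p x y \<noteq> 0" if "p \<in> B" for p
    using B(2)[of "fst p" "snd p"] that by (simp add: m_def)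
  then obtain X where X: "\<And>p. p \<in> B \<Longrightarrow> \<exists>y. m p (X p) y \<noteq> 0" by metis
  \<comment> \<open>\<open>None\<close> indexes the condition on \<open>f\<close>, so that a single
    choice of \<open>b\<close> meets all conditions.\<close>
  have "\<exists>b. \<forall>k\<in>insert None (Some ` B). (case k of None \<Rightarrow> f b | Some p \<Rightarrow> m p (X p) b) \<noteq> 0"
  proof (rule poly_ring_common_nonzero)
    show "(\<lambda>b. case k of None \<Rightarrow> f b | Some p \<Rightarrow> m p (X p) b) \<in> poly_ring" for k
      by (cases k) (use assms m_poly in auto)
    show "(\<lambda>b. case k of None \<Rightarrow> f b | Some p \<Rightarrow> m p (X p) b) \<noteq> (\<lambda>x. 0)"
      if "k \<in> insert None (Some ` B)" for k
      using that assms(2) X by (cases k) (auto simp: fun_eq_iff)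
  qed (use B(1) in auto)
  then obtain b where b: "f b \<noteq> 0" "\<And>p. p \<in> B \<Longrightarrow> m p (X p) b \<noteq> 0" by force
  have "\<exists>a. \<forall>p\<in>B. m p a b \<noteq> 0"
    using b(2) m_poly B(1) by (intro poly_ring_common_nonzero) (auto simp: fun_eq_iff)
  then obtain a where a: "\<And>p. p \<in> B \<Longrightarrow> m p a b \<noteq> 0" by blast
  have "generic_point (a + z *s b)" for z
  proof (rule ccontr)
    assume "\<not> generic_point (a + z *s b)"
    then obtain p where p: "p \<in> B" "bform (fst p) (a + z *s b) = 0" "bform (snd p) (a + z *s b) = 0"
      using B(3) by force
    then have 1: "bform (fst p) a = - z * bform (fst p) b" "bform (snd p) a = - z * bform (snd p) b"
      by (simp_all add: bform_simps eq_neg_iff_add_eq_0)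
    then have "m p a b = 0" unfolding m_def 1 by simp
    with a p(1) show False by blast
  qed
  with b(1) show ?thesis using that by blast
qed

end

section \<open>Invariant polynomials with prescribed jets\<close>

abbreviation grad :: "(complex^'n \<Rightarrow> complex) \<Rightarrow> complex^'n \<Rightarrow> complex^'n" where
  "grad f x \<equiv> (\<chi> i. partial i f x)"

text \<open>The value at \<open>z\<close> is left free, because only gradients and Hessians are
  prescribed.\<close>

definition flat :: "complex^'n \<Rightarrow> (complex^'n \<Rightarrow> complex) \<Rightarrow> bool" where
  "flat z f \<longleftrightarrow> f \<in> poly_ring \<and> (\<forall>i. partial i f z = 0) \<and> (\<forall>i j. partial i (partial j f) z = 0)"

lemma flat_add: "flat z f \<Longrightarrow> flat z g \<Longrightarrow> flat z (\<lambda>x. f x + g x)"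
  by (simp add: flat_def partial_add poly_ring_add partial_poly_ring)

lemma flat_cmult: "flat z f \<Longrightarrow> flat z (\<lambda>x. a * f x)"
  by (simp add: flat_def partial_cmult poly_ring_mult poly_ring_const partial_poly_ring)

lemma flat_sum: "(\<And>i. i \<in> A \<Longrightarrow> flat z (f i)) \<Longrightarrow> flat z (\<lambda>x. \<Sum>i\<in>A. f i x)"
  by (induction A rule: infinite_finite_induct)
    (auto simp: flat_add, auto simp: flat_def)

lemma flat_cube:
  assumes "a \<in> poly_ring" "b \<in> poly_ring" "a z = 0"
  shows "flat z (\<lambda>x. a x ^ 3 * b x)"
proof -
  have "flat z (\<lambda>x. a x * (a x * (a x * b x)))"
    using assms
    by (simp add: flat_def partial_mult partial_add poly_ring_mult poly_ring_add partial_poly_ring)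
  then show ?thesis by (simp add: power3_eq_cube mult.assoc)
qed

lemma partial_bform: "partial j (bform \<gamma>) = (\<lambda>x. \<gamma> $ j)"
proof -
  have "partial j (\<lambda>x. \<Sum>i\<in>UNIV. \<gamma> $ i * x $ i) = (\<lambda>x. \<Sum>i\<in>UNIV. \<gamma> $ i * (if j = i then 1 else 0))"
    by (subst partial_sum) (auto simp: partial_cmult poly_ring_coord)
  then show ?thesis by (simp add: bform_def[abs_def] if_distrib cong: if_cong)
qed

lemma partial_reflection:
  assumes "f \<in> poly_ring" "bform \<gamma> \<gamma> = 2"
  shows "partial j (\<lambda>x. f (reflection \<gamma> x)) x
    = partial j f (reflection \<gamma> x) - \<gamma> $ j * bform \<gamma> (grad f (reflection \<gamma> x))"
proof (rule partial_eqI)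
  have "bform \<gamma> (axis j z) = \<gamma> $ j * z" for z
    by (simp add: bform_def axis_def if_distrib[of "\<lambda>u. _ * u"] cong: if_cong)
  then have *: "reflection \<gamma> (x + axis j z) $ i
      = x $ i + (if i = j then z else 0) - (bform \<gamma> x + \<gamma> $ j * z) * \<gamma> $ i" for z i
    by (simp add: reflection_def assms(2) bform_add axis_def)
  have "((\<lambda>z. f (reflection \<gamma> (x + axis j z))) has_field_derivative
      (\<Sum>i\<in>UNIV. ((if i = j then 1 else 0) - \<gamma> $ j * \<gamma> $ i) * partial i f (reflection \<gamma> (x + axis j 0)))) (at 0)"
    by (rule poly_ring_chain[OF assms(1)])
      (unfold *, auto intro!: derivative_eq_intros)
  moreover have "(\<Sum>i\<in>UNIV. ((if i = j then 1 else 0) - \<gamma> $ j * \<gamma> $ i) * partial i f y)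
      = partial j f y - \<gamma> $ j * bform \<gamma> (grad f y)" for y
    by (simp add: left_diff_distrib sum_subtractf mult_if_delta bform_def sum_distrib_left mult.assoc)
  moreover have "x + axis j 0 = x" by (simp add: vec_eq_iff axis_def)
  ultimately show "((\<lambda>z. f (reflection \<gamma> (x + axis j z))) has_field_derivative
      partial j f (reflection \<gamma> x) - \<gamma> $ j * bform \<gamma> (grad f (reflection \<gamma> x))) (at 0)" by simp
qed

context reflection_group
begin

lemma invariants_iff:
  "f \<in> invariants W \<longleftrightarrow> f \<in> poly_ring \<and> (\<forall>\<gamma>\<in>R. \<forall>x. f (reflection \<gamma> x) = f x)"
proof
  assume f: "f \<in> invariants W"
  have "f (reflection \<gamma> x) = f x" if "\<gamma> \<in> R" for \<gamma> x
  proof -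
    have "act (reflection \<gamma>) f = f"
      using f reflection_in_group[OF that] by (simp add: invariants_def)
    then show ?thesis
      by (metis act_def inv_reflection root_nonisotropic that)
  qed
  then show "f \<in> poly_ring \<and> (\<forall>\<gamma>\<in>R. \<forall>x. f (reflection \<gamma> x) = f x)"
    using f by (simp add: invariants_def)
next
  assume f: "f \<in> poly_ring \<and> (\<forall>\<gamma>\<in>R. \<forall>x. f (reflection \<gamma> x) = f x)"
  have *: "f (w x) = f x" if "w \<in> W" for w x
    using that by (induction) (use f in auto)
  have "act w f = f" if "w \<in> W" for w
    using *[OF that] group_bij[OF that] by (metis act_def bij_inv_eq_iff ext)
  then show "f \<in> invariants W" using f by (simp add: invariants_def)
qed

lemma invariants_poly: "f \<in> invariants W \<Longrightarrow> f \<in> poly_ring"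
  by (simp add: invariants_iff)

lemma average_invariant:
  assumes "g \<in> poly_ring"
  shows "(\<lambda>x. \<Sum>w\<in>W. g (w x)) \<in> invariants W"
  unfolding invariants_iff
proof (intro conjI ballI allI)
  show "(\<lambda>x. \<Sum>w\<in>W. g (w x)) \<in> poly_ring"
    using group_poly[OF _ assms] by (rule poly_ring_sum)
  fix \<gamma> x assume \<gamma>: "\<gamma> \<in> R"
  have inv: "(w \<circ> reflection \<gamma>) \<circ> reflection \<gamma> = w" for w
    by (simp add: fun_eq_iff reflection_reflection root_nonisotropic \<gamma>)
  show "(\<Sum>w\<in>W. g (w (reflection \<gamma> x))) = (\<Sum>w\<in>W. g (w x))"
    by (rule sum.reindex_bij_witness[of _ "\<lambda>w. w \<circ> reflection \<gamma>" "\<lambda>w. w \<circ> reflection \<gamma>"])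
      (use inv \<gamma> group_comp_reflection in \<open>auto simp: reflection_reflection root_nonisotropic\<close>)
qed

text \<open>
  With \<open>\<psi>\<close> equal to 1 at \<open>z\<close> and to 0 at the other points of the orbit, averaging
  \<open>(1 - (1 - \<psi>\<^sup>3)\<^sup>3) \<phi>\<close> over the group gives the multiple \<open>|Stab z| \<phi>\<close> up to third order at \<open>z\<close>.
\<close>

lemma invariant_with_jet:
  assumes \<phi>: "\<phi> \<in> poly_ring" and stab: "\<And>w x. w \<in> W \<Longrightarrow> w z = z \<Longrightarrow> \<phi> (w x) = \<phi> x"
  obtains f where "f \<in> invariants W" "flat z (\<lambda>x. f x - \<phi> x)"
proof -
  define S where "S = {w \<in> W. w z = z}"
  define N where "N = {w \<in> W. w z \<noteq> z}"
  have fin: "finite S" "finite N" and SN: "W = S \<union> N" "S \<inter> N = {}"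
    using finite_W by (auto simp: S_def N_def)
  have "id \<in> S" by (simp add: S_def coxeter_group.one)
  then have cS: "of_nat (card S) \<noteq> (0::complex)" using fin by auto
  have "\<exists>i. w z $ i \<noteq> z $ i" if "w \<in> N" for w
    using that by (auto simp: N_def vec_eq_iff)
  then obtain k where k: "\<And>w. w \<in> N \<Longrightarrow> w z $ k w \<noteq> z $ k w" by metis
  define \<psi> where "\<psi> x = (\<Prod>w\<in>N. (x $ k w - w z $ k w) / (z $ k w - w z $ k w))" for x
  have \<psi>_poly: "\<psi> \<in> poly_ring" unfolding \<psi>_def[abs_def] by (intro poly_ring_intros)
  have "z $ k w - w z $ k w \<noteq> 0" if "w \<in> N" for w
    using k[OF that] by (metis right_minus_eq)
  then have \<psi>_z: "\<psi> z = 1" by (auto simp: \<psi>_def intro!: prod.neutral)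
  have \<psi>_N: "\<psi> (w z) = 0" if "w \<in> N" for w
    using that fin by (auto simp: \<psi>_def)
  \<comment> \<open>The cofactor in 1 - (1 - u)^3 = u (3 - 3 u + u^2) with u the cube of
    \<open>\<psi>\<close>. Thus \<open>g\<close> has a triple zero at the other points of the orbit,
    while \<open>g_alt\<close> shows a triple zero of \<open>g - \<phi>\<close> at
    \<open>z\<close>.\<close>
  define \<chi>' where "\<chi>' x = 3 - 3 * \<psi> x ^ 3 + (\<psi> x ^ 3)\<^sup>2" for x
  define g where "g x = \<psi> x ^ 3 * (\<chi>' x * \<phi> x)" for x
  have \<chi>'_poly: "\<chi>' \<in> poly_ring" unfolding \<chi>'_def[abs_def] by (intro poly_ring_intros \<psi>_poly)
  have g_poly: "g \<in> poly_ring" unfolding g_def[abs_def] by (intro poly_ring_intros \<psi>_poly \<chi>'_poly \<phi>)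
  have g_alt: "g x = \<phi> x - (1 - \<psi> x ^ 3) ^ 3 * \<phi> x" for x
    by (simp add: g_def \<chi>'_def power3_eq_cube power2_eq_square algebra_simps)
  define F where "F x = (\<Sum>w\<in>W. g (w x))" for x
  define f where "f x = 1 / of_nat (card S) * F x" for x
  have F: "F \<in> invariants W" unfolding F_def[abs_def] by (rule average_invariant[OF g_poly])
  then have "f \<in> invariants W"
    unfolding invariants_iff f_def[abs_def] by auto
  moreover have "flat z (\<lambda>x. f x - \<phi> x)"
  proof -
    have "F x = (\<Sum>w\<in>S. g (w x)) + (\<Sum>w\<in>N. g (w x))" for x
      unfolding F_def SN(1) using fin SN(2) by (rule sum.union_disjoint)
    moreover have "(\<Sum>w\<in>S. g (w x)) = of_nat (card S) * \<phi> x + (\<Sum>w\<in>S. (1 - \<psi> (w x) ^ 3) ^ 3 * (- \<phi> x))" for x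
    proof -
      have "(\<Sum>w\<in>S. g (w x)) = (\<Sum>w\<in>S. \<phi> x + (1 - \<psi> (w x) ^ 3) ^ 3 * (- \<phi> x))"
        by (rule sum.cong) (use stab in \<open>auto simp: g_alt S_def\<close>)
      then show ?thesis by (simp only: sum.distrib sum_constant)
    qed
    ultimately have eq: "f x - \<phi> x = 1 / of_nat (card S) * ((\<Sum>w\<in>S. (1 - \<psi> (w x) ^ 3) ^ 3 * (- \<phi> x))
        + (\<Sum>w\<in>N. \<psi> (w x) ^ 3 * (\<chi>' (w x) * \<phi> (w x))))" for x
      using cS by (simp add: f_def g_def field_simps)
    have 1: "flat z (\<lambda>x. (1 - \<psi> (w x) ^ 3) ^ 3 * (- \<phi> x))" if "w \<in> S" for w
    proof (rule flat_cube)
      show "(\<lambda>x. 1 - \<psi> (w x) ^ 3) \<in> poly_ring"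
        using that by (intro poly_ring_intros group_poly[OF _ \<psi>_poly]) (simp add: S_def)
      show "1 - \<psi> (w z) ^ 3 = 0" using that \<psi>_z by (simp add: S_def)
    qed (use \<phi> in auto)
    have 2: "flat z (\<lambda>x. \<psi> (w x) ^ 3 * (\<chi>' (w x) * \<phi> (w x)))" if "w \<in> N" for w
    proof -
      have "w \<in> W" using that by (simp add: N_def)
      then show ?thesis
        using \<psi>_N[OF that]
        by (intro flat_cube poly_ring_mult group_poly[OF _ \<psi>_poly] group_poly[OF _ \<chi>'_poly]
            group_poly[OF _ \<phi>])
    qed
    show ?thesis
      unfolding eq by (intro flat_cmult flat_add flat_sum 1 2)
  qed
  ultimately show ?thesis using that by blast
qed

lemma partial_invariant_reflection:
  assumes "f \<in> invariants W" "\<gamma> \<in> R"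
  shows "partial j f (reflection \<gamma> x) = partial j f x - bform \<gamma> (grad f x) * \<gamma> $ j"
proof -
  have "f \<in> poly_ring" and *: "(\<lambda>x. f (reflection \<gamma> x)) = f"
    using assms by (auto simp: invariants_iff)
  from partial_reflection[OF this(1) root_norm[OF assms(2)], of j "reflection \<gamma> x"]
  show ?thesis
    unfolding * reflection_reflection[OF root_nonisotropic[OF assms(2)]] by (simp add: mult.commute)
qed

lemma bform_grad_poly:
  assumes "f \<in> poly_ring"
  shows "(\<lambda>x. bform \<gamma> (grad f x)) \<in> poly_ring"
  unfolding bform_def vec_lambda_beta by (intro poly_ring_intros assms)

lemma root_component:
  assumes "\<gamma> \<in> R"
  obtains j where "\<gamma> $ j \<noteq> 0"
proof -
  have "\<gamma> \<noteq> 0" using root_nonisotropic[OF assms] by auto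
  then show ?thesis using that by (auto simp: vec_eq_iff)
qed

lemma normal_derivative_zero:
  assumes "f \<in> invariants W" "\<gamma> \<in> R" "bform \<gamma> x = 0"
  shows "bform \<gamma> (grad f x) = 0"
proof -
  have "bform \<gamma> (grad f x) * \<gamma> $ j = 0" for j
    using partial_invariant_reflection[OF assms(1,2), of j x] reflection_fixed[OF assms(3)] by simp
  moreover obtain j where "\<gamma> $ j \<noteq> 0" using root_component[OF assms(2)] by blast
  ultimately show ?thesis by auto
qed

text \<open>For an invariant \<open>f\<close> and a root, this is the polynomial quotient of the
  normal derivative by the root. On the mirror, where the normal derivative is zero, it is half the
  second derivative along \<open>\<gamma>\<close>.\<close>

definition normal_quotient :: "complex^'n \<Rightarrow> (complex^'n \<Rightarrow> complex) \<Rightarrow> complex^'n \<Rightarrow> complex" where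
  "normal_quotient \<gamma> f = (SOME q. q \<in> poly_ring \<and> (\<forall>x. bform \<gamma> (grad f x) = bform \<gamma> x * q x))"

lemma normal_quotient:
  assumes "f \<in> invariants W" "\<gamma> \<in> R"
  shows "normal_quotient \<gamma> f \<in> poly_ring"
    and "bform \<gamma> (grad f x) = bform \<gamma> x * normal_quotient \<gamma> f x"
proof -
  have "\<exists>q. q \<in> poly_ring \<and> (\<forall>x. bform \<gamma> (grad f x) = bform \<gamma> x * q x)"
  proof -
    obtain q where "q \<in> poly_ring" "\<And>x. bform \<gamma> (grad f x) = bform \<gamma> x * q x"
      using poly_ring_eq_bform_mult[OF bform_grad_poly[OF invariants_poly[OF assms(1)]]
          root_nonisotropic[OF assms(2)] normal_derivative_zero[OF assms]] by blast
    then show ?thesis by blast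
  qed
  from someI_ex[OF this, folded normal_quotient_def] show "normal_quotient \<gamma> f \<in> poly_ring"
    "bform \<gamma> (grad f x) = bform \<gamma> x * normal_quotient \<gamma> f x"
    by blast+
qed

text \<open>The defining identity of the quotient, differentiated. On the mirror it says that
  \<open>\<gamma>\<close> is an eigenvector of the Hessian with eigenvalue
  \<open>normal_quotient \<gamma> f x\<close>.\<close>

lemma partial_normal_derivative:
  assumes "f \<in> invariants W" "\<gamma> \<in> R"
  shows "(\<Sum>i\<in>UNIV. \<gamma> $ i * partial j (partial i f) x)
    = \<gamma> $ j * normal_quotient \<gamma> f x + bform \<gamma> x * partial j (normal_quotient \<gamma> f) x"
proof -
  have f: "f \<in> poly_ring" using assms by (simp add: invariants_iff)
  have "partial j (\<lambda>x. bform \<gamma> (grad f x)) x = (\<Sum>i\<in>UNIV. \<gamma> $ i * partial j (partial i f) x)"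
    unfolding bform_def using f
    by (subst partial_sum) (auto simp: partial_cmult partial_poly_ring)
  moreover have "(\<lambda>x. bform \<gamma> (grad f x)) = (\<lambda>x. bform \<gamma> x * normal_quotient \<gamma> f x)"
    using normal_quotient(2)[OF assms] by blast
  ultimately show ?thesis
    using partial_mult[OF poly_ring_bform normal_quotient(1)[OF assms], of j \<gamma>]
    by (simp add: partial_bform)
qed

end

section \<open>The Jacobian of the basic invariants\<close>

lemma det_nonzero_if_rows_span:
  fixes M :: "complex^'n^'n"
  assumes "\<And>u. \<exists>c. \<forall>j. u $ j = (\<Sum>i\<in>UNIV. c i * M $ i $ j)"
  shows "det M \<noteq> 0"
proof -
  have "\<exists>c. u = transpose M *v c" for u
  proof -
    obtain c where "\<And>j. u $ j = (\<Sum>i\<in>UNIV. c i * M $ i $ j)" using assms by blast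
    then show ?thesis
      by (intro exI[of _ "vec_lambda c"])
        (simp add: vec_eq_iff matrix_vector_mult_def transpose_def mult.commute)
  qed
  then have "surj ((*v) (transpose M))" by (metis surjI)
  then obtain B where "transpose M ** B = mat 1"
    using matrix_right_invertible_surjective by blast
  then have "det M * det B = 1" by (metis det_I det_mul det_transpose)
  then show ?thesis by auto
qed

lemma row_relation_iff_det_0:
  fixes M :: "complex^'n^'n"
  shows "(\<exists>c. c \<noteq> (\<lambda>i. 0) \<and> (\<forall>j. (\<Sum>i\<in>UNIV. c i * M $ i $ j) = 0)) \<longleftrightarrow> det M = 0"
proof -
  have "det M \<noteq> 0 \<longleftrightarrow> (\<exists>B. B ** transpose M = mat 1)"
    using invertible_det_nz[of "transpose M"] by (simp add: invertible_left_inverse)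
  also have "\<dots> \<longleftrightarrow> (\<forall>x. transpose M *v x = 0 \<longrightarrow> x = 0)"
    by (rule matrix_left_invertible_ker)
  finally have *: "det M = 0 \<longleftrightarrow> (\<exists>x. transpose M *v x = 0 \<and> x \<noteq> 0)" by blast
  have "transpose M *v x = 0 \<longleftrightarrow> (\<forall>j. (\<Sum>i\<in>UNIV. x $ i * M $ i $ j) = 0)" for x
    by (simp add: vec_eq_iff matrix_vector_mult_def transpose_def mult.commute)
  note rel = this
  show ?thesis
  proof
    assume "\<exists>c. c \<noteq> (\<lambda>i. 0) \<and> (\<forall>j. (\<Sum>i\<in>UNIV. c i * M $ i $ j) = 0)"
    then obtain c where "c \<noteq> (\<lambda>i. 0)" "\<forall>j. (\<Sum>i\<in>UNIV. c i * M $ i $ j) = 0" by blast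
    then have "transpose M *v vec_lambda c = 0" "vec_lambda c \<noteq> 0"
      unfolding rel by (auto simp: vec_eq_iff)
    then show "det M = 0" unfolding * by blast
  next
    assume "det M = 0"
    then obtain x where "transpose M *v x = 0" "x \<noteq> 0" unfolding * by blast
    then show "\<exists>c. c \<noteq> (\<lambda>i. 0) \<and> (\<forall>j. (\<Sum>i\<in>UNIV. c i * M $ i $ j) = 0)"
      unfolding rel by (intro exI[of _ "\<lambda>i. x $ i"]) (auto simp: vec_eq_iff fun_eq_iff)
  qed
qed

lemma det_scale_column:
  fixes m :: "'n::finite \<Rightarrow> 'n \<Rightarrow> complex"
  shows "det (\<chi> i a. if a = j then c * q i else m i a) = c * det (\<chi> i a. if a = j then q i else m i a)"
proof -
  have "transpose (\<chi> i a. if a = j then c * q i else m i a)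
      = (\<chi> a. if a = j then c *s (\<chi> i. q i) else (\<chi> i. m i a))"
    "transpose (\<chi> i a. if a = j then q i else m i a)
      = (\<chi> a. if a = j then (\<chi> i. q i) else (\<chi> i. m i a))"
    by (simp_all add: vec_eq_iff transpose_def)
  then show ?thesis
    using det_row_mul[of j c "\<lambda>_. \<chi> i. q i" "\<lambda>a. \<chi> i. m i a"]
    by (metis (no_types, lifting) det_transpose)
qed

lemma (in reflection_group) reflection_fixes_iff:
  assumes "\<gamma> \<in> R"
  shows "reflection \<gamma> z = z \<longleftrightarrow> bform \<gamma> z = 0"
proof
  assume *: "reflection \<gamma> z = z"
  obtain j where "\<gamma> $ j \<noteq> 0" using root_component[OF assms] by blast
  then show "bform \<gamma> z = 0" using * by (auto simp: reflection_root[OF assms] vec_eq_iff)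
qed (rule reflection_fixed)

lemma (in reflection_group) generic_mirror_stabilizer:
  assumes "generic_point z" "\<gamma> \<in> P" "bform \<gamma> z = 0" "w \<in> W" "w z = z"
  shows "w = id \<or> w = reflection \<gamma>"
proof -
  from assms(1,4,5) consider "w = id" | \<delta> where "\<delta> \<in> P" "w = reflection \<delta>"
    by (auto simp: generic_point_def)
  then show ?thesis
  proof cases
    case 2
    then have "bform \<delta> z = 0" using assms(5) reflection_fixes_iff P_subset by blast
    then have "\<delta> = \<gamma>" using assms(1-3) 2(1) unfolding generic_point_def by blast
    with 2 show ?thesis by simp
  qed simp
qed

text \<open>The stabilizer consists of the identity and one reflection, so a linear form with
  tangent gradient \<open>u\<close> plus a multiple of the squared root is an admissible
  jet.\<close>

lemma (in reflection_group) invariant_with_mirror_jet: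
  assumes "\<gamma> \<in> P" "generic_point z" "bform \<gamma> z = 0" "bform \<gamma> u = 0"
  obtains f where "f \<in> invariants W" "\<And>a. partial a f z = u $ a" "normal_quotient \<gamma> f z = r"
proof -
  have \<gamma>R: "\<gamma> \<in> R" using assms(1) P_subset by blast
  \<comment> \<open>The square of the root has Hessian twice the tensor square of
    \<open>\<gamma>\<close>, and this maps \<open>\<gamma>\<close> to 4 times
    \<open>\<gamma>\<close> because (gamma, gamma) = 2.\<close>
  define e where "e = r / 4"
  define \<phi> where "\<phi> x = bform u x + e * (bform \<gamma> x * bform \<gamma> x)" for x
  have \<phi>: "\<phi> \<in> poly_ring" unfolding \<phi>_def[abs_def] by (intro poly_ring_intros)
  have d1: "partial a \<phi> = (\<lambda>x. u $ a + e * (\<gamma> $ a * bform \<gamma> x + bform \<gamma> x * \<gamma> $ a))" for a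
    unfolding \<phi>_def[abs_def]
    by (simp add: partial_add partial_cmult partial_mult partial_bform poly_ring_intros)
  have d2: "partial i (partial a \<phi>) z = 2 * e * \<gamma> $ i * \<gamma> $ a" for i a
    unfolding d1
    by (simp add: partial_add partial_cmult partial_mult partial_bform poly_ring_intros)
  have sym: "\<phi> (reflection \<gamma> x) = \<phi> x" for x
  proof -
    have "bform u (reflection \<gamma> x) = bform u x"
      using assms(4) by (simp add: reflection_root[OF \<gamma>R] bform_simps bform_commute[of u \<gamma>])
    then show ?thesis
      by (simp add: \<phi>_def bform_reflection_self[OF root_nonisotropic[OF \<gamma>R]])
  qed
  obtain f where f: "f \<in> invariants W" "flat z (\<lambda>x. f x - \<phi> x)"
  proof (rule invariant_with_jet[OF \<phi>])
    show "\<phi> (w x) = \<phi> x" if "w \<in> W" "w z = z" for w x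
      using generic_mirror_stabilizer[OF assms(2,1,3) that] sym by auto
  qed
  have fp: "f \<in> poly_ring" using f(1) by (simp add: invariants_iff)
  have f1: "partial a f z = u $ a" for a
    using f(2) assms(3) by (simp add: flat_def partial_diff fp \<phi> d1)
  have f2: "partial i (partial a f) z = r / 2 * \<gamma> $ i * \<gamma> $ a" for i a
    using f(2) by (simp add: flat_def partial_diff fp \<phi> partial_poly_ring d2 e_def)
  obtain j where j: "\<gamma> $ j \<noteq> 0" using root_component[OF \<gamma>R] by blast
  have "\<gamma> $ j * normal_quotient \<gamma> f z = (\<Sum>i\<in>UNIV. \<gamma> $ i * partial j (partial i f) z)"
    using partial_normal_derivative[OF f(1) \<gamma>R, of j z] assms(3) by simp
  also have "\<dots> = r / 2 * \<gamma> $ j * bform \<gamma> \<gamma>"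
    unfolding f2 bform_def sum_distrib_left by (rule sum.cong) (auto simp: mult_ac)
  also have "\<dots> = \<gamma> $ j * r" by (simp add: root_norm[OF \<gamma>R])
  finally have "normal_quotient \<gamma> f z = r" using j by simp
  with f(1) f1 show ?thesis using that by blast
qed

section \<open>Generators of the ring of invariants\<close>

locale invariant_generators = reflection_group R P
  for R P :: "(complex^'n) set" +
  fixes \<tau> :: "'n \<Rightarrow> complex^'n \<Rightarrow> complex" and d :: "'n \<Rightarrow> nat"
  assumes generate: "alg_gen (range \<tau>) = invariants W"
    and homogeneous: "\<And>i. homogeneous (d i) (\<tau> i)"
begin

lemma generator_invariant: "\<tau> i \<in> invariants W"
  unfolding generate[symmetric] by (rule alg_gen.gen) simp

lemma generator_poly: "\<tau> i \<in> poly_ring"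
  using generator_invariant by (rule invariants_poly)

lemma generator_scale: "\<tau> i (a *s x) = a ^ d i * \<tau> i x"
  using homogeneous by (simp add: homogeneous_def)

lemma partial_generator_poly: "partial j (\<tau> i) \<in> poly_ring"
  by (intro poly_ring_intros generator_poly)

text \<open>The chain rule for a polynomial in the generators. Uniqueness of the coefficients has to
  wait until the Jacobian is known to be nonzero.\<close>

lemma gradient_span:
  assumes "f \<in> invariants W"
  shows "\<exists>F. (\<forall>i. F i \<in> invariants W) \<and>
    (\<forall>j x. partial j f x = (\<Sum>i\<in>UNIV. F i x * partial j (\<tau> i) x))"
  using assms unfolding generate[symmetric]
proof induction
  case (const a)
  then show ?case by (intro exI[of _ "\<lambda>i x. 0"]) (auto intro: alg_gen.const)
next
  case (gen f)
  then obtain k where "f = \<tau> k" by auto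
  then show ?case
    by (intro exI[of _ "\<lambda>i x. if i = k then 1 else 0"])
      (auto simp: mult_if_delta intro: alg_gen.const)
next
  case (add f g)
  from add.IH(1) obtain F where F: "\<And>i. F i \<in> alg_gen (range \<tau>)"
    "\<And>j x. partial j f x = (\<Sum>i\<in>UNIV. F i x * partial j (\<tau> i) x)" by blast
  from add.IH(2) obtain G where G: "\<And>i. G i \<in> alg_gen (range \<tau>)"
    "\<And>j x. partial j g x = (\<Sum>i\<in>UNIV. G i x * partial j (\<tau> i) x)" by blast
  note FG = F G
  have "f \<in> poly_ring" "g \<in> poly_ring"
    using add.hyps generate invariants_poly by auto
  then show ?case using FG
    by (intro exI[of _ "\<lambda>i x. F i x + G i x"])
      (auto simp: partial_add algebra_simps sum.distrib intro: alg_gen.add)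
next
  case (mult f g)
  from mult.IH(1) obtain F where F: "\<And>i. F i \<in> alg_gen (range \<tau>)"
    "\<And>j x. partial j f x = (\<Sum>i\<in>UNIV. F i x * partial j (\<tau> i) x)" by blast
  from mult.IH(2) obtain G where G: "\<And>i. G i \<in> alg_gen (range \<tau>)"
    "\<And>j x. partial j g x = (\<Sum>i\<in>UNIV. G i x * partial j (\<tau> i) x)" by blast
  note FG = F G
  have "f \<in> poly_ring" "g \<in> poly_ring"
    using mult.hyps generate invariants_poly by auto
  then show ?case using FG mult.hyps
    by (intro exI[of _ "\<lambda>i x. F i x * g x + f x * G i x"])
      (auto simp: partial_mult algebra_simps sum.distrib sum_distrib_left
        intro!: alg_gen.add alg_gen.mult)
qed

definition jac :: "complex^'n \<Rightarrow> complex^'n^'n" where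
  "jac x = (\<chi> i. grad (\<tau> i) x)"

lemma jac_nth [simp]: "jac x $ i $ j = partial j (\<tau> i) x"
  by (simp add: jac_def)

lemma det_jac_poly: "(\<lambda>x. det (jac x)) \<in> poly_ring"
  by (rule poly_ring_det) (simp add: partial_generator_poly)

text \<open>The stabilizer is trivial, so every vector \<open>u\<close> is the gradient at
  \<open>z\<close> of some invariant, and by \<open>gradient_span\<close> the rows of the Jacobian
  span the space.\<close>

lemma det_jac_nonzero:
  assumes "generic_point z" "\<And>\<gamma>. \<gamma> \<in> P \<Longrightarrow> bform \<gamma> z \<noteq> 0"
  shows "det (jac z) \<noteq> 0"
proof (rule det_nonzero_if_rows_span)
  fix u
  have stab: "w = id" if "w \<in> W" "w z = z" for w
    using assms that reflection_fixes_iff P_subset unfolding generic_point_def by blast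
  obtain f where f: "f \<in> invariants W" "flat z (\<lambda>x. f x - bform u x)"
  proof (rule invariant_with_jet[OF poly_ring_bform])
    show "bform u (w x) = bform u x" if "w \<in> W" "w z = z" for w x
      using stab[OF that] by simp
  qed
  obtain F where F: "\<And>j x. partial j f x = (\<Sum>i\<in>UNIV. F i x * partial j (\<tau> i) x)"
    using gradient_span[OF f(1)] by metis
  have "partial j f z = u $ j" for j
    using f(2) by (simp add: flat_def partial_diff invariants_poly[OF f(1)] poly_ring_bform partial_bform)
  then show "\<exists>c. \<forall>j. u $ j = (\<Sum>i\<in>UNIV. c i * jac z $ i $ j)"
    using F[of _ z] by (intro exI[of _ "\<lambda>i. F i z"]) simp
qed

lemma normal_quotient_span:
  assumes "\<gamma> \<in> R" "f \<in> invariants W" "\<And>i. F i \<in> poly_ring"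
    "\<And>j x. partial j f x = (\<Sum>i\<in>UNIV. F i x * partial j (\<tau> i) x)"
  shows "normal_quotient \<gamma> f x = (\<Sum>i\<in>UNIV. F i x * normal_quotient \<gamma> (\<tau> i) x)"
proof -
  have "normal_quotient \<gamma> f = (\<lambda>x. \<Sum>i\<in>UNIV. F i x * normal_quotient \<gamma> (\<tau> i) x)"
  proof (rule poly_ring_cancel_bform[of _ _ \<gamma>])
    show "(\<lambda>x. \<Sum>i\<in>UNIV. F i x * normal_quotient \<gamma> (\<tau> i) x) \<in> poly_ring"
      by (intro poly_ring_intros assms normal_quotient generator_invariant)
    fix x
    have "bform \<gamma> x * normal_quotient \<gamma> f x = bform \<gamma> (grad f x)"
      using normal_quotient(2)[OF assms(2,1)] by simp
    also have "\<dots> = (\<Sum>j\<in>UNIV. \<Sum>i\<in>UNIV. F i x * (\<gamma> $ j * partial j (\<tau> i) x))"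
      by (simp add: bform_def assms(4) sum_distrib_left mult_ac)
    also have "\<dots> = (\<Sum>i\<in>UNIV. F i x * bform \<gamma> (grad (\<tau> i) x))"
      by (subst sum.swap) (simp add: bform_def sum_distrib_left)
    also have "\<dots> = bform \<gamma> x * (\<Sum>i\<in>UNIV. F i x * normal_quotient \<gamma> (\<tau> i) x)"
      by (simp add: normal_quotient(2)[OF generator_invariant assms(1)] sum_distrib_left mult_ac)
    finally show "bform \<gamma> x * normal_quotient \<gamma> f x
        = bform \<gamma> x * (\<Sum>i\<in>UNIV. F i x * normal_quotient \<gamma> (\<tau> i) x)" .
  qed (use assms normal_quotient root_nonisotropic in auto)
  then show ?thesis by simp
qed

text \<open>Column j is traded for the derivative along \<open>\<gamma>\<close> and divided by the
  root. Up to the factor \<open>\<gamma> $ j\<close>, its determinant is that of the Jacobian with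
  one zero along the mirror removed.\<close>

definition mirror_jac :: "complex^'n \<Rightarrow> 'n \<Rightarrow> complex^'n \<Rightarrow> complex^'n^'n" where
  "mirror_jac \<gamma> j x = (\<chi> i a. if a = j then normal_quotient \<gamma> (\<tau> i) x else partial a (\<tau> i) x)"

lemma det_mirror_jac_nonzero:
  assumes "\<gamma> \<in> P" "generic_point z" "bform \<gamma> z = 0" "\<gamma> $ j \<noteq> 0"
  shows "det (mirror_jac \<gamma> j z) \<noteq> 0"
proof (rule det_nonzero_if_rows_span)
  fix v :: "complex^'n"
  have \<gamma>R: "\<gamma> \<in> R" using assms(1) P_subset by blast
  \<comment> \<open>Entry j is solved from (gamma, u) = 0; the lost value \<open>v $ j\<close> is
    prescribed as normal quotient instead.\<close>
  define u where "u = (\<chi> a. if a = j then - (\<Sum>a\<in>UNIV - {j}. \<gamma> $ a * v $ a) / \<gamma> $ j else v $ a)"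
  have "bform \<gamma> u = \<gamma> $ j * u $ j + (\<Sum>a\<in>UNIV - {j}. \<gamma> $ a * u $ a)"
    unfolding bform_def by (rule sum.remove) auto
  also have "(\<Sum>a\<in>UNIV - {j}. \<gamma> $ a * u $ a) = (\<Sum>a\<in>UNIV - {j}. \<gamma> $ a * v $ a)"
    by (rule sum.cong) (auto simp: u_def)
  finally have "bform \<gamma> u = 0" using assms(4) by (simp add: u_def)
  then obtain f where f: "f \<in> invariants W" "\<And>a. partial a f z = u $ a" "normal_quotient \<gamma> f z = v $ j"
    using invariant_with_mirror_jet[OF assms(1-3)] by metis
  obtain F where F: "\<And>i. F i \<in> invariants W"
    "\<And>j x. partial j f x = (\<Sum>i\<in>UNIV. F i x * partial j (\<tau> i) x)"
    using gradient_span[OF f(1)] by metis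
  have "v $ a = (\<Sum>i\<in>UNIV. F i z * mirror_jac \<gamma> j z $ i $ a)" for a
  proof (cases "a = j")
    case True
    then show ?thesis
      using normal_quotient_span[OF \<gamma>R f(1) invariants_poly[OF F(1)] F(2), of z] f(3)
      by (simp add: mirror_jac_def)
  next
    case False
    then show ?thesis using f(2)[of a] F(2)[of a z] by (simp add: mirror_jac_def u_def)
  qed
  then show "\<exists>c. \<forall>a. v $ a = (\<Sum>i\<in>UNIV. c i * mirror_jac \<gamma> j z $ i $ a)"
    by (intro exI[of _ "\<lambda>i. F i z"]) blast
qed

lemma det_jac_factor:
  assumes "\<gamma> \<in> R"
  shows "\<gamma> $ j * det (jac x) = bform \<gamma> x * det (mirror_jac \<gamma> j x)"
proof -
  have "\<gamma> $ j * det (jac x)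
      = det (\<chi> k l. if l = j then (jac x *v \<gamma>) $ k else jac x $ k $ l)"
    by (rule cramer_lemma[symmetric])
  also have "(jac x *v \<gamma>) = (\<chi> k. bform \<gamma> x * normal_quotient \<gamma> (\<tau> k) x)"
    unfolding normal_quotient(2)[OF generator_invariant assms, symmetric]
    by (simp add: vec_eq_iff matrix_vector_mult_def bform_def mult.commute)
  finally show ?thesis
    unfolding mirror_jac_def vec_lambda_beta jac_nth det_scale_column .
qed

lemma det_jac_zero_on_mirror:
  assumes "\<gamma> \<in> R" "bform \<gamma> x = 0"
  shows "det (jac x) = 0"
  using det_jac_factor[OF assms(1)] assms(2) root_component[OF assms(1)]
  by (metis mult_eq_0_iff)

lemma poly_ring_eq_discriminant_mult:
  assumes "f \<in> poly_ring" "\<And>\<gamma> x. \<gamma> \<in> P \<Longrightarrow> bform \<gamma> x = 0 \<Longrightarrow> f x = 0"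
  shows "\<exists>q\<in>poly_ring. \<forall>x. f x = discriminant_root x * q x"
  unfolding discriminant_root_def using finite_P assms
  by (intro poly_ring_eq_prod_bform_mult distinct_mirrors) (auto simp: positive_root_norm)

lemma det_jac_homogeneous:
  "s ^ CARD('n) * det (jac (s *s x)) = s ^ sum d UNIV * det (jac x)"
proof -
  have row: "s * partial j (\<tau> i) (s *s x) = s ^ d i * partial j (\<tau> i) x" for i j
    by (rule partial_homogeneous[OF generator_poly generator_scale])
  have "s ^ CARD('n) * det (jac (s *s x)) = det (\<chi> i. s *s (jac (s *s x) $ i))"
    by (subst det_rows_mul) (simp add: vec_lambda_eta)
  also have "(\<chi> i. s *s (jac (s *s x) $ i)) = (\<chi> i. s ^ d i *s (jac x $ i))"
    by (simp add: vec_eq_iff row)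
  also have "det \<dots> = s ^ sum d UNIV * det (jac x)"
    by (subst det_rows_mul) (simp add: vec_lambda_eta power_sum)
  finally show ?thesis .
qed

text \<open>
  The quotient \<open>K\<close> of the Jacobian by the product of the roots has no zero at generic points, hence
  is constant along a generic line; being homogeneous, it is constant.
\<close>

lemma det_jac_eq_discriminant_root:
  obtains C where "C \<noteq> 0" "\<And>x. det (jac x) = C * discriminant_root x"
proof -
  let ?m = "CARD('n) + card P" and ?M = "sum d UNIV"
  obtain K where K: "K \<in> poly_ring" "\<And>x. det (jac x) = discriminant_root x * K x"
    using poly_ring_eq_discriminant_mult[OF det_jac_poly] det_jac_zero_on_mirror P_subset by blast
  have K_generic: "K z \<noteq> 0" if "generic_point z" for z
  proof (cases "\<exists>\<gamma>\<in>P. bform \<gamma> z = 0")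
    case False
    then show ?thesis using det_jac_nonzero[OF that] K(2)[of z] by auto
  next
    case True
    then obtain \<gamma> where \<gamma>: "\<gamma> \<in> P" "bform \<gamma> z = 0" by blast
    then have \<gamma>R: "\<gamma> \<in> R" using P_subset by blast
    obtain j where j: "\<gamma> $ j \<noteq> 0" using root_component[OF \<gamma>R] by blast
    define A' where "A' x = (\<Prod>\<delta>\<in>P - {\<gamma>}. bform \<delta> x)" for x
    have A: "discriminant_root x = bform \<gamma> x * A' x" for x
      unfolding discriminant_root_def A'_def using finite_P \<gamma>(1) by (rule prod.remove)
    have "(\<lambda>x. \<gamma> $ j * A' x * K x) = (\<lambda>x. det (mirror_jac \<gamma> j x))"
    proof (rule poly_ring_cancel_bform[of _ _ \<gamma>])
      show "(\<lambda>x. \<gamma> $ j * A' x * K x) \<in> poly_ring"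
        unfolding A'_def by (intro poly_ring_intros K(1))
      show "(\<lambda>x. det (mirror_jac \<gamma> j x)) \<in> poly_ring"
      proof (rule poly_ring_det)
        show "(\<lambda>x. mirror_jac \<gamma> j x $ i $ a) \<in> poly_ring" for i a
          by (cases "a = j")
            (simp_all add: mirror_jac_def normal_quotient(1)[OF generator_invariant \<gamma>R] partial_generator_poly)
      qed
      show "bform \<gamma> x * (\<gamma> $ j * A' x * K x) = bform \<gamma> x * det (mirror_jac \<gamma> j x)" for x
        using det_jac_factor[OF \<gamma>R, of j x] by (simp add: K(2) A mult_ac)
    qed (use root_nonisotropic[OF \<gamma>R] in auto)
    then have "\<gamma> $ j * A' z * K z = det (mirror_jac \<gamma> j z)" by (rule fun_cong)
    then show ?thesis using det_mirror_jac_nonzero[OF \<gamma>(1) that \<gamma>(2) j] by auto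
  qed
  \<comment> \<open>The degree of \<open>K\<close> is ?M - ?m, of which not even the sign is known
    yet; the two powers avoid forming the difference.\<close>
  have K_scale: "s ^ ?m * K (s *s x) = s ^ ?M * K x" for s x
  proof -
    have "(\<lambda>x. s ^ ?m * K (s *s x)) = (\<lambda>x. s ^ ?M * K x)"
    proof (rule poly_ring_cancel[OF discriminant_root_poly _ _ discriminant_root_nonzero])
      fix x assume "discriminant_root x \<noteq> 0"
      moreover have "discriminant_root (s *s x) = s ^ card P * discriminant_root x"
        by (simp add: discriminant_root_def bform_scale prod.distrib)
      ultimately show "s ^ ?m * K (s *s x) = s ^ ?M * K x"
        using det_jac_homogeneous[of s x] by (simp add: K(2) power_add mult_ac)
    next
      have "(\<lambda>x. K (s *s x)) \<in> poly_ring"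
        by (rule poly_ring_compose[OF K(1)]) (auto intro!: poly_ring_intros)
      then show "(\<lambda>x. s ^ ?m * K (s *s x)) \<in> poly_ring" by (intro poly_ring_intros)
    qed (intro poly_ring_intros K(1))
    then show ?thesis by (rule fun_cong)
  qed
  have "K \<noteq> (\<lambda>x. 0)"
  proof -
    obtain a b where "\<And>z. generic_point (a + z *s b)"
      using generic_line[OF discriminant_root_poly discriminant_root_nonzero] by blast
    then show ?thesis using K_generic by metis
  qed
  then obtain a b where ab: "K b \<noteq> 0" "\<And>z. generic_point (a + z *s b)"
    using generic_line[OF K(1)] by blast
  obtain p where p: "\<And>z. K (a + z *s b) = poly p z"
    using poly_ring_on_line[OF K(1)] by blast
  then have "poly p z \<noteq> 0" for z using K_generic[OF ab(2)] by metis
  then have "constant (poly p)" using fundamental_theorem_of_algebra by blast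
  then obtain k where k: "\<And>z. K (a + z *s b) = k"
    using p unfolding constant_def by metis
  then have "k \<noteq> 0" using K_generic[OF ab(2)] by metis
  \<comment> \<open>The same line seen from infinity, with y = 1/z. Here \<open>r\<close> is nonzero
    at 0, and homogeneity compares it with the constant \<open>k\<close>; equal orders at y = 0
    force ?m = ?M.\<close>
  obtain r where r: "\<And>y. K (b + y *s a) = poly r y"
    using poly_ring_on_line[OF K(1)] by blast
  have "poly r 0 \<noteq> 0" using r[of 0] ab(1) by simp
  have eq: "y ^ ?m * poly r y = k * y ^ ?M" if "y \<noteq> 0" for y
  proof -
    have "a + (1 / y) *s b = (1 / y) *s (b + y *s a)"
      using that by (simp add: vec_eq_iff field_simps)
    then have "K ((1 / y) *s (b + y *s a)) = k" using k[of "1 / y"] by metis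
    then have "(1 / y) ^ ?m * k = (1 / y) ^ ?M * poly r y"
      using K_scale[of "1 / y" "b + y *s a"] unfolding r by metis
    then show ?thesis using that by (simp add: field_simps)
  qed
  have "[:0, 1:] ^ ?m * r = smult k ([:0, 1:] ^ ?M)"
    by (rule poly_eq_if_eq_off_0) (simp add: poly_power eq)
  then have "order 0 ([:0, 1:] ^ ?m * r) = order 0 (smult k ([:0, 1:] ^ ?M))" by simp
  moreover have "order 0 ([:0, 1:] ^ e :: complex poly) = e" for e
    using order_power_n_n[of 0 e] by simp
  moreover have "r \<noteq> 0" "order 0 r = 0"
    using \<open>poly r 0 \<noteq> 0\<close> by (auto simp: order_0I)
  ultimately have mM: "?m = ?M"
    using \<open>k \<noteq> 0\<close> by (simp add: order_mult order_smult)
  have "K x = K 0" for x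
  proof -
    have "K (s *s x) = K x" if "s \<noteq> 0" for s
      using K_scale[of s x] that unfolding mM by simp
    moreover obtain e where e: "\<And>z. K (0 + z *s x) = poly e z"
      using poly_ring_on_line[OF K(1)] by blast
    ultimately have "e = [:K x:]"
      by (intro poly_eq_if_eq_off_0) (simp flip: e)
    then show ?thesis using e[of 0] by simp
  qed
  then show ?thesis
    using that[of "K 0"] K(2) ab(1) by (metis mult.commute)
qed

end

section \<open>Division by the Jacobian\<close>

context invariant_generators
begin

lemma det_jac_nonzero_poly: "(\<lambda>x. det (jac x)) \<noteq> (\<lambda>x. 0)"
proof -
  obtain C where "C \<noteq> 0" "\<And>x. det (jac x) = C * discriminant_root x"
    using det_jac_eq_discriminant_root by blast
  then show ?thesis using discriminant_root_nonzero by (simp add: fun_eq_iff)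
qed

lemma gradient_independent:
  assumes "det (jac x) \<noteq> 0" "\<And>j. (\<Sum>i\<in>UNIV. c i * partial j (\<tau> i) x) = 0"
  shows "c i = 0"
proof -
  have "\<not> (c \<noteq> (\<lambda>i. 0) \<and> (\<forall>j. (\<Sum>i\<in>UNIV. c i * jac x $ i $ j) = 0))"
    using assms(1) row_relation_iff_det_0[of "jac x"] by blast
  then show ?thesis using assms(2) by (auto simp: fun_eq_iff)
qed

lemma gradient_unique:
  assumes "\<And>i. F i \<in> poly_ring" "\<And>i. G i \<in> poly_ring"
    and "\<And>j x. (\<Sum>i\<in>UNIV. F i x * partial j (\<tau> i) x) = (\<Sum>i\<in>UNIV. G i x * partial j (\<tau> i) x)"
  shows "F i = G i"
proof (rule poly_ring_cancel[OF det_jac_poly assms(1,2) det_jac_nonzero_poly])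
  fix x assume "det (jac x) \<noteq> 0"
  then have "F i x - G i x = 0"
    by (rule gradient_independent[where c = "\<lambda>i. F i x - G i x"])
      (simp add: left_diff_distrib sum_subtractf assms(3))
  then show "F i x = G i x" by simp
qed

lemma poly_ring_eq_det_jac_mult:
  assumes "f \<in> poly_ring" "\<And>\<gamma> x. \<gamma> \<in> P \<Longrightarrow> bform \<gamma> x = 0 \<Longrightarrow> f x = 0"
  shows "\<exists>q\<in>poly_ring. \<forall>x. f x = det (jac x) * q x"
proof -
  obtain C where C: "C \<noteq> 0" "\<And>x. det (jac x) = C * discriminant_root x"
    using det_jac_eq_discriminant_root by blast
  obtain q where "q \<in> poly_ring" "\<forall>x. f x = discriminant_root x * q x"
    using poly_ring_eq_discriminant_mult[OF assms] by (rule bexE)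
  then show ?thesis
    using C by (intro bexI[of _ "\<lambda>x. q x / C"] poly_ring_divide) simp_all
qed

text \<open>Solomon's theorem in degree one. On a mirror an equivariant field is tangent, like the
  gradients, so the numerators in Cramer's rule are zero there and the Jacobian divides them.
  Uniqueness of the coefficients makes them invariant.\<close>

lemma equivariant_eq_gradients:
  assumes F: "\<And>j. F j \<in> poly_ring"
    and equiv: "\<And>\<gamma> j x. \<gamma> \<in> R \<Longrightarrow>
      F j (reflection \<gamma> x) = F j x - \<gamma> $ j * (\<Sum>i\<in>UNIV. \<gamma> $ i * F i x)"
  shows "\<exists>G. (\<forall>i. G i \<in> invariants W) \<and>
    (\<forall>j x. F j x = (\<Sum>i\<in>UNIV. G i x * partial j (\<tau> i) x))"
proof -
  define N where "N i x = (\<chi> k l. if k = i then F l x else jac x $ k $ l)" for i x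
  have N_poly: "(\<lambda>x. det (N i x)) \<in> poly_ring" for i
  proof (rule poly_ring_det)
    show "(\<lambda>x. N i x $ k $ l) \<in> poly_ring" for k l
      by (cases "k = i") (simp_all add: N_def F partial_generator_poly)
  qed
  have N_zero: "det (N i x) = 0" if "\<gamma> \<in> P" "bform \<gamma> x = 0" for i x \<gamma>
  proof (rule ccontr)
    assume "det (N i x) \<noteq> 0"
    have \<gamma>: "\<gamma> \<in> R" using that P_subset by blast
    obtain j where j: "\<gamma> $ j \<noteq> 0" using root_component[OF \<gamma>] by blast
    have "\<gamma> $ j * (\<Sum>i\<in>UNIV. \<gamma> $ i * F i x) = 0"
      using equiv[OF \<gamma>, of j x] reflection_fixed[OF that(2)] by simp
    then have "(\<Sum>i\<in>UNIV. F i x * \<gamma> $ i) = 0" using j by (simp add: mult.commute)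
    moreover have "(\<Sum>l\<in>UNIV. partial l (\<tau> k) x * \<gamma> $ l) = 0" for k
      using normal_derivative_zero[OF generator_invariant \<gamma> that(2)]
      by (simp add: bform_def mult.commute)
    ultimately have "(N i x *v \<gamma>) $ k = 0" for k
      by (cases "k = i") (simp_all add: matrix_vector_mult_def N_def)
    then have "N i x *v \<gamma> = 0" by (simp only: vec_eq_iff zero_index) blast
    moreover have "inj ((*v) (N i x))"
      using \<open>det (N i x) \<noteq> 0\<close> by (simp add: inj_matrix_vector_mult invertible_det_nz)
    ultimately have "\<gamma> = 0" by (metis injD matrix_vector_mult_0_right)
    then show False using j by simp
  qed
  have "\<exists>q\<in>poly_ring. \<forall>x. det (N i x) = det (jac x) * q x" for i
    using N_poly N_zero by (rule poly_ring_eq_det_jac_mult)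
  then obtain G where G: "\<And>i. G i \<in> poly_ring" "\<And>i x. det (N i x) = det (jac x) * G i x"
    by metis
  have FG: "F j = (\<lambda>x. \<Sum>i\<in>UNIV. G i x * partial j (\<tau> i) x)" for j
  proof (rule poly_ring_cancel[OF det_jac_poly F _ det_jac_nonzero_poly])
    show "(\<lambda>x. \<Sum>i\<in>UNIV. G i x * partial j (\<tau> i) x) \<in> poly_ring"
      by (intro poly_ring_intros G generator_poly)
    fix x assume nz: "det (jac x) \<noteq> 0"
    then have "det (transpose (jac x)) \<noteq> 0" by simp
    then obtain c where c: "transpose (jac x) *v c = (\<chi> l. F l x)"
      by (meson cramer)
    then have Fc: "F l x = (\<Sum>i\<in>UNIV. c $ i * partial l (\<tau> i) x)" for l
      by (simp add: vec_eq_iff matrix_vector_mult_def transpose_def mult.commute)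
    have "G i x = c $ i" for i
    proof -
      have *: "(\<Sum>k\<in>UNIV. c $ k *s row k (jac x)) = (\<chi> l. F l x)"
        by (simp add: vec_eq_iff row_def Fc)
      have "det (\<chi> k. if k = i then (\<chi> l. F l x) else row k (jac x)) = c $ i * det (jac x)"
        using cramer_lemma_transpose[of i c "jac x"] unfolding * .
      moreover have "(\<chi> k. if k = i then (\<chi> l. F l x) else row k (jac x)) = N i x"
        by (simp add: N_def vec_eq_iff row_def)
      ultimately show ?thesis using G(2)[of i x] nz by simp
    qed
    then show "F j x = (\<Sum>i\<in>UNIV. G i x * partial j (\<tau> i) x)" by (simp add: Fc)
  qed
  have "G i \<in> invariants W" for i
    unfolding invariants_iff
  proof (intro conjI ballI allI G(1))
    fix \<gamma> x assume \<gamma>: "\<gamma> \<in> R"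
    have "(\<lambda>x. G i (reflection \<gamma> x)) = G i"
    proof (rule gradient_unique)
      fix j x
      let ?s = "reflection \<gamma>"
      define H where "H j = (\<Sum>i\<in>UNIV. G i (?s x) * partial j (\<tau> i) x)" for j
      have H: "(\<Sum>k\<in>UNIV. \<gamma> $ k * H k) = (\<Sum>i\<in>UNIV. G i (?s x) * bform \<gamma> (grad (\<tau> i) x))"
        unfolding H_def bform_def sum_distrib_left
        by (subst sum.swap) (simp add: mult_ac)
      have eqH: "F j (?s x) = H j - \<gamma> $ j * (\<Sum>k\<in>UNIV. \<gamma> $ k * H k)" for j
        unfolding H unfolding FG H_def
        by (simp add: partial_invariant_reflection[OF generator_invariant \<gamma>] right_diff_distrib
            sum_subtractf sum_distrib_left mult_ac)
      have 1: "F j x - H j = \<gamma> $ j * (\<Sum>k\<in>UNIV. \<gamma> $ k * (F k x - H k))" for j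
      proof -
        have "F j x - H j = \<gamma> $ j * (\<Sum>k\<in>UNIV. \<gamma> $ k * F k x) - \<gamma> $ j * (\<Sum>k\<in>UNIV. \<gamma> $ k * H k)"
          using eqH[of j] equiv[OF \<gamma>, of j x] by algebra
        then show ?thesis by (simp add: right_diff_distrib sum_subtractf)
      qed
      \<comment> \<open>The difference of \<open>F\<close> and \<open>H\<close> is \<open>e\<close>
        times \<open>\<gamma>\<close>; pairing it with \<open>\<gamma>\<close> gives e = 2
        e.\<close>
      define e where "e = (\<Sum>k\<in>UNIV. \<gamma> $ k * (F k x - H k))"
      have "e = (\<Sum>k\<in>UNIV. \<gamma> $ k * (\<gamma> $ k * e))"
        unfolding e_def using 1 by (metis (no_types, lifting) sum.cong)
      also have "\<dots> = 2 * e"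
        unfolding root_norm[OF \<gamma>, symmetric] bform_def sum_distrib_right
        by (simp add: mult.assoc)
      finally have "e = 0" by simp
      then have "F j x = H j" using 1[of j] by (simp add: e_def)
      then show "(\<Sum>i\<in>UNIV. G i (?s x) * partial j (\<tau> i) x) = (\<Sum>i\<in>UNIV. G i x * partial j (\<tau> i) x)"
        by (simp add: H_def FG)
    qed (intro G poly_ring_reflection)+
    then show "G i (reflection \<gamma> x) = G i x" by (rule fun_cong)
  qed
  with FG show ?thesis by (intro exI[of _ G]) auto
qed

text \<open>Cramer's rule with columns replaced. At a generic mirror point a row relation of the
  Jacobian persists in the modified matrix, so the numerator is zero there and, by irreducibility of
  the mirror, on all of it. This is the criterion for a field with possible simple poles to be
  polynomial.\<close>

lemma column_eq_jac_mult:
  assumes F: "\<And>i. F i \<in> poly_ring"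
    and mirror: "\<And>\<gamma> z k. \<gamma> \<in> P \<Longrightarrow> generic_point z \<Longrightarrow> bform \<gamma> z = 0 \<Longrightarrow> k \<noteq> (\<lambda>i. 0) \<Longrightarrow>
      (\<And>j. (\<Sum>i\<in>UNIV. k i * partial j (\<tau> i) z) = 0) \<Longrightarrow> (\<Sum>i\<in>UNIV. k i * F i z) = 0"
  shows "\<exists>Q. (\<forall>l. Q l \<in> poly_ring) \<and> (\<forall>i x. F i x = (\<Sum>l\<in>UNIV. Q l x * partial l (\<tau> i) x))"
proof -
  define N where "N l x = (\<chi> i a. if a = l then F i x else jac x $ i $ a)" for l x
  have N_poly: "(\<lambda>x. det (N l x)) \<in> poly_ring" for l
  proof (rule poly_ring_det)
    show "(\<lambda>x. N l x $ i $ a) \<in> poly_ring" for i a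
      by (cases "a = l") (simp_all add: N_def F partial_generator_poly)
  qed
  have N_generic: "det (N l z) = 0" if "\<gamma> \<in> P" "bform \<gamma> z = 0" "generic_point z" for l z \<gamma>
  proof -
    have "det (jac z) = 0" using det_jac_zero_on_mirror P_subset that by blast
    then obtain k where k: "k \<noteq> (\<lambda>i. 0)" "\<And>j. (\<Sum>i\<in>UNIV. k i * jac z $ i $ j) = 0"
      using row_relation_iff_det_0[of "jac z"] by blast
    then have "(\<Sum>i\<in>UNIV. k i * F i z) = 0"
      using that by (intro mirror) auto
    then have "(\<Sum>i\<in>UNIV. k i * N l z $ i $ a) = 0" for a
      using k(2)[of a] by (cases "a = l") (simp_all add: N_def)
    then show ?thesis using k(1) row_relation_iff_det_0[of "N l z"] by blast
  qed
  have N_zero: "det (N l x) = 0" if mem: "\<gamma> \<in> P" "bform \<gamma> x = 0" for l x \<gamma>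
  proof -
    obtain g z where g: "g \<in> poly_ring" "bform \<gamma> z = 0" "g z \<noteq> 0"
      "\<And>x. bform \<gamma> x = 0 \<Longrightarrow> g x \<noteq> 0 \<Longrightarrow> generic_point x"
      using generic_on_mirror[OF mem(1)] by blast
    show ?thesis
    proof (rule poly_ring_zero_on_mirror[OF N_poly g(1) _ _ g(2,3) mem(2)])
      show "bform \<gamma> \<gamma> \<noteq> 0" using positive_root_norm[OF mem(1)] by simp
    qed (use N_generic[OF mem(1)] g(4) in blast)
  qed
  have "\<exists>q\<in>poly_ring. \<forall>x. det (N l x) = det (jac x) * q x" for l
    using N_poly N_zero by (rule poly_ring_eq_det_jac_mult)
  then obtain Q where Q: "\<And>l. Q l \<in> poly_ring" "\<And>l x. det (N l x) = det (jac x) * Q l x"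
    by metis
  have "F i = (\<lambda>x. \<Sum>l\<in>UNIV. Q l x * partial l (\<tau> i) x)" for i
  proof (rule poly_ring_cancel[OF det_jac_poly F _ det_jac_nonzero_poly])
    show "(\<lambda>x. \<Sum>l\<in>UNIV. Q l x * partial l (\<tau> i) x) \<in> poly_ring"
      by (intro poly_ring_intros Q generator_poly)
    fix x assume nz: "det (jac x) \<noteq> 0"
    have "(\<chi> i a. if a = l then (\<chi> i. F i x) $ i else jac x $ i $ a) = N l x" for l
      by (simp add: N_def vec_eq_iff)
    then have "jac x *v (\<chi> l. Q l x) = (\<chi> i. F i x)"
      unfolding cramer[OF nz] using Q(2)[of _ x] nz by (simp only:) (simp add: vec_eq_iff)
    then show "F i x = (\<Sum>l\<in>UNIV. Q l x * partial l (\<tau> i) x)"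
      by (simp add: vec_eq_iff matrix_vector_mult_def mult.commute)
  qed
  then show ?thesis using Q(1) by (intro exI[of _ Q]) auto
qed

section \<open>Derivations with respect to the basic invariants\<close>

lemma invariant_const: "(\<lambda>x. a) \<in> invariants W"
  and invariant_add: "f \<in> invariants W \<Longrightarrow> g \<in> invariants W \<Longrightarrow> (\<lambda>x. f x + g x) \<in> invariants W"
  and invariant_mult: "f \<in> invariants W \<Longrightarrow> g \<in> invariants W \<Longrightarrow> (\<lambda>x. f x * g x) \<in> invariants W"
  and invariant_diff: "f \<in> invariants W \<Longrightarrow> g \<in> invariants W \<Longrightarrow> (\<lambda>x. f x - g x) \<in> invariants W"
  by (auto simp: invariants_iff)

lemma invariant_sum: "(\<And>i. i \<in> A \<Longrightarrow> f i \<in> invariants W) \<Longrightarrow> (\<lambda>x. \<Sum>i\<in>A. f i x) \<in> invariants W"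
  by (induction A rule: infinite_finite_induct) (auto simp: invariant_const invariant_add)

lemmas invariant_intros = invariant_const invariant_add invariant_mult invariant_diff invariant_sum
  generator_invariant

text \<open>Partial derivative with respect to generator i, read off from the expansion of the
  gradient. It is meaningful on invariants, where the expansion is unique.\<close>

definition D :: "'n \<Rightarrow> (complex^'n \<Rightarrow> complex) \<Rightarrow> complex^'n \<Rightarrow> complex" where
  "D i f = (SOME F. (\<forall>i. F i \<in> invariants W) \<and>
    (\<forall>j x. partial j f x = (\<Sum>i\<in>UNIV. F i x * partial j (\<tau> i) x))) i"

lemma D_invariant: "f \<in> invariants W \<Longrightarrow> D i f \<in> invariants W"
  and partial_eq_D: "f \<in> invariants W \<Longrightarrow>
    partial j f x = (\<Sum>i\<in>UNIV. D i f x * partial j (\<tau> i) x)"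
proof -
  assume f: "f \<in> invariants W"
  let ?Q = "\<lambda>F. (\<forall>i. F i \<in> invariants W) \<and>
    (\<forall>j x. partial j f x = (\<Sum>i\<in>UNIV. F i x * partial j (\<tau> i) x))"
  have eq: "(\<lambda>i. D i f) = (SOME F. ?Q F)" by (rule ext) (simp only: D_def)
  have "?Q (\<lambda>i. D i f)" using someI_ex[OF gradient_span[OF f]] unfolding eq[symmetric] .
  then show "D i f \<in> invariants W"
    "partial j f x = (\<Sum>i\<in>UNIV. D i f x * partial j (\<tau> i) x)" by blast+
qed

lemma D_eqI:
  assumes "f \<in> invariants W" "\<And>i. F i \<in> poly_ring"
    "\<And>j x. partial j f x = (\<Sum>i\<in>UNIV. F i x * partial j (\<tau> i) x)"
  shows "D i f = F i"
  using assms by (intro gradient_unique) (auto simp: D_invariant invariants_poly partial_eq_D[symmetric])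

lemma D_const: "D i (\<lambda>x. a) = (\<lambda>x. 0)"
  by (rule D_eqI) (auto simp: invariant_const)

lemma D_generator: "D i (\<tau> k) = (\<lambda>x. if i = k then 1 else 0)"
  by (rule D_eqI[where F = "\<lambda>i x. if i = k then 1 else 0"])
    (auto simp: generator_invariant mult_if_delta)

lemma D_add:
  assumes "f \<in> invariants W" "g \<in> invariants W"
  shows "D i (\<lambda>x. f x + g x) = (\<lambda>x. D i f x + D i g x)"
  by (rule D_eqI[where F = "\<lambda>i x. D i f x + D i g x"])
    (use assms in \<open>auto simp: invariant_add partial_add invariants_poly D_invariant partial_eq_D
      distrib_right sum.distrib\<close>)

lemma D_diff:
  assumes "f \<in> invariants W" "g \<in> invariants W"
  shows "D i (\<lambda>x. f x - g x) = (\<lambda>x. D i f x - D i g x)"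
  by (rule D_eqI[where F = "\<lambda>i x. D i f x - D i g x"])
    (use assms in \<open>auto simp: invariant_diff partial_diff invariants_poly D_invariant partial_eq_D
      left_diff_distrib sum_subtractf\<close>)

lemma D_mult:
  assumes "f \<in> invariants W" "g \<in> invariants W"
  shows "D i (\<lambda>x. f x * g x) = (\<lambda>x. D i f x * g x + f x * D i g x)"
proof (rule D_eqI[where F = "\<lambda>i x. D i f x * g x + f x * D i g x"])
  show "(\<lambda>x. D i f x * g x + f x * D i g x) \<in> poly_ring" for i
    by (intro poly_ring_intros invariants_poly D_invariant assms)
  show "partial j (\<lambda>x. f x * g x) x
      = (\<Sum>i\<in>UNIV. (D i f x * g x + f x * D i g x) * partial j (\<tau> i) x)" for j x
    using assms by (simp add: partial_mult invariants_poly partial_eq_D distrib_right sum.distrib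
        sum_distrib_left sum_distrib_right mult.assoc) (simp add: mult_ac)
qed (intro invariant_mult assms)

lemma D_cmult: "f \<in> invariants W \<Longrightarrow> D i (\<lambda>x. a * f x) = (\<lambda>x. a * D i f x)"
  by (subst D_mult) (auto simp: invariant_const D_const)

lemma D_sum:
  assumes "\<And>k. k \<in> A \<Longrightarrow> f k \<in> invariants W"
  shows "D i (\<lambda>x. \<Sum>k\<in>A. f k x) = (\<lambda>x. \<Sum>k\<in>A. D i (f k) x)"
  using assms
  by (induction A rule: infinite_finite_induct) (auto simp: D_const D_add invariant_sum)

lemma D_commute:
  assumes "f \<in> invariants W"
  shows "D i (D j f) = D j (D i f)"
  using assms unfolding generate[symmetric]
proof induction
  case (gen f)
  then obtain k where "f = \<tau> k" by auto
  then show ?case by (simp add: D_generator D_const)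
next
  case (mult f g)
  then have "f \<in> invariants W" "g \<in> invariants W" by (simp_all add: generate)
  then show ?case using mult.IH
    by (simp add: D_mult D_add D_invariant invariant_mult fun_eq_iff algebra_simps)
next
  case (add f g)
  then have "f \<in> invariants W" "g \<in> invariants W" by (simp_all add: generate)
  then show ?case using add.IH by (simp add: D_add D_invariant)
qed (simp add: D_const)

section \<open>Powers of the derivations as a measure of degree\<close>

lemma D_pow_invariant: "f \<in> invariants W \<Longrightarrow> (D i ^^ k) f \<in> invariants W"
  by (induction k) (auto simp: D_invariant)

lemma D_pow_0: "(D i ^^ k) (\<lambda>x. 0) = (\<lambda>x. 0)"
  by (induction k) (auto simp: D_const)

lemma D_pow_add:
  assumes "f \<in> invariants W" "g \<in> invariants W"
  shows "(D i ^^ k) (\<lambda>x. f x + g x) = (\<lambda>x. (D i ^^ k) f x + (D i ^^ k) g x)"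
  using assms by (induction k) (auto simp: D_add D_pow_invariant)

lemma D_pow_mono:
  assumes "(D i ^^ k) f = (\<lambda>x. 0)" "k \<le> m"
  shows "(D i ^^ m) f = (\<lambda>x. 0)"
proof -
  obtain l where "m = l + k" using assms(2) by (metis add.commute le_Suc_ex)
  then show ?thesis by (simp add: funpow_add assms(1) D_pow_0)
qed

lemma D_pow_mult_eq_0:
  assumes "f \<in> invariants W" "g \<in> invariants W"
    "(D i ^^ k) f = (\<lambda>x. 0)" "(D i ^^ l) g = (\<lambda>x. 0)"
  shows "(D i ^^ (k + l)) (\<lambda>x. f x * g x) = (\<lambda>x. 0)"
  using assms
proof (induction "k + l" arbitrary: k l f g)
  case 0
  then show ?case by simp
next
  case (Suc n)
  show ?case
  proof (cases "k = 0 \<or> l = 0")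
    case True
    then have "(\<lambda>x. f x * g x) = (\<lambda>x. 0)" using Suc.prems by (auto simp: fun_eq_iff)
    then show ?thesis by (simp add: D_pow_0)
  next
    case False
    then obtain k' l' where kl: "k = Suc k'" "l = Suc l'" by (meson not0_implies_Suc)
    have 1: "(D i ^^ n) (\<lambda>x. D i f x * g x) = (\<lambda>x. 0)"
      using Suc.hyps(1)[of k' l "D i f" g] Suc.hyps(2) Suc.prems kl
      by (simp add: D_invariant funpow_swap1)
    have 2: "(D i ^^ n) (\<lambda>x. f x * D i g x) = (\<lambda>x. 0)"
      using Suc.hyps(1)[of k l' f "D i g"] Suc.hyps(2) Suc.prems kl
      by (simp add: D_invariant funpow_swap1)
    have "(D i ^^ (k + l)) (\<lambda>x. f x * g x) = (D i ^^ n) (D i (\<lambda>x. f x * g x))"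
      unfolding Suc.hyps(2)[symmetric] by (simp add: funpow_swap1)
    also have "\<dots> = (\<lambda>x. 0)"
      unfolding D_mult[OF Suc.prems(1,2)]
      using Suc.prems 1 2 by (subst D_pow_add) (auto intro: invariant_mult D_invariant)
    finally show ?thesis .
  qed
qed

lemma D_nilpotent:
  assumes "f \<in> invariants W"
  shows "\<exists>k. (D i ^^ k) f = (\<lambda>x. 0)"
  using assms unfolding generate[symmetric]
proof induction
  case (const a)
  then show ?case by (intro exI[of _ 1]) (simp add: D_const)
next
  case (gen f)
  then obtain k where "f = \<tau> k" by auto
  then show ?case by (intro exI[of _ 2]) (simp add: D_generator D_const numeral_2_eq_2)
next
  case (add f g)
  then obtain k l where "(D i ^^ k) f = (\<lambda>x. 0)" "(D i ^^ l) g = (\<lambda>x. 0)" by blast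
  then have "(D i ^^ max k l) f = (\<lambda>x. 0)" "(D i ^^ max k l) g = (\<lambda>x. 0)"
    by (auto elim: D_pow_mono)
  then show ?case using add.hyps by (intro exI[of _ "max k l"]) (simp add: D_pow_add generate)
next
  case (mult f g)
  then obtain k l where "(D i ^^ k) f = (\<lambda>x. 0)" "(D i ^^ l) g = (\<lambda>x. 0)" by blast
  then have "(D i ^^ (k + l)) (\<lambda>x. f x * g x) = (\<lambda>x. 0)"
    using mult.hyps by (intro D_pow_mult_eq_0) (simp_all add: generate)
  then show ?case by (rule exI)
qed

text \<open>Leibniz rule for a factor of degree at most one in generator i: all but two terms drop
  out.\<close>

lemma D_pow_mult_linear:
  assumes "f \<in> invariants W" "g \<in> invariants W" "D i g = (\<lambda>x. c)"
  shows "(D i ^^ Suc k) (\<lambda>x. g x * f x)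
    = (\<lambda>x. g x * (D i ^^ Suc k) f x + of_nat (Suc k) * c * (D i ^^ k) f x)"
proof (induction k)
  case 0
  then show ?case by (simp add: D_mult assms fun_eq_iff)
next
  case (Suc k)
  let ?f = "\<lambda>m. (D i ^^ m) f"
  have inv: "?f m \<in> invariants W" for m by (rule D_pow_invariant[OF assms(1)])
  have "(D i ^^ Suc (Suc k)) (\<lambda>x. g x * f x)
      = D i (\<lambda>x. g x * ?f (Suc k) x + of_nat (Suc k) * c * ?f k x)"
    using Suc.IH by simp
  also have "\<dots> = (\<lambda>x. D i g x * ?f (Suc k) x + g x * D i (?f (Suc k)) x
      + of_nat (Suc k) * c * D i (?f k) x)"
    by (subst D_add, intro invariant_mult assms inv, intro invariant_mult invariant_const inv)
      (simp only: D_mult[OF assms(2) inv] D_cmult[OF inv])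
  also have "\<dots> = (\<lambda>x. g x * ?f (Suc (Suc k)) x + of_nat (Suc (Suc k)) * c * ?f (Suc k) x)"
    by (simp add: assms(3) fun_eq_iff algebra_simps)
  finally show ?case .
qed

end

section \<open>Commuting Hessians\<close>

context invariant_generators
begin

definition met :: "'n \<Rightarrow> 'n \<Rightarrow> complex^'n \<Rightarrow> complex" where
  "met a b x = (\<Sum>i\<in>UNIV. partial i (\<tau> a) x * partial i (\<tau> b) x)"

definition hess :: "'n \<Rightarrow> complex^'n \<Rightarrow> complex^'n^'n" where
  "hess k x = (\<chi> i j. partial i (partial j (\<tau> k)) x)"

lemma hess_nth [simp]: "hess k x $ i $ j = partial i (partial j (\<tau> k)) x"
  by (simp add: hess_def)

lemma hess_symmetric: "partial i (partial j (\<tau> k)) x = partial j (partial i (\<tau> k)) x"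
  using partial_commute[OF generator_poly] by metis

lemma met_eq_bform: "met a b x = bform (grad (\<tau> a) x) (grad (\<tau> b) x)"
  by (simp add: met_def bform_def)

lemma grad_reflection:
  assumes "f \<in> invariants W" "\<gamma> \<in> R"
  shows "grad f (reflection \<gamma> x) = reflection \<gamma> (grad f x)"
  by (simp add: vec_eq_iff partial_invariant_reflection[OF assms] reflection_root[OF assms(2), of "grad f x"])

lemma met_poly: "met a b \<in> poly_ring"
  unfolding met_def[abs_def] by (intro poly_ring_intros generator_poly)

lemma met_invariant: "met a b \<in> invariants W"
  unfolding invariants_iff
proof (intro conjI ballI allI met_poly)
  fix \<gamma> x assume \<gamma>: "\<gamma> \<in> R"
  show "met a b (reflection \<gamma> x) = met a b x"
    unfolding met_eq_bform grad_reflection[OF generator_invariant \<gamma>]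
    by (rule bform_reflection[OF root_nonisotropic[OF \<gamma>]])
qed

lemma euler_generator: "(\<Sum>j\<in>UNIV. x $ j * partial j (\<tau> k) x) = of_nat (d k) * \<tau> k x"
  by (rule euler_homogeneous[OF generator_poly generator_scale])

lemma hess_euler: "hess k x *v x = (of_nat (d k) - 1) *s grad (\<tau> k) x"
proof -
  have "(\<Sum>j\<in>UNIV. x $ j * partial i (partial j (\<tau> k)) x) = (of_nat (d k) - 1) * partial i (\<tau> k) x" for i
  proof -
    have "partial i (\<lambda>x. \<Sum>j\<in>UNIV. x $ j * partial j (\<tau> k) x) x
        = (\<Sum>j\<in>UNIV. (if i = j then partial j (\<tau> k) x else 0) + x $ j * partial i (partial j (\<tau> k)) x)"
    proof -
      have "partial i (\<lambda>x. x $ j * partial j (\<tau> k) x) x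
          = (if i = j then partial j (\<tau> k) x else 0) + x $ j * partial i (partial j (\<tau> k)) x" for j
        by (simp add: partial_mult poly_ring_coord partial_generator_poly)
      then show ?thesis
        by (subst partial_sum) (auto intro!: poly_ring_intros generator_poly)
    qed
    moreover have "partial i (\<lambda>x. \<Sum>j\<in>UNIV. x $ j * partial j (\<tau> k) x) x = of_nat (d k) * partial i (\<tau> k) x"
      unfolding euler_generator by (simp add: partial_cmult generator_poly)
    ultimately show ?thesis by (simp add: sum.distrib algebra_simps)
  qed
  then have "(hess k x *v x) $ i = (of_nat (d k) - 1) * partial i (\<tau> k) x" for i
    by (simp add: matrix_vector_mult_def mult.commute)
  then show ?thesis by (simp only: vec_eq_iff vector_smult_component vec_lambda_beta) blast
qed

lemma roots_span: "(\<And>\<gamma>. \<gamma> \<in> R \<Longrightarrow> bform \<gamma> u = 0) \<Longrightarrow> u = 0"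
proof -
  assume *: "\<And>\<gamma>. \<gamma> \<in> R \<Longrightarrow> bform \<gamma> u = 0"
  have "bform y u = 0" for y
  proof (rule vec.span_induct[of y R "\<lambda>y. bform y u = 0"])
    show "y \<in> vec.span R" using root_system by (simp add: coxeter_root_system_def)
    show "vec.subspace {y. bform y u = 0}"
      by (rule vec.subspaceI) (auto simp: bform_simps)
  qed (rule *)
  then show "u = 0" by (intro bform_eqI) (simp add: bform_commute[of u])
qed

text \<open>A generator of degree 0 or 1 has constant gradient, which is zero: by homogeneity in
  degree 0, and in degree 1 because at the origin it is orthogonal to all roots. A zero row
  contradicts the nonzero Jacobian. This licenses division by d - 1.\<close>

lemma degree_ge_2: "d k \<ge> 2"
proof (rule ccontr)
  assume "\<not> d k \<ge> 2"
  then consider "d k = 0" | "d k = 1" by linarith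
  then have "grad (\<tau> k) x = 0" for x
  proof cases
    case 1
    have "partial j (\<tau> k) x = 0" for j
    proof (rule poly_ring_scale_zero[OF partial_generator_poly])
      show "s * partial j (\<tau> k) (s *s x) = partial j (\<tau> k) x" for s
        using partial_homogeneous[OF generator_poly generator_scale, of s j k x] 1 by simp
    qed
    then show ?thesis by (simp add: vec_eq_iff)
  next
    case 2
    have "partial j (\<tau> k) x = partial j (\<tau> k) 0" for j x
    proof -
      obtain p where p: "\<And>z. partial j (\<tau> k) (0 + z *s x) = poly p z"
        using poly_ring_on_line[OF partial_generator_poly] by blast
      have "p = [:partial j (\<tau> k) x:]"
      proof (rule poly_eq_if_eq_off_0)
        fix z :: complex assume "z \<noteq> 0"
        then show "poly p z = poly [:partial j (\<tau> k) x:] z"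
          using partial_homogeneous[OF generator_poly generator_scale, of z j k x] 2 p[of z] by simp
      qed
      then show ?thesis using p[of 0] by simp
    qed
    then have "grad (\<tau> k) x = grad (\<tau> k) 0" by (simp add: vec_eq_iff)
    also have "\<dots> = 0"
      by (rule roots_span) (rule normal_derivative_zero[OF generator_invariant], simp_all)
    finally show ?thesis .
  qed
  then have "partial j (\<tau> k) x = 0" for j x by (simp add: vec_eq_iff)
  then have "det (jac x) = 0" for x
    using row_relation_iff_det_0[of "jac x"]
    by (auto simp: mult_if_delta fun_eq_iff intro!: exI[of _ "\<lambda>i. if i = k then 1 else 0"])
  then show False using det_jac_nonzero_poly by (simp add: fun_eq_iff)
qed

lemma degree_minus_1_nonzero: "of_nat (d k) - (1::complex) \<noteq> 0"
proof -
  have "d k \<noteq> 1" using degree_ge_2[of k] by simp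
  then have "of_nat (d k) \<noteq> (of_nat 1 :: complex)" by (simp only: of_nat_eq_iff not_False_eq_True)
  then show ?thesis by (metis of_nat_1 right_minus_eq)
qed

lemma hess_reflection:
  assumes \<gamma>: "\<gamma> \<in> R"
  shows "reflection \<gamma> (hess k (reflection \<gamma> x) *v u) = hess k x *v reflection \<gamma> u"
proof -
  let ?s = "reflection \<gamma>" let ?H = "hess k x" let ?H' = "hess k (?s x)"
  have entry: "?H' $ i $ j - \<gamma> $ i * (\<Sum>m\<in>UNIV. \<gamma> $ m * ?H' $ m $ j)
      = ?H $ i $ j - (\<Sum>m\<in>UNIV. ?H $ i $ m * \<gamma> $ m) * \<gamma> $ j" for i j
  proof -
    have "(\<lambda>x. partial j (\<tau> k) (?s x)) = (\<lambda>x. partial j (\<tau> k) x - bform \<gamma> (grad (\<tau> k) x) * \<gamma> $ j)"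
      by (rule ext) (rule partial_invariant_reflection[OF generator_invariant \<gamma>])
    then have "partial i (\<lambda>x. partial j (\<tau> k) (?s x)) x
        = partial i (\<lambda>x. partial j (\<tau> k) x - (\<Sum>m\<in>UNIV. \<gamma> $ m * partial m (\<tau> k) x) * \<gamma> $ j) x"
      by (simp add: bform_def)
    also have "\<dots> = ?H $ i $ j - (\<Sum>m\<in>UNIV. ?H $ i $ m * \<gamma> $ m) * \<gamma> $ j"
    proof -
      have p: "(\<lambda>x. \<Sum>m\<in>UNIV. \<gamma> $ m * partial m (\<tau> k) x) \<in> poly_ring"
        by (intro poly_ring_intros generator_poly)
      have "partial i (\<lambda>x. \<Sum>m\<in>UNIV. \<gamma> $ m * partial m (\<tau> k) x)
          = (\<lambda>x. \<Sum>m\<in>UNIV. \<gamma> $ m * partial i (partial m (\<tau> k)) x)"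
        by (subst partial_sum) (auto simp: partial_cmult partial_generator_poly intro!: poly_ring_intros generator_poly)
      then show ?thesis
        using p by (simp add: partial_diff partial_mult partial_generator_poly poly_ring_intros mult.commute)
    qed
    finally show ?thesis
      unfolding partial_reflection[OF partial_generator_poly root_norm[OF \<gamma>]]
      by (simp add: bform_def)
  qed
  have "(?H' *v u) $ i - bform \<gamma> (?H' *v u) * \<gamma> $ i
      = (?H *v u) $ i - bform \<gamma> u * (?H *v \<gamma>) $ i" for i
  proof -
    have "bform \<gamma> (?H' *v u) = (\<Sum>j\<in>UNIV. (\<Sum>m\<in>UNIV. \<gamma> $ m * ?H' $ m $ j) * u $ j)"
      unfolding bform_def matrix_vector_mult_def
      by (simp add: sum_distrib_left sum_distrib_right mult.assoc) (rule sum.swap)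
    then have "(?H' *v u) $ i - bform \<gamma> (?H' *v u) * \<gamma> $ i
        = (\<Sum>j\<in>UNIV. (?H' $ i $ j - \<gamma> $ i * (\<Sum>m\<in>UNIV. \<gamma> $ m * ?H' $ m $ j)) * u $ j)"
      by (simp add: matrix_vector_mult_def[of _ u] left_diff_distrib sum_subtractf sum_distrib_right
          mult.commute[of _ "\<gamma> $ i"] sum_distrib_left[of "\<gamma> $ i"] mult.assoc)
    also have "\<dots> = (\<Sum>j\<in>UNIV. (?H $ i $ j - (\<Sum>m\<in>UNIV. ?H $ i $ m * \<gamma> $ m) * \<gamma> $ j) * u $ j)"
      unfolding entry ..
    also have "\<dots> = (?H *v u) $ i - (\<Sum>j\<in>UNIV. \<gamma> $ j * u $ j) * (\<Sum>m\<in>UNIV. ?H $ i $ m * \<gamma> $ m)"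
      by (simp add: matrix_vector_mult_def left_diff_distrib sum_subtractf sum_distrib_left[symmetric]
          mult.assoc)
    finally show ?thesis by (simp add: matrix_vector_mult_def bform_def)
  qed
  then show ?thesis
    by (simp add: reflection_root[OF \<gamma>] vec_eq_iff matrix_vector_mult_diff_distrib
        vector_scalar_commute)
qed

lemma christoffel_exists:
  "\<exists>G. (\<forall>i. G i \<in> invariants W) \<and>
    (\<forall>j x. (hess k x *v grad (\<tau> b) x) $ j = (\<Sum>i\<in>UNIV. G i x * partial j (\<tau> i) x))"
proof (rule equivariant_eq_gradients)
  show "(\<lambda>x. (hess k x *v grad (\<tau> b) x) $ j) \<in> poly_ring" for j
    unfolding matrix_vector_mult_def vec_lambda_beta hess_nth
    by (intro poly_ring_intros generator_poly)
  fix \<gamma> j x assume \<gamma>: "\<gamma> \<in> R"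
  let ?s = "reflection \<gamma>" let ?v = "hess k x *v grad (\<tau> b) x"
  have ss: "?s (?s y) = y" for y by (rule reflection_reflection[OF root_nonisotropic[OF \<gamma>]])
  have "?s (hess k (?s x) *v ?s (grad (\<tau> b) x)) = ?v"
    unfolding hess_reflection[OF \<gamma>] ss ..
  then have "hess k (?s x) *v grad (\<tau> b) (?s x) = ?s ?v"
    unfolding grad_reflection[OF generator_invariant \<gamma>] by (metis ss)
  then show "(hess k (?s x) *v grad (\<tau> b) (?s x)) $ j = ?v $ j - \<gamma> $ j * (\<Sum>i\<in>UNIV. \<gamma> $ i * ?v $ i)"
    by (simp add: reflection_root[OF \<gamma>] bform_def mult.commute)
qed

text \<open>The contravariant Christoffel symbols of the flat metric in the coordinates given by the
  generators.\<close>

definition chr :: "'n \<Rightarrow> 'n \<Rightarrow> 'n \<Rightarrow> complex^'n \<Rightarrow> complex" where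
  "chr k b = (SOME G. (\<forall>i. G i \<in> invariants W) \<and>
    (\<forall>j x. (hess k x *v grad (\<tau> b) x) $ j = (\<Sum>i\<in>UNIV. G i x * partial j (\<tau> i) x)))"

lemma chr_invariant: "chr k b i \<in> invariants W"
  and hess_grad: "(hess k x *v grad (\<tau> b) x) $ j = (\<Sum>i\<in>UNIV. chr k b i x * partial j (\<tau> i) x)"
  using someI_ex[OF christoffel_exists[of k b], folded chr_def] by blast+

lemma partial_met:
  "partial j (met a b) x = (hess a x *v grad (\<tau> b) x) $ j + (hess b x *v grad (\<tau> a) x) $ j"
proof -
  have "partial j (met a b) x = (\<Sum>i\<in>UNIV. partial j (partial i (\<tau> a)) x * partial i (\<tau> b) x
      + partial i (\<tau> a) x * partial j (partial i (\<tau> b)) x)"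
    unfolding met_def[abs_def]
    by (subst partial_sum) (auto simp: partial_mult partial_generator_poly intro!: poly_ring_intros generator_poly)
  then show ?thesis by (simp add: sum.distrib matrix_vector_mult_def mult.commute)
qed

lemma D_met: "D i (met a b) = (\<lambda>x. chr a b i x + chr b a i x)"
  by (rule D_eqI[OF met_invariant, where F = "\<lambda>i x. chr a b i x + chr b a i x"])
    (auto simp: invariants_poly chr_invariant partial_met hess_grad distrib_right sum.distrib
      intro!: poly_ring_intros)

lemma bform_hess_symmetric: "bform u (hess k x *v v) = bform v (hess k x *v u)"
  unfolding bform_def matrix_vector_mult_def vec_lambda_beta sum_distrib_left hess_nth
  by (subst sum.swap) (simp add: hess_symmetric[of _ _ k] mult_ac)

lemma bform_grad_span:
  assumes "\<And>j. v $ j = (\<Sum>i\<in>UNIV. c i * partial j (\<tau> i) x)"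
  shows "bform (grad (\<tau> a) x) v = (\<Sum>i\<in>UNIV. met a i x * c i)"
  unfolding bform_def assms met_def sum_distrib_left sum_distrib_right
  by (subst sum.swap) (simp add: mult_ac)

lemma bform_grad_hess:
  "bform (grad (\<tau> a) x) (hess k x *v grad (\<tau> b) x) = (\<Sum>i\<in>UNIV. met a i x * chr k b i x)"
  by (rule bform_grad_span[OF hess_grad])

text \<open>Let S a k b be the pairing of grad t^a with H_k grad t^b. By \<open>D_met\<close> each
  sum on the right consists of two values of S, and S a k b = S b k a because Hessians are
  symmetric. All values but twice S a k b cancel.\<close>

lemma koszul:
  "2 * (\<Sum>i\<in>UNIV. met a i x * chr k b i x)
    = (\<Sum>i\<in>UNIV. met a i x * D i (met b k) x) + (\<Sum>i\<in>UNIV. met b i x * D i (met a k) x)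
      - (\<Sum>i\<in>UNIV. met k i x * D i (met a b) x)"
proof -
  define S where "S a k b = (\<Sum>i\<in>UNIV. met a i x * chr k b i x)" for a k b
  have sym: "S a k b = S b k a" for a k b
    unfolding S_def bform_grad_hess[symmetric] by (rule bform_hess_symmetric)
  have "(\<Sum>i\<in>UNIV. met a i x * D i (met b k) x) = S a b k + S a k b" for a b k
    by (simp add: D_met S_def distrib_left sum.distrib)
  then show ?thesis
    using sym[of a k b] sym[of a b k] sym[of b a k] by (simp add: S_def[symmetric])
qed

end

text \<open>Saito's normalization carried over to the index type: \<open>e\<close> stands for the
  index 1 and \<open>star\<close> for the involution sending \<alpha> to n + 1 - \<alpha>.\<close>

locale saito_generators = invariant_generators R P \<tau> d
  for R P :: "(complex^'n) set" and \<tau> :: "'n \<Rightarrow> complex^'n \<Rightarrow> complex" and d :: "'n \<Rightarrow> nat" +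
  fixes star :: "'n \<Rightarrow> 'n" and e :: 'n
  assumes star_star: "star (star i) = i"
    and D_e_met: "D e (met a b) = (\<lambda>x. if b = star a then 1 else 0)"
begin

lemma D_e_D_met: "D e (D i (met a b)) = (\<lambda>x. 0)"
  unfolding D_commute[OF met_invariant, of e] D_e_met D_const ..

lemma D_e_sum_met:
  assumes "\<And>i. f i \<in> invariants W"
  shows "D e (\<lambda>x. \<Sum>i\<in>UNIV. met a i x * f i x)
    = (\<lambda>x. f (star a) x + (\<Sum>i\<in>UNIV. met a i x * D e (f i) x))"
proof -
  have "D e (\<lambda>x. met a i x * f i x)
      = (\<lambda>x. (if i = star a then f i x else 0) + met a i x * D e (f i) x)" for i
    by (simp add: D_mult[OF met_invariant assms] D_e_met fun_eq_iff)
  then show ?thesis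
    by (subst D_sum) (simp_all add: invariant_mult met_invariant assms sum.distrib)
qed

text \<open>Each Koszul term is g times a first derivative of g. That derivative does not depend on
  t^1, since \<open>D e\<close> maps g to constants, so the term has degree at most one in
  t^1.\<close>

lemma D_e_D_e_contraction: "D e (D e (\<lambda>x. \<Sum>i\<in>UNIV. met a i x * chr k b i x)) = (\<lambda>x. 0)"
proof -
  define K where "K a b k x = (\<Sum>i\<in>UNIV. met a i x * D i (met b k) x)" for a b k x
  have K: "K a b k \<in> invariants W" for a b k
    unfolding K_def[abs_def] by (intro invariant_intros met_invariant D_invariant)
  have "D e (K a b k) = D (star a) (met b k)" for a b k
    unfolding K_def[abs_def] by (subst D_e_sum_met) (simp_all add: D_invariant met_invariant D_e_D_met)
  then have DK: "D e (D e (K a b k)) = (\<lambda>x. 0)" for a b k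
    by (simp add: D_e_D_met)
  have "(\<lambda>x. \<Sum>i\<in>UNIV. met a i x * chr k b i x) = (\<lambda>x. 1 / 2 * (K a b k x + K b a k x - K k a b x))"
  proof
    show "(\<Sum>i\<in>UNIV. met a i x * chr k b i x) = 1 / 2 * (K a b k x + K b a k x - K k a b x)" for x
      unfolding K_def koszul[of a x k b, symmetric] by simp
  qed
  moreover have "D e (\<lambda>x. 1 / 2 * (K a b k x + K b a k x - K k a b x))
      = (\<lambda>x. 1 / 2 * (D e (K a b k) x + D e (K b a k) x - D e (K k a b) x))"
    by (simp only: D_cmult D_add D_diff K invariant_intros)
  moreover have "D e (\<lambda>x. 1 / 2 * (D e (K a b k) x + D e (K b a k) x - D e (K k a b) x)) = (\<lambda>x. 0)"
    by (simp only: D_cmult D_add D_diff K invariant_intros D_invariant DK) simp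
  ultimately show ?thesis by simp
qed

text \<open>
  The Christoffel symbols are polynomials in the basic invariants, so they are annihilated by a power
  of \<open>D e\<close>; comparing the top coefficients in \<open>g \<Gamma> = S\<close>, where \<open>g\<close> and \<open>S\<close> have degree at most 1
  in \<open>t\<^sup>1\<close>, lowers this power to 1.
\<close>

lemma D_e_chr: "D e (chr k b i) = (\<lambda>x. 0)"
proof -
  let ?N = "\<lambda>m. \<forall>i. (D e ^^ m) (chr k b i) = (\<lambda>x. 0)"
  \<comment> \<open>The contraction is only known to be killed by the square of \<open>D e\<close>,
    so the exponent must be at least two before it can be lowered, and the descent ends at
    one.\<close>
  have step: "?N (Suc m)" if N: "?N (Suc (Suc m))" for m
  proof
    fix i
    \<comment> \<open>The derivative of g along t^1 is the permutation matrix of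
      \<open>star\<close>, so this row isolates component i.\<close>
    let ?a = "star i"
    have "(D e ^^ Suc (Suc m)) (\<lambda>x. \<Sum>i\<in>UNIV. met ?a i x * chr k b i x)
        = (\<lambda>x. \<Sum>i\<in>UNIV. (D e ^^ Suc (Suc m)) (\<lambda>x. met ?a i x * chr k b i x) x)"
    proof -
      have "(D e ^^ m) (\<lambda>x. \<Sum>i\<in>A. f i x) = (\<lambda>x. \<Sum>i\<in>A. (D e ^^ m) (f i) x)"
        if "finite A" "\<And>i. f i \<in> invariants W" for m A f
        using that by (induction A) (auto simp: D_pow_0 D_pow_add invariant_sum)
      from this[OF finite invariant_mult[OF met_invariant chr_invariant]] show ?thesis .
    qed
    also have "\<dots> = (\<lambda>x. of_nat (Suc (Suc m)) * (D e ^^ Suc m) (chr k b i) x)"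
    proof -
      have "(D e ^^ Suc (Suc m)) (\<lambda>x. met ?a j x * chr k b j x)
          = (\<lambda>x. if j = i then of_nat (Suc (Suc m)) * (D e ^^ Suc m) (chr k b j) x else 0)" for j
        using D_pow_mult_linear[OF chr_invariant[of k b j] met_invariant[of ?a j] D_e_met, of "Suc m"] N
        by (simp add: star_star fun_eq_iff)
      then show ?thesis by simp
    qed
    finally have "(\<lambda>x. of_nat (Suc (Suc m)) * (D e ^^ Suc m) (chr k b i) x) = (\<lambda>x. 0)"
      using D_e_D_e_contraction[of ?a k b] by (simp add: funpow_swap1 D_pow_0)
    then have "of_nat (Suc (Suc m)) * (D e ^^ Suc m) (chr k b i) x = 0" for x by (rule fun_cong)
    then show "(D e ^^ Suc m) (chr k b i) = (\<lambda>x. 0)"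
      by (intro ext) (metis mult_eq_0_iff nat.distinct(1) of_nat_eq_0_iff)
  qed
  obtain n where n: "\<And>i. (D e ^^ n i) (chr k b i) = (\<lambda>x. 0)"
    using D_nilpotent[OF chr_invariant] by metis
  define m where "m = Max (range n)"
  have "?N (Suc m)"
  proof
    fix i
    have "n i \<le> Suc m" by (simp add: m_def le_SucI)
    with n show "(D e ^^ Suc m) (chr k b i) = (\<lambda>x. 0)" by (rule D_pow_mono)
  qed
  then have "?N (Suc 0)"
  proof (induction m)
    case (Suc m)
    then show ?case using step by blast
  qed
  then show ?thesis by simp
qed

lemma hess_commute: "hess k x ** hess b x = hess b x ** hess k x"
proof -
  define Om where "Om i j x = D i (chr k b j) x - D j (chr k b i) x" for i j x
  have Om_inv: "Om i j \<in> invariants W" for i j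
    unfolding Om_def[abs_def] by (intro invariant_intros D_invariant chr_invariant)
  have D_Om: "D e (Om i j) = (\<lambda>x. 0)" for i j
    unfolding Om_def[abs_def]
    by (simp add: D_diff D_invariant chr_invariant D_commute[OF chr_invariant, of e] D_e_chr D_const)
  \<comment> \<open>In the curl of H_k grad t^b the third derivatives of t^k cancel, which leaves
    H_k H_b minus its transpose H_b H_k. The chain rule writes the same curl with the coefficients
    \<open>Om\<close>.\<close>
  have commutator: "(hess k x ** hess b x - hess b x ** hess k x) $ l $ m
      = (\<Sum>j\<in>UNIV. \<Sum>i\<in>UNIV. partial l (\<tau> j) x * (Om i j x * partial m (\<tau> i) x))" for x l m
  proof -
    define F where "F l x = (\<Sum>p\<in>UNIV. partial l (partial p (\<tau> k)) x * partial p (\<tau> b) x)" for l x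
    have F1: "partial m (F l) x = (\<Sum>p\<in>UNIV. partial m (partial l (partial p (\<tau> k))) x * partial p (\<tau> b) x)
        + (hess k x ** hess b x) $ l $ m" for l m
    proof -
      have "partial m (F l) x = (\<Sum>p\<in>UNIV. partial m (partial l (partial p (\<tau> k))) x * partial p (\<tau> b) x
          + partial l (partial p (\<tau> k)) x * partial m (partial p (\<tau> b)) x)"
        unfolding F_def[abs_def]
        by (subst partial_sum) (auto simp: partial_mult partial_generator_poly partial_poly_ring
            intro!: poly_ring_intros generator_poly)
      then show ?thesis
        by (simp add: sum.distrib matrix_matrix_mult_def hess_symmetric[of m _ b])
    qed
    have F: "F l = (\<lambda>x. \<Sum>j\<in>UNIV. chr k b j x * partial l (\<tau> j) x)" for l
      using hess_grad[of k _ b l] by (simp add: F_def fun_eq_iff matrix_vector_mult_def)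
    have F2: "partial m (F l) x = (\<Sum>j\<in>UNIV. \<Sum>i\<in>UNIV. D i (chr k b j) x * partial m (\<tau> i) x * partial l (\<tau> j) x)
        + (\<Sum>j\<in>UNIV. chr k b j x * partial m (partial l (\<tau> j)) x)" for l m
      unfolding F by (subst partial_sum)
        (auto simp: partial_mult partial_generator_poly invariants_poly chr_invariant partial_eq_D
          sum.distrib sum_distrib_right intro!: poly_ring_mult)
    have third: "partial m (partial l (partial p (\<tau> k))) x = partial l (partial m (partial p (\<tau> k))) x" for p
      using partial_commute[OF partial_generator_poly] by metis
    have "(hess k x ** hess b x) $ l $ m - (hess k x ** hess b x) $ m $ l
        = partial m (F l) x - partial l (F m) x"
      unfolding F1 by (simp add: third)
    also have "\<dots> = (\<Sum>j\<in>UNIV. \<Sum>i\<in>UNIV. D i (chr k b j) x * partial m (\<tau> i) x * partial l (\<tau> j) x)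
        - (\<Sum>j\<in>UNIV. \<Sum>i\<in>UNIV. D i (chr k b j) x * partial l (\<tau> i) x * partial m (\<tau> j) x)"
      unfolding F2 by (simp add: hess_symmetric[of m l])
    also have "(\<Sum>j\<in>UNIV. \<Sum>i\<in>UNIV. D i (chr k b j) x * partial l (\<tau> i) x * partial m (\<tau> j) x)
        = (\<Sum>j\<in>UNIV. \<Sum>i\<in>UNIV. D j (chr k b i) x * partial l (\<tau> j) x * partial m (\<tau> i) x)"
      by (rule sum.swap)
    finally have "(hess k x ** hess b x) $ l $ m - (hess k x ** hess b x) $ m $ l
        = (\<Sum>j\<in>UNIV. \<Sum>i\<in>UNIV. partial l (\<tau> j) x * (Om i j x * partial m (\<tau> i) x))"
      by (simp add: Om_def sum_subtractf[symmetric] algebra_simps)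
    moreover have "(hess k x ** hess b x) $ m $ l = (hess b x ** hess k x) $ l $ m"
      by (simp add: matrix_matrix_mult_def hess_symmetric[of m _ k] hess_symmetric[of _ l b] mult.commute)
    ultimately show ?thesis by simp
  qed
  \<comment> \<open>Pairing the commutator with two gradients and letting the Hessians act through
    \<open>chr\<close> avoids derivatives of \<open>chr\<close>: only one factor g remains on the
    right, against two on the left.\<close>
  have contraction: "(\<Sum>j\<in>UNIV. met a j x * (\<Sum>i\<in>UNIV. met c i x * Om i j x))
      = (\<Sum>i\<in>UNIV. chr k a i x * (\<Sum>j\<in>UNIV. met i j x * chr b c j x))
        - (\<Sum>i\<in>UNIV. chr b a i x * (\<Sum>j\<in>UNIV. met i j x * chr k c j x))" for a c x
  proof -
    have span: "bform (hess k x *v grad (\<tau> a) x) v = (\<Sum>i\<in>UNIV. chr k a i x * bform (grad (\<tau> i) x) v)" for k a v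
      unfolding bform_def hess_grad sum_distrib_left sum_distrib_right
      by (subst sum.swap) (simp add: mult.assoc)
    have product: "bform (grad (\<tau> a) x) (hess k x *v (hess b x *v grad (\<tau> c) x))
        = (\<Sum>i\<in>UNIV. chr k a i x * (\<Sum>j\<in>UNIV. met i j x * chr b c j x))" for k b
      unfolding bform_hess_symmetric[of "grad (\<tau> a) x" k]
        bform_commute[of _ "hess k x *v grad (\<tau> a) x"] span bform_grad_hess ..
    have "((hess k x ** hess b x - hess b x ** hess k x) *v grad (\<tau> c) x) $ l
        = (\<Sum>j\<in>UNIV. (\<Sum>i\<in>UNIV. met c i x * Om i j x) * partial l (\<tau> j) x)" for l
    proof -
      have "((hess k x ** hess b x - hess b x ** hess k x) *v grad (\<tau> c) x) $ l
          = (\<Sum>m\<in>UNIV. \<Sum>j\<in>UNIV. \<Sum>i\<in>UNIV. partial l (\<tau> j) x * (Om i j x * (partial m (\<tau> i) x * partial m (\<tau> c) x)))"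
        unfolding matrix_vector_mult_def vec_lambda_beta commutator
        by (simp add: sum_distrib_right mult.assoc)
      also have "\<dots> = (\<Sum>j\<in>UNIV. \<Sum>i\<in>UNIV. \<Sum>m\<in>UNIV. partial l (\<tau> j) x * (Om i j x * (partial m (\<tau> i) x * partial m (\<tau> c) x)))"
        by (subst sum.swap, rule sum.cong[OF HOL.refl], rule sum.swap)
      also have "\<dots> = (\<Sum>j\<in>UNIV. (\<Sum>i\<in>UNIV. met c i x * Om i j x) * partial l (\<tau> j) x)"
        by (simp add: met_def sum_distrib_left sum_distrib_right mult_ac)
      finally show ?thesis .
    qed
    from bform_grad_span[OF this, of a] show ?thesis
      by (simp add: matrix_vector_mult_diff_rdistrib bform_diff product
          flip: matrix_vector_mul_assoc)
  qed
  have "Om i j x = 0" for i j x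
  proof -
    \<comment> \<open>Each \<open>D e\<close> falls on one of the two factors g; the two orders give
      the factor 2.\<close>
    have "D e (D e (\<lambda>x. \<Sum>q\<in>UNIV. met (star j) q x * (\<Sum>p\<in>UNIV. met (star i) p x * Om p q x)))
        = (\<lambda>x. 2 * Om i j x)"
      by (simp add: D_e_sum_met D_add Om_inv D_Om invariant_intros met_invariant star_star)
    moreover have "D e (D e (\<lambda>x. \<Sum>p\<in>UNIV. chr k a p x * (\<Sum>q\<in>UNIV. met p q x * chr b c q x))) = (\<lambda>x. 0)"
      for k a b c
    proof -
      have "D e (\<lambda>x. chr k a p x * (\<Sum>q\<in>UNIV. met p q x * chr b c q x)) = (\<lambda>x. chr k a p x * chr b c (star p) x)" for p
        by (simp add: D_mult D_e_sum_met chr_invariant met_invariant D_e_chr invariant_intros)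
      then have "D e (\<lambda>x. \<Sum>p\<in>UNIV. chr k a p x * (\<Sum>q\<in>UNIV. met p q x * chr b c q x))
          = (\<lambda>x. \<Sum>p\<in>UNIV. chr k a p x * chr b c (star p) x)"
        by (subst D_sum) (simp_all add: chr_invariant met_invariant invariant_intros)
      then show ?thesis
        by (simp add: D_sum D_mult chr_invariant D_e_chr invariant_intros)
    qed
    ultimately have "(\<lambda>x. 2 * Om i j x) = (\<lambda>x. 0)"
      unfolding contraction
      by (subst (asm) D_diff, intro invariant_intros chr_invariant met_invariant, intro invariant_intros chr_invariant met_invariant)
        (simp add: D_diff chr_invariant met_invariant invariant_intros D_invariant)
    then have "2 * Om i j x = 0" by (rule fun_cong)
    then show ?thesis by simp
  qed
  then show ?thesis
    using commutator[of x] by (simp add: vec_eq_iff)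
qed

lemma hess_grad_exchange:
  "(of_nat (d b) - 1) *s (hess k x *v grad (\<tau> b) x) = (of_nat (d k) - 1) *s (hess b x *v grad (\<tau> k) x)"
proof -
  have "hess k x *v (hess b x *v x) = hess b x *v (hess k x *v x)"
    by (simp add: matrix_vector_mul_assoc hess_commute)
  then show ?thesis unfolding hess_euler by (simp only: vector_scalar_commute)
qed

end

section \<open>Residues along the mirrors\<close>

context saito_generators
begin

text \<open>Structure constants of the product of gradients in which grad t^k acts as its Hessian
  divided by d_k - 1. Commuting Hessians make this product commutative.\<close>

definition coef :: "'n \<Rightarrow> 'n \<Rightarrow> 'n \<Rightarrow> complex^'n \<Rightarrow> complex" where
  "coef k b i x = chr k b i x / (of_nat (d k) - 1)"

lemma degree_ne_1: "d k \<noteq> Suc 0"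
  using degree_ge_2[of k] by simp

lemma coef_poly: "coef k b i \<in> poly_ring"
  unfolding coef_def[abs_def] by (intro poly_ring_intros invariants_poly chr_invariant)

lemma hess_grad_coef:
  "(hess k x *v grad (\<tau> b) x) $ j = (of_nat (d k) - 1) * (\<Sum>i\<in>UNIV. coef k b i x * partial j (\<tau> i) x)"
  using degree_minus_1_nonzero[of k]
  by (simp add: hess_grad coef_def sum_divide_distrib[symmetric] del: of_nat_eq_1_iff)

lemma coef_commute: "coef k b i = coef b k i"
proof (rule gradient_unique)
  fix j x
  have "(of_nat (d b) - 1) * (hess k x *v grad (\<tau> b) x) $ j
      = (of_nat (d k) - 1) * (hess b x *v grad (\<tau> k) x) $ j"
    using hess_grad_exchange[of b k x] by (metis vector_smult_component)
  then show "(\<Sum>i\<in>UNIV. coef k b i x * partial j (\<tau> i) x) = (\<Sum>i\<in>UNIV. coef b k i x * partial j (\<tau> i) x)"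
    unfolding hess_grad_coef using degree_minus_1_nonzero[of b] degree_minus_1_nonzero[of k] by simp
qed (rule coef_poly)+

text \<open>Duality of the degrees: \<open>met a (star a)\<close> is homogeneous of degree d_a +
  d_(star a) - 2 and contains t^1 with coefficient 1. The comparison is made by applying
  \<open>D e\<close> to Euler's identity.\<close>

lemma degree_star: "of_nat (d a) - 1 + (of_nat (d (star a)) - 1) = (of_nat (d e) :: complex)"
proof -
  let ?b = "star a" let ?\<delta> = "of_nat (d a) - 1 + (of_nat (d ?b) - 1) :: complex"
  have euler: "(\<Sum>i\<in>UNIV. of_nat (d i) * \<tau> i x * D i (met a ?b) x) = ?\<delta> * met a ?b x" for x
  proof -
    have "(\<Sum>j\<in>UNIV. x $ j * partial j (met a ?b) x) = bform x (hess a x *v grad (\<tau> ?b) x)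
        + bform x (hess ?b x *v grad (\<tau> a) x)"
      by (simp add: partial_met bform_def distrib_left sum.distrib)
    also have "\<dots> = ?\<delta> * met a ?b x"
      unfolding bform_hess_symmetric[of x] hess_euler
      by (simp only: bform_scale met_eq_bform bform_commute[of "grad (\<tau> ?b) x" "grad (\<tau> a) x"] distrib_right)
    finally have "(\<Sum>j\<in>UNIV. x $ j * partial j (met a ?b) x) = ?\<delta> * met a ?b x" .
    moreover have "(\<Sum>j\<in>UNIV. x $ j * partial j (met a ?b) x)
        = (\<Sum>i\<in>UNIV. D i (met a ?b) x * (\<Sum>j\<in>UNIV. x $ j * partial j (\<tau> i) x))"
      unfolding partial_eq_D[OF met_invariant] sum_distrib_left
      by (subst sum.swap) (simp add: mult_ac)
    ultimately show ?thesis by (simp add: euler_generator mult.commute)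
  qed
  have "D e (\<lambda>x. \<Sum>i\<in>UNIV. of_nat (d i) * \<tau> i x * D i (met a ?b) x) = (\<lambda>x. of_nat (d e))"
  proof -
    have "D e (\<lambda>x. of_nat (d i) * \<tau> i x * D i (met a ?b) x)
        = (\<lambda>x. if i = e then of_nat (d e) else 0)" for i
      by (cases "i = e")
        (simp_all add: D_mult D_cmult D_generator D_e_D_met D_e_met D_const D_invariant met_invariant invariant_intros)
    then show ?thesis
      by (subst D_sum) (simp_all add: D_invariant met_invariant invariant_intros)
  qed
  moreover have "D e (\<lambda>x. ?\<delta> * met a ?b x) = (\<lambda>x. ?\<delta>)"
    by (simp add: D_cmult[OF met_invariant] D_e_met)
  ultimately have "(\<lambda>x :: complex^'n. ?\<delta>) = (\<lambda>x. of_nat (d e))" unfolding euler by simp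
  then show ?thesis by (rule fun_cong)
qed

lemma degree_e_nonzero: "of_nat (d e) \<noteq> (0::complex)"
  using degree_ge_2[of e] by simp

text \<open>By commutativity both Christoffel symbols in \<open>D e (met a b)\<close> are multiples
  of \<open>coef a b e\<close>, so the normalization determines it; \<open>degree_star\<close>
  evaluates the sum of the two factors.\<close>

lemma coef_e: "of_nat (d e) * coef a b e x = (if b = star a then 1 else 0)"
proof -
  have "D e (met a b) x = (of_nat (d a) - 1 + (of_nat (d b) - 1)) * coef a b e x"
    using fun_cong[OF coef_commute[of b a e], of x]
      degree_minus_1_nonzero[of a] degree_minus_1_nonzero[of b]
    by (simp add: D_met coef_def field_simps)
  then have *: "(of_nat (d a) - 1 + (of_nat (d b) - 1)) * coef a b e x = (if b = star a then 1 else 0)"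
    by (simp add: D_e_met)
  show ?thesis
  proof (cases "b = star a")
    case True
    then show ?thesis using * degree_star[of a] by simp
  next
    case False
    have "of_nat (d a) - 1 + (of_nat (d b) - 1) = (of_nat (d a + d b - 2) :: complex)"
      using degree_ge_2[of a] degree_ge_2[of b] by (simp add: of_nat_diff)
    moreover have "d a + d b - 2 \<noteq> 0" using degree_ge_2[of a] degree_ge_2[of b] by simp
    ultimately have "of_nat (d a) - 1 + (of_nat (d b) - 1) \<noteq> (0::complex)"
      by (metis of_nat_eq_0_iff)
    then show ?thesis using * False by simp
  qed
qed

abbreviation nq :: "complex^'n \<Rightarrow> 'n \<Rightarrow> complex^'n \<Rightarrow> complex" where
  "nq \<gamma> b \<equiv> normal_quotient \<gamma> (\<tau> b)"

lemma nq_poly: "\<gamma> \<in> R \<Longrightarrow> nq \<gamma> b \<in> poly_ring"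
  by (rule normal_quotient(1)[OF generator_invariant])

lemma nq: "\<gamma> \<in> R \<Longrightarrow> bform \<gamma> (grad (\<tau> b) x) = bform \<gamma> x * nq \<gamma> b x"
  by (rule normal_quotient(2)[OF generator_invariant])

lemma hess_root:
  assumes "\<gamma> \<in> R"
  shows "(hess b x *v \<gamma>) $ j = \<gamma> $ j * nq \<gamma> b x + bform \<gamma> x * partial j (nq \<gamma> b) x"
  unfolding partial_normal_derivative[OF generator_invariant assms, symmetric]
  by (simp add: matrix_vector_mult_def mult.commute)

text \<open>Two evaluations of the pairing of \<open>\<gamma>\<close> with H_b grad t^a, one through
  \<open>hess_root\<close> and one through the structure constants. The common factor
  \<open>bform \<gamma> x\<close> is cancelled so that the identity is available on the mirror
  itself.\<close>

lemma nq_product: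
  assumes \<gamma>: "\<gamma> \<in> R"
  shows "nq \<gamma> b x * nq \<gamma> a x + (\<Sum>j\<in>UNIV. partial j (nq \<gamma> b) x * partial j (\<tau> a) x)
    = (of_nat (d b) - 1) * (\<Sum>i\<in>UNIV. coef b a i x * nq \<gamma> i x)"
proof -
  have "(\<lambda>x. nq \<gamma> b x * nq \<gamma> a x + (\<Sum>j\<in>UNIV. partial j (nq \<gamma> b) x * partial j (\<tau> a) x))
    = (\<lambda>x. (of_nat (d b) - 1) * (\<Sum>i\<in>UNIV. coef b a i x * nq \<gamma> i x))"
  proof (rule poly_ring_cancel_bform[OF _ _ root_nonisotropic[OF \<gamma>]])
    fix x
    have "bform \<gamma> (hess b x *v grad (\<tau> a) x) = bform (grad (\<tau> a) x) (hess b x *v \<gamma>)"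
      by (rule bform_hess_symmetric)
    also have "\<dots> = bform \<gamma> (grad (\<tau> a) x) * nq \<gamma> b x
        + bform \<gamma> x * (\<Sum>j\<in>UNIV. partial j (nq \<gamma> b) x * partial j (\<tau> a) x)"
      unfolding bform_def[of "grad (\<tau> a) x"] hess_root[OF \<gamma>]
      by (simp add: bform_def[of \<gamma> "grad (\<tau> a) x"] distrib_left sum.distrib sum_distrib_left
          sum_distrib_right mult_ac)
    also have "\<dots> = bform \<gamma> x * (nq \<gamma> b x * nq \<gamma> a x + (\<Sum>j\<in>UNIV. partial j (nq \<gamma> b) x * partial j (\<tau> a) x))"
      unfolding nq[OF \<gamma>] by (simp add: algebra_simps)
    finally have 1: "bform \<gamma> (hess b x *v grad (\<tau> a) x) = \<dots>" .
    have "bform \<gamma> (hess b x *v grad (\<tau> a) x)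
        = (of_nat (d b) - 1) * (\<Sum>i\<in>UNIV. coef b a i x * bform \<gamma> (grad (\<tau> i) x))"
      unfolding bform_def hess_grad_coef sum_distrib_left
      by (subst sum.swap) (simp add: mult_ac)
    also have "\<dots> = bform \<gamma> x * ((of_nat (d b) - 1) * (\<Sum>i\<in>UNIV. coef b a i x * nq \<gamma> i x))"
      unfolding nq[OF \<gamma>] by (simp add: sum_distrib_left mult_ac)
    finally show "bform \<gamma> x * (nq \<gamma> b x * nq \<gamma> a x + (\<Sum>j\<in>UNIV. partial j (nq \<gamma> b) x * partial j (\<tau> a) x))
        = bform \<gamma> x * ((of_nat (d b) - 1) * (\<Sum>i\<in>UNIV. coef b a i x * nq \<gamma> i x))"
      unfolding 1 .
  qed (intro poly_ring_intros nq_poly[OF \<gamma>] coef_poly generator_poly)+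
  then show ?thesis by (rule fun_cong)
qed

text \<open>The difference of the two tensors contracted with grad t^b. The poles are absorbed in
  \<open>nq\<close>, so the entries are polynomial before the tensor itself is known to be.\<close>

definition defect :: "'n \<Rightarrow> 'n \<Rightarrow> 'n \<Rightarrow> complex^'n \<Rightarrow> complex" where
  "defect i j b x = hess b x $ i $ j / (of_nat (d b) - 1)
    - 1 / of_nat (d e) * (\<Sum>\<gamma>\<in>P. \<gamma> $ i * \<gamma> $ j * nq \<gamma> b x)"

lemma defect_poly: "defect i j b \<in> poly_ring"
  unfolding defect_def[abs_def] hess_nth using P_subset
  by (intro poly_ring_intros nq_poly generator_poly) auto

text \<open>
  A linear relation \<open>\<kappa>\<close> between the gradients at a generic point of the mirror of \<open>\<gamma>\<close> is unique up to
  scaling. Pairing it with the structure constants gives \<open>nq \<gamma> b = (d b - 1) m b\<close>, where \<open>m\<close> is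
  proportional to \<open>\<kappa> \<circ> star\<close>, and the symmetry \<open>d b + d (star b) = d e + 2\<close> fixes the residue.
\<close>

lemma defect_relation:
  assumes \<gamma>P: "\<gamma> \<in> P" and z: "generic_point z" "bform \<gamma> z = 0"
    and \<kappa>: "\<kappa> \<noteq> (\<lambda>b. 0)" and rel: "\<And>j. (\<Sum>b\<in>UNIV. \<kappa> b * partial j (\<tau> b) z) = 0"
  shows "(\<Sum>b\<in>UNIV. \<kappa> b * defect i j b z) = 0"
proof -
  have \<gamma>: "\<gamma> \<in> R" using \<gamma>P P_subset by blast
  define \<nu> where "\<nu> = (\<Sum>b\<in>UNIV. \<kappa> b * nq \<gamma> b z)"
  define \<mu> where "\<mu> = (\<Sum>b\<in>UNIV. \<kappa> b * nq \<gamma> b z / (of_nat (d b) - 1))"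
  \<comment> \<open>A relation that also annihilates the normal quotients is a row relation of the
    invertible \<open>mirror_jac\<close>. Hence \<open>\<nu>\<close> is nonzero, and any further
    relation is a multiple of \<open>\<kappa>\<close> whose factor is found by pairing with
    \<open>nq\<close>.\<close>
  have relation_zero: "\<rho> = (\<lambda>b. 0)"
    if "\<And>j. (\<Sum>b\<in>UNIV. \<rho> b * partial j (\<tau> b) z) = 0" "(\<Sum>b\<in>UNIV. \<rho> b * nq \<gamma> b z) = 0" for \<rho>
  proof (rule ccontr)
    obtain l where l: "\<gamma> $ l \<noteq> 0" using root_component[OF \<gamma>] by blast
    assume "\<rho> \<noteq> (\<lambda>b. 0)"
    moreover have "(\<Sum>b\<in>UNIV. \<rho> b * mirror_jac \<gamma> l z $ b $ j) = 0" for j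
      using that by (cases "j = l") (simp_all add: mirror_jac_def)
    ultimately have "det (mirror_jac \<gamma> l z) = 0" using row_relation_iff_det_0 by blast
    with det_mirror_jac_nonzero[OF \<gamma>P z l] show False by simp
  qed
  have \<nu>: "\<nu> \<noteq> 0"
    using relation_zero[OF rel] \<kappa> by (auto simp: \<nu>_def)
  have rel_grad: "(\<Sum>b\<in>UNIV. \<kappa> b * bform v (grad (\<tau> b) z)) = 0" for v
  proof -
    have "(\<Sum>b\<in>UNIV. \<kappa> b * bform v (grad (\<tau> b) z)) = (\<Sum>j\<in>UNIV. v $ j * (\<Sum>b\<in>UNIV. \<kappa> b * partial j (\<tau> b) z))"
      unfolding bform_def sum_distrib_left by (subst sum.swap) (simp add: mult_ac)
    then show ?thesis by (simp add: rel)
  qed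
  have hess_rel: "(\<Sum>b\<in>UNIV. \<kappa> b * (hess a z *v grad (\<tau> b) z) $ l) = 0" for a l
  proof -
    have "(hess a z *v v) $ l = bform (hess a z $ l) v" for v
      by (simp add: bform_def matrix_vector_mult_def)
    then show ?thesis by (simp add: rel_grad)
  qed
  \<comment> \<open>Applying H_a to the relation gives again a relation, with coefficients
    contracted from \<open>coef a\<close>; \<open>m a\<close> is its factor against
    \<open>\<kappa>\<close>.\<close>
  define m where "m a = (\<Sum>i\<in>UNIV. (\<Sum>b\<in>UNIV. \<kappa> b * coef a b i z) * nq \<gamma> i z) / \<nu>" for a
  have m: "(\<Sum>b\<in>UNIV. \<kappa> b * coef a b i z) = m a * \<kappa> i" for a i
  proof -
    define \<rho> where "\<rho> i = (\<Sum>b\<in>UNIV. \<kappa> b * coef a b i z)" for i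
    have \<rho>: "(\<Sum>i\<in>UNIV. \<rho> i * partial j (\<tau> i) z) = 0" for j
    proof -
      have "(of_nat (d a) - 1) * (\<Sum>i\<in>UNIV. \<rho> i * partial j (\<tau> i) z)
          = (\<Sum>b\<in>UNIV. \<kappa> b * (hess a z *v grad (\<tau> b) z) $ j)"
        unfolding hess_grad_coef \<rho>_def sum_distrib_left sum_distrib_right
        by (subst sum.swap) (simp add: mult_ac)
      then show ?thesis using hess_rel[of a j] degree_minus_1_nonzero[of a] by simp
    qed
    have m\<rho>: "m a * \<nu> = (\<Sum>i\<in>UNIV. \<rho> i * nq \<gamma> i z)" using \<nu> by (simp add: m_def \<rho>_def)
    have "(\<lambda>i. \<rho> i - m a * \<kappa> i) = (\<lambda>i. 0)"
    proof (rule relation_zero)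
      show "(\<Sum>b\<in>UNIV. (\<rho> b - m a * \<kappa> b) * partial j (\<tau> b) z) = 0" for j
        by (simp add: left_diff_distrib sum_subtractf \<rho> mult.assoc rel flip: sum_distrib_left)
      show "(\<Sum>b\<in>UNIV. (\<rho> b - m a * \<kappa> b) * nq \<gamma> b z) = 0"
        by (simp add: left_diff_distrib sum_subtractf mult.assoc m\<rho> \<nu>_def[symmetric] flip: sum_distrib_left)
    qed
    then show ?thesis by (simp add: fun_eq_iff \<rho>_def)
  qed
  \<comment> \<open>The contraction of \<open>nq_product\<close> with \<open>\<kappa>\<close>; the
    gradient of \<open>nq \<gamma> b\<close> drops out because it is paired with the
    relation.\<close>
  have nq_m: "nq \<gamma> b z = (of_nat (d b) - 1) * m b" for b
  proof -
    have "(\<Sum>a\<in>UNIV. \<kappa> a * (nq \<gamma> b z * nq \<gamma> a z + (\<Sum>j\<in>UNIV. partial j (nq \<gamma> b) z * partial j (\<tau> a) z)))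
        = nq \<gamma> b z * \<nu> + (\<Sum>a\<in>UNIV. \<kappa> a * bform (grad (nq \<gamma> b) z) (grad (\<tau> a) z))"
      by (simp add: distrib_left sum.distrib \<nu>_def bform_def sum_distrib_left mult_ac)
    also have "\<dots> = nq \<gamma> b z * \<nu>" unfolding rel_grad by simp
    finally have "nq \<gamma> b z * \<nu> = (\<Sum>a\<in>UNIV. \<kappa> a * ((of_nat (d b) - 1) * (\<Sum>i\<in>UNIV. coef b a i z * nq \<gamma> i z)))"
      unfolding nq_product[OF \<gamma>] by simp
    also have "\<dots> = (of_nat (d b) - 1) * (\<Sum>i\<in>UNIV. (\<Sum>a\<in>UNIV. \<kappa> a * coef b a i z) * nq \<gamma> i z)"
      unfolding sum_distrib_left sum_distrib_right by (subst sum.swap) (simp add: mult_ac)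
    also have "\<dots> = (of_nat (d b) - 1) * m b * \<nu>"
      unfolding m \<nu>_def by (simp add: sum_distrib_left mult_ac)
    finally show ?thesis using \<nu> by simp
  qed
  have m_star: "of_nat (d e) * (m a * \<kappa> e) = \<kappa> (star a)" for a
  proof -
    have "of_nat (d e) * (m a * \<kappa> e) = (\<Sum>b\<in>UNIV. \<kappa> b * (of_nat (d e) * coef a b e z))"
      unfolding m[symmetric] by (simp add: sum_distrib_left mult_ac)
    then show ?thesis by (simp add: coef_e if_distrib[of "\<lambda>u. _ * u"] cong: if_cong)
  qed
  have "\<kappa> e \<noteq> 0"
  proof
    assume "\<kappa> e = 0"
    then have "\<kappa> (star a) = 0" for a using m_star[of a] by simp
    then have "\<kappa> b = 0" for b using star_star by metis
    then show False using \<kappa> by (simp add: fun_eq_iff)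
  qed
  define H where "H = (of_nat (d e) :: complex)"
  define Q where "Q = (\<Sum>b\<in>UNIV. \<kappa> b * \<kappa> (star b))"
  have \<mu>Q: "H * \<kappa> e * \<mu> = Q"
  proof -
    have "H * \<kappa> e * \<mu> = (\<Sum>b\<in>UNIV. \<kappa> b * (H * (m b * \<kappa> e)))"
      unfolding \<mu>_def nq_m sum_distrib_left
      by (rule sum.cong) (auto simp: degree_ne_1)
    then show ?thesis unfolding H_def m_star Q_def .
  qed
  have "H * \<kappa> e * \<nu> = (\<Sum>b\<in>UNIV. (of_nat (d b) - 1) * (\<kappa> b * \<kappa> (star b)))"
  proof -
    have "H * \<kappa> e * \<nu> = (\<Sum>b\<in>UNIV. (of_nat (d b) - 1) * (\<kappa> b * (H * (m b * \<kappa> e))))"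
      unfolding \<nu>_def nq_m sum_distrib_left by (simp add: mult_ac)
    then show ?thesis unfolding H_def m_star .
  qed
  \<comment> \<open>Averaging over \<open>star\<close> replaces the weight d_b - 1 by half of d_e,
    by duality of the degrees. This is where the constant 1/h arises.\<close>
  moreover have "(\<Sum>b\<in>UNIV. (of_nat (d b) - 1) * (\<kappa> b * \<kappa> (star b)))
      = (\<Sum>b\<in>UNIV. (of_nat (d (star b)) - 1) * (\<kappa> b * \<kappa> (star b)))"
    by (rule sum.reindex_bij_witness[of _ star star]) (auto simp: star_star mult.commute)
  ultimately have "2 * (H * \<kappa> e * \<nu>)
      = (\<Sum>b\<in>UNIV. (of_nat (d b) - 1 + (of_nat (d (star b)) - 1)) * (\<kappa> b * \<kappa> (star b)))"
    unfolding distrib_right sum.distrib by simp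
  also have "\<dots> = H * Q"
    unfolding degree_star Q_def H_def by (simp add: sum_distrib_left)
  finally have "(H * \<kappa> e) * (2 * \<nu>) = (H * \<kappa> e) * (H * \<mu>)" using \<mu>Q by (simp add: mult_ac)
  moreover have "H \<noteq> 0" using degree_e_nonzero by (simp add: H_def)
  ultimately have \<mu>\<nu>: "2 * \<nu> = H * \<mu>" using \<open>\<kappa> e \<noteq> 0\<close> by simp
  \<comment> \<open>The Hessian part of the contracted defect. It kills the gradients at
    \<open>z\<close>, which span the mirror, and scales \<open>\<gamma>\<close> by
    \<open>\<mu>\<close>, so it is \<open>\<mu> / 2\<close> times the tensor square of
    \<open>\<gamma>\<close>.\<close>
  define Y where "Y = (\<chi> i j. \<Sum>b\<in>UNIV. \<kappa> b * (hess b z $ i $ j / (of_nat (d b) - 1)))"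
  have Y: "(Y *v v) $ i = (\<Sum>b\<in>UNIV. \<kappa> b * ((hess b z *v v) $ i / (of_nat (d b) - 1)))" for v i
  proof -
    have "(Y *v v) $ i = (\<Sum>j\<in>UNIV. \<Sum>b\<in>UNIV. \<kappa> b * (hess b z $ i $ j / (of_nat (d b) - 1)) * v $ j)"
      by (simp add: Y_def matrix_vector_mult_def sum_distrib_right)
    also have "\<dots> = (\<Sum>b\<in>UNIV. \<Sum>j\<in>UNIV. \<kappa> b * (hess b z $ i $ j / (of_nat (d b) - 1)) * v $ j)"
      by (rule sum.swap)
    also have "\<dots> = (\<Sum>b\<in>UNIV. \<kappa> b * ((hess b z *v v) $ i / (of_nat (d b) - 1)))"
      by (simp add: matrix_vector_mult_def sum_distrib_left sum_divide_distrib mult.assoc)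
    finally show ?thesis .
  qed
  have Y_grad: "Y *v grad (\<tau> a) z = 0" for a
  proof -
    have "(hess b z *v grad (\<tau> a) z) $ i / (of_nat (d b) - 1)
        = (hess a z *v grad (\<tau> b) z) $ i / (of_nat (d a) - 1)" for b i
      using fun_cong[OF coef_commute[of a b], of _] degree_minus_1_nonzero
      by (simp add: hess_grad_coef coef_commute[of b a])
    then have "(Y *v grad (\<tau> a) z) $ i
        = (\<Sum>b\<in>UNIV. \<kappa> b * (hess a z *v grad (\<tau> b) z) $ i) / (of_nat (d a) - 1)" for i
      unfolding Y by (simp add: sum_divide_distrib)
    then show ?thesis by (simp add: hess_rel vec_eq_iff)
  qed
  have Y_tangent: "Y *v u = 0" if u: "bform \<gamma> u = 0" for u
  proof -
    obtain f where f: "f \<in> invariants W" "\<And>a. partial a f z = u $ a"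
      using invariant_with_mirror_jet[OF \<gamma>P z u] by blast
    have "u = (\<Sum>i\<in>UNIV. D i f z *s grad (\<tau> i) z)"
      using f(2) by (simp add: vec_eq_iff partial_eq_D[OF f(1)])
    then show ?thesis
      by (simp add: vec.linear_sum[OF matrix_vector_mul_linear_gen] vector_scalar_commute Y_grad)
  qed
  have Y_root: "Y *v \<gamma> = \<mu> *s \<gamma>"
    by (simp add: vec_eq_iff Y hess_root[OF \<gamma>] z(2) \<mu>_def sum_distrib_left mult_ac)
  have Y_entry: "Y $ i $ j = \<mu> / 2 * \<gamma> $ i * \<gamma> $ j"
  proof -
    let ?u = "axis j 1 - (\<gamma> $ j / 2) *s \<gamma>"
    have "bform \<gamma> ?u = 0"
      by (simp add: bform_simps bform_axis root_norm[OF \<gamma>])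
    then have "Y *v ?u = 0" by (rule Y_tangent)
    then have "Y *v axis j 1 = (\<gamma> $ j / 2) *s (\<mu> *s \<gamma>)"
      by (simp add: matrix_vector_mult_diff_distrib vector_scalar_commute Y_root)
    then have "(Y *v axis j 1) $ i = \<gamma> $ j / 2 * (\<mu> * \<gamma> $ i)" by simp
    moreover have "(Y *v axis j 1) $ i = Y $ i $ j"
      using bform_axis[of "Y $ i" j] by (simp only: matrix_vector_mult_def bform_def vec_lambda_beta)
    ultimately show ?thesis by (simp add: mult_ac)
  qed
  have other: "(\<Sum>b\<in>UNIV. \<kappa> b * nq \<delta> b z) = 0" if "\<delta> \<in> P" "\<delta> \<noteq> \<gamma>" for \<delta>
  proof -
    have \<delta>: "\<delta> \<in> R" using that P_subset by blast
    have "bform \<delta> z \<noteq> 0" using z that \<gamma>P unfolding generic_point_def by blast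
    moreover have "bform \<delta> z * (\<Sum>b\<in>UNIV. \<kappa> b * nq \<delta> b z) = (\<Sum>b\<in>UNIV. \<kappa> b * bform \<delta> (grad (\<tau> b) z))"
      unfolding nq[OF \<delta>] by (simp add: sum_distrib_left mult_ac)
    ultimately show ?thesis using rel_grad[of \<delta>] by simp
  qed
  have "(\<Sum>b\<in>UNIV. \<kappa> b * defect i j b z)
      = Y $ i $ j - 1 / H * (\<Sum>\<delta>\<in>P. \<delta> $ i * \<delta> $ j * (\<Sum>b\<in>UNIV. \<kappa> b * nq \<delta> b z))"
  proof -
    have "(\<Sum>b\<in>UNIV. \<kappa> b * (\<Sum>\<delta>\<in>P. \<delta> $ i * \<delta> $ j * nq \<delta> b z))
        = (\<Sum>\<delta>\<in>P. \<delta> $ i * \<delta> $ j * (\<Sum>b\<in>UNIV. \<kappa> b * nq \<delta> b z))"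
      unfolding sum_distrib_left by (subst sum.swap) (simp add: mult_ac)
    then show ?thesis
      by (simp add: defect_def Y_def H_def right_diff_distrib sum_subtractf sum_divide_distrib[symmetric])
  qed
  also have "(\<Sum>\<delta>\<in>P. \<delta> $ i * \<delta> $ j * (\<Sum>b\<in>UNIV. \<kappa> b * nq \<delta> b z)) = \<gamma> $ i * \<gamma> $ j * \<nu>"
  proof -
    have "(\<Sum>\<delta>\<in>P. \<delta> $ i * \<delta> $ j * (\<Sum>b\<in>UNIV. \<kappa> b * nq \<delta> b z))
        = \<gamma> $ i * \<gamma> $ j * (\<Sum>b\<in>UNIV. \<kappa> b * nq \<gamma> b z)"
      using finite_P \<gamma>P other by (subst sum.remove[of P \<gamma>]) (auto intro!: sum.neutral)
    then show ?thesis by (simp add: \<nu>_def)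
  qed
  also have "Y $ i $ j - 1 / H * (\<gamma> $ i * \<gamma> $ j * \<nu>) = (H * \<mu> - 2 * \<nu>) / (2 * H) * \<gamma> $ i * \<gamma> $ j"
    using \<open>H \<noteq> 0\<close> by (simp add: Y_entry field_simps)
  also have "\<dots> = 0" by (simp add: \<mu>\<nu>)
  finally show ?thesis .
qed

lemma defect_scale: "s\<^sup>2 * defect i j b (s *s x) = s ^ d b * defect i j b x"
proof (cases "s = 0")
  case True
  then show ?thesis using degree_ge_2[of b] by simp
next
  case s: False
  have grad_scale: "s * partial j (\<tau> b) (s *s x) = s ^ d b * partial j (\<tau> b) x" for j x
    by (rule partial_homogeneous[OF generator_poly generator_scale])
  have "s\<^sup>2 * partial i (partial j (\<tau> b)) (s *s x) = s ^ d b * partial i (partial j (\<tau> b)) x"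
  proof -
    have p: "(\<lambda>x. partial j (\<tau> b) (s *s x)) \<in> poly_ring"
      by (rule poly_ring_compose[OF partial_generator_poly]) (auto intro!: poly_ring_intros)
    have "partial i (\<lambda>x. s * partial j (\<tau> b) (s *s x)) x = partial i (\<lambda>x. s ^ d b * partial j (\<tau> b) x) x"
      unfolding grad_scale ..
    then have "s * (s * partial i (partial j (\<tau> b)) (s *s x)) = s ^ d b * partial i (partial j (\<tau> b)) x"
      unfolding partial_cmult[OF p] partial_cmult[OF partial_generator_poly]
        partial_scale[OF partial_generator_poly] .
    then show ?thesis by (simp add: power2_eq_square mult.assoc)
  qed
  moreover have "s\<^sup>2 * nq \<gamma> b (s *s x) = s ^ d b * nq \<gamma> b x" if "\<gamma> \<in> P" for \<gamma>
  proof -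
    have \<gamma>: "\<gamma> \<in> R" using that P_subset by blast
    have "(\<lambda>x. s\<^sup>2 * nq \<gamma> b (s *s x)) = (\<lambda>x. s ^ d b * nq \<gamma> b x)"
    proof (rule poly_ring_cancel_bform[OF _ _ root_nonisotropic[OF \<gamma>]])
      have "(\<lambda>x. nq \<gamma> b (s *s x)) \<in> poly_ring"
        by (rule poly_ring_compose[OF nq_poly[OF \<gamma>]]) (auto intro!: poly_ring_intros)
      then show "(\<lambda>x. s\<^sup>2 * nq \<gamma> b (s *s x)) \<in> poly_ring" by (intro poly_ring_intros)
      show "(\<lambda>x. s ^ d b * nq \<gamma> b x) \<in> poly_ring" by (intro poly_ring_intros nq_poly[OF \<gamma>])
      fix x
      have "bform \<gamma> x * (s\<^sup>2 * nq \<gamma> b (s *s x)) = s * bform \<gamma> (grad (\<tau> b) (s *s x))"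
        unfolding nq[OF \<gamma>] by (simp add: bform_scale power2_eq_square)
      also have "\<dots> = (\<Sum>i\<in>UNIV. \<gamma> $ i * (s * partial i (\<tau> b) (s *s x)))"
        by (simp add: bform_def sum_distrib_left mult_ac)
      also have "\<dots> = s ^ d b * bform \<gamma> (grad (\<tau> b) x)"
        unfolding grad_scale by (simp add: bform_def sum_distrib_left mult_ac)
      finally show "bform \<gamma> x * (s\<^sup>2 * nq \<gamma> b (s *s x)) = bform \<gamma> x * (s ^ d b * nq \<gamma> b x)"
        unfolding nq[OF \<gamma>] by (simp add: mult_ac)
    qed
    then show ?thesis by (rule fun_cong)
  qed
  moreover have "s\<^sup>2 * defect i j b (s *s x)
      = s\<^sup>2 * partial i (partial j (\<tau> b)) (s *s x) / (of_nat (d b) - 1)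
        - 1 / of_nat (d e) * (\<Sum>\<gamma>\<in>P. \<gamma> $ i * \<gamma> $ j * (s\<^sup>2 * nq \<gamma> b (s *s x)))"
    by (simp add: defect_def right_diff_distrib sum_distrib_left mult_ac)
  ultimately show ?thesis
    by (simp add: defect_def right_diff_distrib sum_distrib_left mult_ac)
qed

theorem hess_eq_normal_quotients:
  "partial i (partial j (\<tau> b)) x
    = (of_nat (d b) - 1) / of_nat (d e) * (\<Sum>\<gamma>\<in>P. \<gamma> $ i * \<gamma> $ j * nq \<gamma> b x)"
proof -
  obtain Q where Q: "\<And>l. Q l \<in> poly_ring"
    "\<And>b x. defect i j b x = (\<Sum>l\<in>UNIV. Q l x * partial l (\<tau> b) x)"
  proof -
    have "\<exists>Q. (\<forall>l. Q l \<in> poly_ring) \<and> (\<forall>b x. defect i j b x = (\<Sum>l\<in>UNIV. Q l x * partial l (\<tau> b) x))"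
      by (rule column_eq_jac_mult[OF defect_poly], rule defect_relation)
    then show ?thesis using that by blast
  qed
  \<comment> \<open>The defect has degree d_b - 2 and grad t^b degree d_b - 1. Where the Jacobian is
    invertible this forces degree -1 on \<open>Q\<close>.\<close>
  have Q_scale: "s * Q l (s *s x) = Q l x" if s: "s \<noteq> 0" for s l x
  proof -
    have "(\<lambda>x. s * Q l (s *s x)) = Q l"
    proof (rule poly_ring_cancel[OF det_jac_poly _ Q(1) det_jac_nonzero_poly])
      have "(\<lambda>x. Q l (s *s x)) \<in> poly_ring"
        by (rule poly_ring_compose[OF Q(1)]) (auto intro!: poly_ring_intros)
      then show "(\<lambda>x. s * Q l (s *s x)) \<in> poly_ring" by (intro poly_ring_intros)
      fix x assume nz: "det (jac x) \<noteq> 0"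
      let ?c = "\<chi> l. s * Q l (s *s x) - Q l x"
      have "(jac x *v ?c) $ b = 0" for b
      proof -
        have "s ^ d b * (\<Sum>l\<in>UNIV. s * Q l (s *s x) * partial l (\<tau> b) x)
            = (\<Sum>l\<in>UNIV. s * Q l (s *s x) * (s * partial l (\<tau> b) (s *s x)))"
          unfolding partial_homogeneous[OF generator_poly generator_scale]
          by (simp add: sum_distrib_left mult_ac)
        also have "\<dots> = s\<^sup>2 * defect i j b (s *s x)"
          unfolding Q(2) by (simp add: sum_distrib_left power2_eq_square mult_ac)
        also have "\<dots> = s ^ d b * (\<Sum>l\<in>UNIV. Q l x * partial l (\<tau> b) x)"
          using defect_scale[of s i j b x] unfolding Q(2) .
        finally have "(\<Sum>l\<in>UNIV. s * Q l (s *s x) * partial l (\<tau> b) x) = (\<Sum>l\<in>UNIV. Q l x * partial l (\<tau> b) x)"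
          using s by simp
        then show ?thesis
          by (simp add: matrix_vector_mult_def right_diff_distrib sum_subtractf mult.commute)
      qed
      then have "jac x *v ?c = 0" by (simp add: vec_eq_iff)
      moreover have "inj ((*v) (jac x))"
        using nz by (simp add: inj_matrix_vector_mult invertible_det_nz)
      ultimately have "?c = 0" by (metis injD matrix_vector_mult_0_right)
      then show "s * Q l (s *s x) = Q l x" by (simp add: vec_eq_iff)
    qed
    then show ?thesis by (rule fun_cong)
  qed
  have "Q l x = 0" for l
    using Q(1) Q_scale by (rule poly_ring_scale_zero)
  then have "defect i j b x = 0" unfolding Q(2) by simp
  then show ?thesis
    using degree_minus_1_nonzero[of b] by (simp add: defect_def field_simps)
qed

end

section \<open>Dunkl operators\<close>

context reflection_group
begin

lemma divdiff_eqI: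
  assumes "\<gamma> \<in> R" "f \<in> poly_ring" "q \<in> poly_ring"
    "\<And>x. bform \<gamma> x * q x = f x - f (reflection \<gamma> x)"
  shows "divdiff \<gamma> f = q"
  unfolding divdiff_def
  using divdiff_ex1[OF assms(2) root_nonisotropic[OF assms(1)]] assms
  by (intro the1_equality) (simp_all add: act_def inv_reflection root_nonisotropic)

lemma divdiff_invariant:
  assumes "f \<in> invariants W" "\<gamma> \<in> R"
  shows "divdiff \<gamma> f = (\<lambda>x. 0)"
  using assms by (intro divdiff_eqI) (auto simp: invariants_iff)

text \<open>By equivariance of the gradient, the difference of \<open>partial j f\<close> and its
  reflection is \<open>\<gamma> $ j\<close> times the normal derivative, so Dunkl operators produce
  exactly the normal quotients.\<close>

lemma divdiff_partial_invariant:
  assumes "f \<in> invariants W" "\<gamma> \<in> R"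
  shows "divdiff \<gamma> (partial j f) = (\<lambda>x. \<gamma> $ j * normal_quotient \<gamma> f x)"
proof (rule divdiff_eqI[OF assms(2)])
  show "bform \<gamma> x * (\<gamma> $ j * normal_quotient \<gamma> f x)
      = partial j f x - partial j f (reflection \<gamma> x)" for x
    by (simp add: partial_invariant_reflection[OF assms] normal_quotient(2)[OF assms])
qed (intro poly_ring_intros invariants_poly assms normal_quotient)+

lemma dunkl_invariant:
  assumes "f \<in> invariants W"
  shows "dunkl P c j f = partial j f"
proof -
  have "divdiff \<gamma> f = (\<lambda>x. 0)" if "\<gamma> \<in> P" for \<gamma>
    using divdiff_invariant[OF assms] that P_subset by blast
  then show ?thesis by (simp add: dunkl_def fun_eq_iff)
qed

lemma dunkl_partial_invariant:
  assumes "f \<in> invariants W"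
  shows "dunkl P c i (partial j f) x
    = partial i (partial j f) x - c * (\<Sum>\<gamma>\<in>P. \<gamma> $ i * \<gamma> $ j * normal_quotient \<gamma> f x)"
proof -
  have "divdiff \<gamma> (partial j f) = (\<lambda>x. \<gamma> $ j * normal_quotient \<gamma> f x)" if "\<gamma> \<in> P" for \<gamma>
    using divdiff_partial_invariant[OF assms] that P_subset by blast
  then show ?thesis by (simp add: dunkl_def mult.assoc)
qed

end

text \<open>Saito's condition differentiates a polynomial \<open>G\<close> in auxiliary variables;
  this identifies that derivative, at the values of the generators, with \<open>D i\<close>.
  Differentiability is carried along so that the product rule applies in the induction.\<close>

lemma (in invariant_generators) D_polynomial_in_generators:
  assumes "bij_betw idx UNIV M" "\<And>i. \<tau> i = t (idx i)"
    and "G \<in> alg_gen ((\<lambda>\<mu> (y :: nat \<Rightarrow> complex). y \<mu>) ` M)"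
  shows "(\<lambda>x. G (\<lambda>\<mu>. t \<mu> x)) \<in> invariants W"
    and "((\<lambda>z. G ((\<lambda>\<mu>. t \<mu> x)(idx i := z))) has_field_derivative
      D i (\<lambda>x. G (\<lambda>\<mu>. t \<mu> x)) x) (at (t (idx i) x))"
proof -
  have "(\<lambda>x. G (\<lambda>\<mu>. t \<mu> x)) \<in> invariants W \<and>
    (\<forall>i x. ((\<lambda>z. G ((\<lambda>\<mu>. t \<mu> x)(idx i := z))) has_field_derivative
      D i (\<lambda>x. G (\<lambda>\<mu>. t \<mu> x)) x) (at (t (idx i) x)))"
    using assms(3)
  proof induction
    case (const a)
    then show ?case by (simp add: invariant_const D_const)
  next
    case (gen f)
    then obtain \<mu> where "\<mu> \<in> M" and f: "f = (\<lambda>y. y \<mu>)" by auto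
    then obtain k where k: "\<mu> = idx k" using assms(1) by (auto simp: bij_betw_def)
    have "idx k = idx i \<longleftrightarrow> k = i" for i
      using assms(1) by (auto simp: bij_betw_def inj_def)
    moreover have "(\<lambda>x. t (idx k) x) = \<tau> k" by (simp add: assms(2))
    ultimately show ?case
      by (auto simp: f k generator_invariant D_generator)
  next
    case (add f g)
    then show ?case by (auto simp: invariant_add D_add intro: DERIV_add)
  next
    case (mult f g)
    have triv: "(\<lambda>\<mu>. t \<mu> x)(idx i := t (idx i) x) = (\<lambda>\<mu>. t \<mu> x)" for i x by auto
    have "((\<lambda>z. f ((\<lambda>\<mu>. t \<mu> x)(idx i := z)) * g ((\<lambda>\<mu>. t \<mu> x)(idx i := z))) has_field_derivative
      D i (\<lambda>x. f (\<lambda>\<mu>. t \<mu> x)) x * g (\<lambda>\<mu>. t \<mu> x) + D i (\<lambda>x. g (\<lambda>\<mu>. t \<mu> x)) x * f (\<lambda>\<mu>. t \<mu> x))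
      (at (t (idx i) x))" for i x
      using DERIV_mult[OF mult.IH(1)[THEN conjunct2, rule_format, of x i]
          mult.IH(2)[THEN conjunct2, rule_format, of x i]]
      by (simp only: triv)
    moreover have inv: "(\<lambda>x. f (\<lambda>\<mu>. t \<mu> x)) \<in> invariants W" "(\<lambda>x. g (\<lambda>\<mu>. t \<mu> x)) \<in> invariants W"
      using mult.IH by blast+
    ultimately show ?case
      by (simp only: invariant_mult D_mult mult.commute) blast
  qed
  then show "(\<lambda>x. G (\<lambda>\<mu>. t \<mu> x)) \<in> invariants W"
    "((\<lambda>z. G ((\<lambda>\<mu>. t \<mu> x)(idx i := z))) has_field_derivative
      D i (\<lambda>x. G (\<lambda>\<mu>. t \<mu> x)) x) (at (t (idx i) x))" by blast+
qed

theorem corollary14: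
  fixes R P :: "(complex^'n) set"
    and W :: "(complex^'n \<Rightarrow> complex^'n) set"
    and d :: "nat \<Rightarrow> nat"
    and t :: "nat \<Rightarrow> complex^'n \<Rightarrow> complex"
    and \<beta> h :: nat
    and c :: complex
  assumes "coxeter_root_system R" and "irreducible_roots R"
    and "W = coxeter_group R"
    and "positive_roots R P"
    and "group_degrees W d" and "h = d 1"
    and "saito_polynomials W d t"
    and "\<beta> \<in> {1..CARD('n)}"
    and "c = (of_nat (d \<beta>) - 1) / of_nat h"
  shows "\<forall>i j. dunkl P c i (dunkl P c j (t \<beta>)) = dunkl P c i (partial j (t \<beta>)) \<and>
               dunkl P c i (partial j (t \<beta>)) = (\<lambda>x. 0)"
proof -
  let ?n = "CARD('n)"
  interpret reflection_group R P
    by unfold_locales (fact assms)+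
  \<comment> \<open>The polynomials are numbered from 1 to n, whereas square matrices require the
    index type; \<open>el\<close> and its inverse \<open>idx\<close> translate.\<close>
  obtain el :: "nat \<Rightarrow> 'n" where el: "bij_betw el {1..?n} UNIV"
    using ex_bij_betw_nat_finite_1[of "UNIV :: 'n set"] by auto
  define idx where "idx = inv_into {1..?n} el"
  have idx: "bij_betw idx UNIV {1..?n}"
    unfolding idx_def using el by (rule bij_betw_inv_into)
  have idx_mem: "1 \<le> idx i" "idx i \<le> ?n" for i
    using idx by (auto simp: bij_betw_def)
  have idx_el: "idx (el k) = k" if "1 \<le> k" "k \<le> ?n" for k
    unfolding idx_def using el that by (auto simp: bij_betw_def)
  have el_idx: "el (idx i) = i" for i
    unfolding idx_def using el by (simp add: bij_betw_def f_inv_into_f)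
  have basic: "basic_invariants W d t"
    and saito: "\<And>\<alpha> \<beta>. \<alpha> \<in> {1..?n} \<Longrightarrow> \<beta> \<in> {1..?n} \<Longrightarrow>
      \<exists>G \<in> alg_gen ((\<lambda>\<mu> (y :: nat \<Rightarrow> complex). y \<mu>) ` {1..?n}).
        (\<forall>x. (\<Sum>a\<in>UNIV. partial a (t \<alpha>) x * partial a (t \<beta>) x) = G (\<lambda>\<mu>. t \<mu> x)) \<and>
        (\<forall>y. deriv (\<lambda>z. G (y(1 := z))) (y 1) = (if \<alpha> + \<beta> = ?n + 1 then 1 else 0))"
    using assms(7) unfolding saito_polynomials_def by blast+
  have range: "range (\<lambda>i. t (idx i)) = t ` {1..?n}"
    using idx by (metis bij_betw_def image_image)
  interpret invariant_generators R P "\<lambda>i. t (idx i)" "\<lambda>i. d (idx i)"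
    by unfold_locales
      (use basic idx_mem in \<open>auto simp: range basic_invariants_def assms(3)\<close>)
  define star where "star i = el (?n + 1 - idx i)" for i
  have idx_star: "idx (star i) = ?n + 1 - idx i" for i
    unfolding star_def using idx_mem[of i] by (intro idx_el) auto
  interpret saito_generators R P "\<lambda>i. t (idx i)" "\<lambda>i. d (idx i)" star "el 1"
  proof unfold_locales
    show "star (star i) = i" for i
    proof -
      have "idx (star (star i)) = idx i" using idx_mem[of i] by (simp add: idx_star)
      then show ?thesis using el_idx by metis
    qed
    fix a b
    have idx1: "idx (el 1) = 1" by (rule idx_el) (auto simp: Suc_leI)
    obtain G where G: "G \<in> alg_gen ((\<lambda>\<mu> (y :: nat \<Rightarrow> complex). y \<mu>) ` {1..?n})"
      "\<And>x. met a b x = G (\<lambda>\<mu>. t \<mu> x)"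
      "\<And>y. deriv (\<lambda>z. G (y(1 := z))) (y 1) = (if idx a + idx b = ?n + 1 then 1 else 0)"
      using saito[of "idx a" "idx b"] idx_mem unfolding met_def by auto
    have "idx a + idx b = ?n + 1 \<longleftrightarrow> idx b = idx (star a)"
      using idx_mem[of a] by (auto simp: idx_star)
    also have "\<dots> \<longleftrightarrow> b = star a" using el_idx by metis
    finally have iff: "idx a + idx b = ?n + 1 \<longleftrightarrow> b = star a" .
    have met: "met a b = (\<lambda>x. G (\<lambda>\<mu>. t \<mu> x))" using G(2) by blast
    show "D (el 1) (met a b) = (\<lambda>x. if b = star a then 1 else 0)"
    proof
      fix x
      have "D (el 1) (met a b) x = deriv (\<lambda>z. G ((\<lambda>\<mu>. t \<mu> x)(1 := z))) (t 1 x)"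
        using DERIV_imp_deriv[OF D_polynomial_in_generators(2)[OF idx HOL.refl G(1), of x "el 1"]]
        unfolding idx1 met by (rule sym)
      then show "D (el 1) (met a b) x = (if b = star a then 1 else 0)"
        using G(3)[of "\<lambda>\<mu>. t \<mu> x"] unfolding iff by simp
    qed
  qed
  define b where "b = el \<beta>"
  have b: "idx b = \<beta>" unfolding b_def using assms(8) by (intro idx_el) auto
  have h: "idx (el 1) = 1" by (rule idx_el) (auto simp: Suc_leI)
  have inv: "t \<beta> \<in> invariants (coxeter_group R)"
    using generator_invariant[of b] by (simp add: b)
  have "dunkl P c i (partial j (t \<beta>)) x = 0" for i j x
    using hess_eq_normal_quotients[of i j b x, unfolded b h]
    by (simp add: dunkl_partial_invariant[OF inv] assms(6,9))
  then show ?thesis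
    by (simp add: dunkl_invariant[OF inv] fun_eq_iff)
qed

end
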